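(* Let $f_1,\dots,f_m$ be polynomials in $z=(z_1,\dots,z_n)$ with complex coefficients, each completely nonvanishing on the positive orthant $\mathbb{R}^n_+=(0,\infty)^n$, and suppose that the Newton polytope $\Delta_{f_1\cdots f_m}$ is of full dimension $n$. Then the Euler--Mellin integral $$M_f(s,t)=\int_{\mathbb{R}_+^n}\frac{z^s}{f(z)^t}\,\frac{dz_1\wedge\cdots\wedge dz_n}{z_1\cdots z_n}$$ admits a meromorphic continuation (to $(s,t)\in\mathbb{C}^{n+m}$) of the form $$M_f(s,t)=\Phi_f(s,t)\prod_{k=1}^N\Gamma\bigl(\langle\mu_k,s\rangle-\langle\nu_k,t\rangle\bigr),$$ where $\Phi_f(s,t)$ is an entire function and the vectors $\mu_k$, $\nu_k$ ($1\le k\le N$) are those obtained, as described in the context, from the halfspace presentations of the Newton polytopes $\Delta_{f_1},\dots,\Delta_{f_m}$, giving the presentation $$\tau\Delta_f=\bigcap_{k=1}^N\bigl\{\sigma\in\mathbb{R}^n\mid\langle\mu_k,\sigma\rangle\ge\langle\nu_k,\tau\rangle\bigr\}.$$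
   Context: Notation: for $s\in\mathbb{C}^n$ and $t\in\mathbb{C}^m$, $z^s:=z_1^{s_1}\cdots z_n^{s_n}$ and $f(z)^t:=f_1(z)^{t_1}\cdots f_m(z)^{t_m}$. On $\mathbb{R}^n_+$ one uses $z^s=e^{\langle s,\log z\rangle}$ with real logarithms, and $f_i^{t_i}=\exp(t_i\log f_i)$ for a fixed continuous branch of $\log f_i$ on the simply connected set $\mathbb{R}^n_+$, where $f_i$ has no zeros. $\Gamma(\cdot)$ is the Gamma function. For a polynomial $g=\sum_{\alpha\in\operatorname{supp}(g)}c_\alpha z^\alpha$, $\Delta_g$ is its Newton polytope, the convex hull of $\operatorname{supp}(g)$ in $\mathbb{R}^n$. For a face $F$ of $\Delta_g$ (including $\Delta_g$ itself), the truncated polynomial is $g_F:=\sum_{\alpha\in F\cap\operatorname{supp}(g)}c_\alpha z^\alpha$. The polynomial $g$ is completely nonvanishing on a set $X$ if for each face $F$ of $\Delta_g$ the polynomial $g_F$ has no zeros on $X$. For $\tau\in\mathbb{R}^m_+$, $\tau\Delta_f:=\sum_{i=1}^m\tau_i\Delta_{f_i}$ (weighted Minkowski sum); for $\tau=(1,\dots,1)$ this is $\Delta_{f_1\cdots f_m}$. The original integral $M_f(s,t)$ converges for $\operatorname{Re}t=\tau\in\mathbb{R}^m_+$ and $\operatorname{Re}s\in\operatorname{int}(\tau\Delta_f)$, and it is this function that is continued. The vectors $\mu_k,\nu_k$: each Newton polytope $\Delta_{f_i}$ is written as the intersection of a finite number of halfspaces $$\Delta_{f_i}=\bigcap_{j=1}^{N_i}\bigl\{\sigma\in\mathbb{R}^n\mid\langle\mu^i_j,\sigma\rangle\ge\nu^i_j\bigr\},$$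 where the $\mu^i_j$ are primitive integer vectors. Fixing an order, $\{\mu_1,\dots,\mu_N\}$ is the set $\{\mu^i_j\mid 1\le i\le m,\ 1\le j\le N_i\}$, with the $\mu_k$ pairwise distinct. For each $k$, $\nu_k:=(\nu_k^1,\dots,\nu_k^m)$ with $\nu_k^i:=\min\{\langle\mu_k,\alpha\rangle\mid\alpha\in\Delta_{f_i}\}$. The displayed presentation of $\tau\Delta_f$ is stated to follow from this definition.
   Formalization: The displayed presentation of τΔ_f does not follow from arbitrary presentations of the Δ_{f_i} (it can fail for n≥3, m≥2); it is required of the chosen μ_k, ν_k, and presentations satisfying it are shown to exist. *)

theory Defs
  imports "HOL-Analysis.Analysis" "HOL-Library.Poly_Mapping"
begin

text \<open>Polynomials in variables indexed by \<open>'n\<close>, as finitely supported functions from exponents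
  to coefficients. The ring operations are those of \<open>HOL-Library.Poly_Mapping\<close>
  (multiplication is convolution), and \<open>Poly_Mapping.keys\<close> is the support.\<close>

type_synonym 'n cpoly = "('n \<Rightarrow>\<^sub>0 nat) \<Rightarrow>\<^sub>0 complex"

definition eval_poly :: "'n::finite cpoly \<Rightarrow> complex ^ 'n \<Rightarrow> complex" where
  "eval_poly g z = (\<Sum>\<alpha>\<in>Poly_Mapping.keys g.
     Poly_Mapping.lookup g \<alpha> * (\<Prod>i\<in>UNIV. (z $ i) ^ Poly_Mapping.lookup \<alpha> i))"

definition exponent_vec :: "('n::finite \<Rightarrow>\<^sub>0 nat) \<Rightarrow> real ^ 'n" where
  "exponent_vec \<alpha> = (\<chi> i. real (Poly_Mapping.lookup \<alpha> i))"

definition newton_polytope :: "'n::finite cpoly \<Rightarrow> (real ^ 'n) set" where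
  "newton_polytope g = convex hull (exponent_vec ` Poly_Mapping.keys g)"

definition truncated_poly :: "(real ^ 'n) set \<Rightarrow> 'n::finite cpoly \<Rightarrow> 'n cpoly" where
  "truncated_poly F g =
     (\<Sum>\<alpha>\<in>{\<alpha> \<in> Poly_Mapping.keys g. exponent_vec \<alpha> \<in> F}.
       Poly_Mapping.single \<alpha> (Poly_Mapping.lookup g \<alpha>))"

text \<open>The library's \<open>face_of\<close> counts the empty set as a face. Its truncation is \<open>0\<close>, so it has to
  be left out, unless it is the whole Newton polytope, i.e. \<open>g = 0\<close>.\<close>

definition completely_nonvanishing_on :: "'n::finite cpoly \<Rightarrow> (complex ^ 'n) set \<Rightarrow> bool" where
  "completely_nonvanishing_on g X \<longleftrightarrow>
     (\<forall>F. F face_of newton_polytope g \<and> (F \<noteq> {} \<or> F = newton_polytope g) \<longrightarrow>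
        (\<forall>z\<in>X. eval_poly (truncated_poly F g) z \<noteq> 0))"

definition orthant :: "(real ^ 'n::finite) set" where
  "orthant = {x. \<forall>i. 0 < x $ i}"

definition complex_vec :: "real ^ 'n::finite \<Rightarrow> complex ^ 'n" where
  "complex_vec x = (\<chi> i. complex_of_real (x $ i))"

definition real_vec :: "int ^ 'n::finite \<Rightarrow> real ^ 'n" where
  "real_vec \<mu> = (\<chi> i. real_of_int (\<mu> $ i))"

definition Re_vec :: "complex ^ 'n::finite \<Rightarrow> real ^ 'n" where
  "Re_vec s = (\<chi> i. Re (s $ i))"

text \<open>The bilinear (not sesquilinear) pairing of a real vector with a complex one.\<close>

definition pairing :: "real ^ 'n::finite \<Rightarrow> complex ^ 'n \<Rightarrow> complex" where
  "pairing u s = (\<Sum>i\<in>UNIV. complex_of_real (u $ i) * s $ i)"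

definition weighted_minkowski_sum ::
    "real ^ 'm::finite \<Rightarrow> ('m \<Rightarrow> 'n::finite cpoly) \<Rightarrow> (real ^ 'n) set" where
  "weighted_minkowski_sum \<tau> f =
     {(\<Sum>i\<in>UNIV. (\<tau> $ i) *\<^sub>R \<sigma> i) |\<sigma>. \<forall>i. \<sigma> i \<in> newton_polytope (f i)}"

text \<open>Here \<open>L i\<close> is the chosen continuous branch of \<open>log (f i)\<close> on the positive orthant.\<close>

definition log_branches ::
    "('m::finite \<Rightarrow> 'n::finite cpoly) \<Rightarrow> ('m \<Rightarrow> real ^ 'n \<Rightarrow> complex) \<Rightarrow> bool" where
  "log_branches f L \<longleftrightarrow>
     (\<forall>i. continuous_on orthant (L i) \<and>
          (\<forall>x\<in>orthant. exp (L i x) = eval_poly (f i) (complex_vec x)))"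

definition monomial_power :: "real ^ 'n::finite \<Rightarrow> complex ^ 'n \<Rightarrow> complex" where
  "monomial_power x s = exp (\<Sum>i\<in>UNIV. s $ i * complex_of_real (ln (x $ i)))"

definition poly_power ::
    "('m::finite \<Rightarrow> real ^ 'n::finite \<Rightarrow> complex) \<Rightarrow> real ^ 'n \<Rightarrow> complex ^ 'm \<Rightarrow> complex" where
  "poly_power L x t = (\<Prod>i\<in>UNIV. exp (t $ i * L i x))"

definition euler_mellin_integrand ::
    "('m::finite \<Rightarrow> real ^ 'n::finite \<Rightarrow> complex) \<Rightarrow> complex ^ 'n \<Rightarrow> complex ^ 'm \<Rightarrow>
      real ^ 'n \<Rightarrow> complex" where
  "euler_mellin_integrand L s t x =
     monomial_power x s / poly_power L x t / (\<Prod>i\<in>UNIV. complex_of_real (x $ i))"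

text \<open>The polynomials enter only through the branches \<open>L\<close> of their logarithms.\<close>

definition euler_mellin ::
    "('m::finite \<Rightarrow> real ^ 'n::finite \<Rightarrow> complex) \<Rightarrow> complex ^ 'n \<Rightarrow> complex ^ 'm \<Rightarrow> complex" where
  "euler_mellin L s t = (LINT x:orthant|lborel. euler_mellin_integrand L s t x)"

definition convergence_domain ::
    "('m::finite \<Rightarrow> 'n::finite cpoly) \<Rightarrow> ((complex ^ 'n) \<times> (complex ^ 'm)) set" where
  "convergence_domain f =
     {(s, t). Re_vec t \<in> orthant \<and> Re_vec s \<in> interior (weighted_minkowski_sum (Re_vec t) f)}"

definition primitive_vec :: "int ^ 'n::finite \<Rightarrow> bool" where
  "primitive_vec \<mu> \<longleftrightarrow> Gcd (range (\<lambda>i. \<mu> $ i)) = 1"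

definition halfspace_presentations ::
    "('m::finite \<Rightarrow> 'n::finite cpoly) \<Rightarrow> ('m \<Rightarrow> nat) \<Rightarrow> ('m \<Rightarrow> nat \<Rightarrow> int ^ 'n) \<Rightarrow>
      ('m \<Rightarrow> nat \<Rightarrow> real) \<Rightarrow> bool" where
  "halfspace_presentations f N \<mu> \<nu> \<longleftrightarrow>
     (\<forall>i. (\<forall>j\<in>{1..N i}. primitive_vec (\<mu> i j)) \<and>
          newton_polytope (f i) = (\<Inter>j\<in>{1..N i}. {\<sigma>. \<nu> i j \<le> real_vec (\<mu> i j) \<bullet> \<sigma>}))"

text \<open>The pairwise distinct vectors \<open>\<mu>\<^sub>1, \<dots>, \<mu>\<^sub>N\<close> appear as a set; products over \<open>k\<close> become
  products over this set.\<close>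

definition normals :: "('m::finite \<Rightarrow> nat) \<Rightarrow> ('m \<Rightarrow> nat \<Rightarrow> int ^ 'n::finite) \<Rightarrow> (int ^ 'n) set" where
  "normals N \<mu> = {\<mu> i j |i j. j \<in> {1..N i}}"

text \<open>The vector \<open>\<nu>\<^sub>k\<close> belonging to \<open>\<mu>\<^sub>k = \<kappa>\<close>. The infimum is a minimum for nonempty (hence compact)
  Newton polytopes, and it may exceed the offset used in the chosen presentation.\<close>

definition support_vec :: "('m::finite \<Rightarrow> 'n::finite cpoly) \<Rightarrow> int ^ 'n \<Rightarrow> real ^ 'm" where
  "support_vec f \<kappa> = (\<chi> i. INF \<sigma>\<in>newton_polytope (f i). real_vec \<kappa> \<bullet> \<sigma>)"

text \<open>For at least two polytopes in dimension at least three this is not a consequence of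
  \<open>halfspace_presentations\<close>: a Minkowski sum can have facets spanned by edges of different summands,
  whose normals need not occur in presentations of the summands.\<close>

definition minkowski_presentation ::
    "('m::finite \<Rightarrow> 'n::finite cpoly) \<Rightarrow> (int ^ 'n) set \<Rightarrow> bool" where
  "minkowski_presentation f K \<longleftrightarrow>
     (\<forall>\<tau>\<in>orthant. weighted_minkowski_sum \<tau> f =
        (\<Inter>\<kappa>\<in>K. {\<sigma>. support_vec f \<kappa> \<bullet> \<tau> \<le> real_vec \<kappa> \<bullet> \<sigma>}))"

text \<open>Holomorphic functions of several complex variables: complex (Frechet) differentiability
  at every point of an open set.\<close>

definition holomorphic_several_on ::
    "((complex ^ 'n::finite) \<times> (complex ^ 'm::finite) \<Rightarrow> complex) \<Rightarrow>
      ((complex ^ 'n) \<times> (complex ^ 'm)) set \<Rightarrow> bool" where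
  "holomorphic_several_on F U \<longleftrightarrow>
     open U \<and>
     (\<forall>p\<in>U. \<exists>D. (F has_derivative D) (at p) \<and> (\<forall>c v w. D (c *s v, c *s w) = c * D (v, w)))"

text \<open>Meromorphic functions of several complex variables: locally quotients of holomorphic
  functions, the denominator vanishing identically on no nonempty open set. As functions are
  total, the values at zeros of the denominator are arbitrary.\<close>

definition meromorphic_several_on ::
    "((complex ^ 'n::finite) \<times> (complex ^ 'm::finite) \<Rightarrow> complex) \<Rightarrow>
      ((complex ^ 'n) \<times> (complex ^ 'm)) set \<Rightarrow> bool" where
  "meromorphic_several_on F U \<longleftrightarrow>
     (\<forall>p\<in>U. \<exists>V g h. p \<in> V \<and> V \<subseteq> U \<and>
        holomorphic_several_on g V \<and> holomorphic_several_on h V \<and>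
        interior {q \<in> V. h q = 0} = {} \<and>
        (\<forall>q\<in>V. h q \<noteq> 0 \<longrightarrow> F q = g q / h q))"

end

theory Submission
  imports Defs
begin

text \<open>In the coordinates \<open>y = log z\<close> the integral becomes a Laplace transform
  \<open>M p = \<integral>exp (phase p y) dy\<close> over the whole space, where \<open>p = (s, t)\<close> and
  \<open>phase p y = \<langle>s, y\<rangle> - \<Sum>\<^sub>i t\<^sub>i log f\<^sub>i(e\<^sup>y)\<close> is complex linear in \<open>p\<close>.

  Convergence rests on two estimates. Complete nonvanishing means that no limit of the normalised
  values of \<open>f\<^sub>i(e\<^sup>y)\<close>, in whatever direction \<open>y\<close> tends to infinity, is zero, because every such
  limit is a value of a truncation of \<open>f\<^sub>i\<close> to a face; by compactness, \<open>|f\<^sub>i(e\<^sup>y)|\<close> dominates all its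
  monomials (\<open>exp_sum_lower_bound\<close>). And the argument of \<open>f\<^sub>i(e\<^sup>y)\<close> is bounded: along a line, the real
  part of \<open>f\<^sub>i\<close> is a real exponential sum, which has fewer zeros than terms
  (\<open>Im_log_exp_sum_oscillation\<close>). If \<open>Re s\<close> is interior to the weighted Minkowski sum, these give
  exponential decay of the integrand (\<open>Re_phase_le\<close>), and the Laplace transform is holomorphic.

  There are two kinds of recurrences. Inserting \<open>1 = f\<^sub>i / f\<^sub>i\<close> writes \<open>M(s, t)\<close> as the combination of
  the values \<open>M(s + \<alpha>, t + e\<^sub>i)\<close> with the coefficients of \<open>f\<^sub>i\<close>. Integrating the derivative in the
  direction of a facet normal \<open>\<kappa>\<close> gives, with \<open>l\<^sub>\<kappa>(s, t) = \<langle>\<kappa>, s\<rangle> - \<langle>\<nu>\<^sub>\<kappa>, t\<rangle>\<close>,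

  \<open>l\<^sub>\<kappa>(s, t) M(s, t) = \<Sum>\<^sub>i \<Sum>\<^sub>\<alpha> t\<^sub>i c\<^sub>i\<^sub>,\<^sub>\<alpha> (\<langle>\<kappa>, \<alpha>\<rangle> - \<nu>\<^sub>\<kappa>\<^sub>,\<^sub>i) M(s + \<alpha>, t + e\<^sub>i)\<close>,

  where the exponents on the face minimising \<open>\<kappa>\<close> drop out. The gaps \<open>\<langle>\<kappa>, \<alpha>\<rangle> - \<nu>\<^sub>\<kappa>\<^sub>,\<^sub>i\<close> are natural numbers, so a shift
  raises each \<open>l\<^sub>\<kappa>\<close> by a natural number. The functional equation of the Gamma function therefore turns
  both kinds into recurrences with polynomial coefficients for
  \<open>\<Phi> = M / \<Prod>\<^sub>\<kappa> \<Gamma>(l\<^sub>\<kappa>)\<close>. The domain of convergence is given by \<open>Re t\<^sub>i > 0\<close> and \<open>Re l\<^sub>\<kappa> > 0\<close>, and for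
  each of these forms one recurrence raises it by at least \<open>1\<close> in all its terms without lowering the
  others. Composing them all and iterating defines \<open>\<Phi>\<close> everywhere (\<open>entire_continuation\<close>).

  That presentations with a common finite set of integral normals exist at all is a matter of rational
  cones: each cone of linear functionals that attain their minima at a given choice of exponents is
  generated by finitely many integral vectors (\<open>rational_cone_finitely_generated\<close>), and these generators
  suffice to separate every outside point from a weighted Minkowski sum (\<open>common_integral_normals\<close>).\<close>

section \<open>Finite generation of rational cones\<close>

lemma convex_cone_hull_sum:
  assumes "\<And>i. i \<in> I \<Longrightarrow> x i \<in> convex_cone hull S"
  shows "(\<Sum>i\<in>I. x i) \<in> convex_cone hull S"
  using assms
  by (induction I rule: infinite_finite_induct)
     (auto simp: convex_cone_hull_contains_0 convex_cone_hull_add)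

lemma convex_cone_hull_scaleR:
  "0 \<le> c \<Longrightarrow> x \<in> convex_cone hull S \<Longrightarrow> c *\<^sub>R x \<in> convex_cone hull S"
  by (rule convex_cone_scaleR[OF convex_cone_convex_cone_hull])

lemma convex_cone_hull_finite_obtain:
  fixes H :: "'a::real_vector set"
  assumes "finite H" "y \<in> convex_cone hull H"
  obtains c where "\<And>g. 0 \<le> c g" "y = (\<Sum>g\<in>H. c g *\<^sub>R g)"
proof -
  let ?Q = "{\<Sum>g\<in>H. c g *\<^sub>R g |c. \<forall>g. 0 \<le> (c g :: real)}"
  have "convex_cone ?Q"
    unfolding convex_cone_iff
  proof (intro conjI ballI allI impI)
    show "0 \<in> ?Q"
      by (rule CollectI, rule exI[of _ "\<lambda>_. 0"]) simp
  next
    fix x y assume "x \<in> ?Q" "y \<in> ?Q"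
    then obtain c d where "\<forall>g. 0 \<le> (c g::real)" "x = (\<Sum>g\<in>H. c g *\<^sub>R g)"
       "\<forall>g. 0 \<le> (d g::real)" "y = (\<Sum>g\<in>H. d g *\<^sub>R g)" by blast
    then show "x + y \<in> ?Q"
      by (intro CollectI exI[of _ "\<lambda>g. c g + d g"]) (auto simp: scaleR_add_left sum.distrib)
  next
    fix x and r :: real assume "x \<in> ?Q" "0 \<le> r"
    then obtain c where "\<forall>g. 0 \<le> (c g::real)" "x = (\<Sum>g\<in>H. c g *\<^sub>R g)" by blast
    with \<open>0 \<le> r\<close> show "r *\<^sub>R x \<in> ?Q"
      by (intro CollectI exI[of _ "\<lambda>g. r * c g"]) (auto simp: scaleR_sum_right)
  qed
  moreover have "H \<subseteq> ?Q"
  proof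
    fix h assume "h \<in> H"
    then have "h = (\<Sum>g\<in>H. (if g = h then 1 else 0) *\<^sub>R g)"
      using \<open>finite H\<close> by (simp add: if_distrib[of "\<lambda>c. c *\<^sub>R _"] cong: if_cong)
    then show "h \<in> ?Q"
      by (intro CollectI exI[of _ "\<lambda>g. if g = h then 1 else 0"]) auto
  qed
  ultimately have "convex_cone hull H \<subseteq> ?Q" by (rule hull_minimal[rotated])
  with assms(2) that show ?thesis by blast
qed

text \<open>The double description step. Generators on the wrong side of the hyperplane are paired with
  generators on the right side; each pair contributes the point where its segment, suitably scaled, meets
  the hyperplane.\<close>

lemma convex_cone_hull_Int_halfspace:
  fixes H :: "'a::real_inner set"
  assumes "finite H"
  shows "convex_cone hull H \<inter> {y. 0 \<le> a \<bullet> y} =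
    convex_cone hull ({g \<in> H. 0 \<le> a \<bullet> g} \<union>
      {(a \<bullet> g) *\<^sub>R h - (a \<bullet> h) *\<^sub>R g |g h. g \<in> H \<and> h \<in> H \<and> 0 < a \<bullet> g \<and> a \<bullet> h < 0})"
    (is "?L = convex_cone hull ?G")
proof
  have "?G \<subseteq> ?L"
  proof
    fix x assume "x \<in> ?G"
    then consider "x \<in> H" "0 \<le> a \<bullet> x"
      | g h where "x = (a \<bullet> g) *\<^sub>R h + (- (a \<bullet> h)) *\<^sub>R g" "g \<in> H" "h \<in> H" "0 < a \<bullet> g" "a \<bullet> h < 0"
      by auto
    then show "x \<in> ?L"
    proof cases
      case 2
      have "x \<in> convex_cone hull H"
        unfolding 2(1) using 2 by (intro convex_cone_hull_add convex_cone_hull_scaleR hull_inc) auto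
      moreover have "a \<bullet> x = 0" unfolding 2(1) by (simp add: inner_add_right algebra_simps)
      ultimately show ?thesis by simp
    qed (auto intro: hull_inc)
  qed
  moreover have "convex_cone ?L"
    using convex_cone_convex_cone_hull[of H] convex_cone_halfspace_ge[of a]
    by (auto simp: convex_cone_iff)
  ultimately show "convex_cone hull ?G \<subseteq> ?L" by (rule hull_minimal)
next
  show "?L \<subseteq> convex_cone hull ?G"
  proof
    fix y assume y: "y \<in> ?L"
    obtain c where c: "\<And>g. 0 \<le> c g" and yc: "y = (\<Sum>g\<in>H. c g *\<^sub>R g)"
      using y assms by (blast elim: convex_cone_hull_finite_obtain)
    define Hp Hz Hn where "Hp = {g\<in>H. 0 < a \<bullet> g}" "Hz = {g\<in>H. a \<bullet> g = 0}" "Hn = {g\<in>H. a \<bullet> g < 0}"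
    note defs = this
    have fin: "finite Hp" "finite Hz" "finite Hn" using assms by (auto simp: defs)
    have H: "H = Hp \<union> Hz \<union> Hn" by (auto simp: defs)
    have split: "(\<Sum>g\<in>H. F g) = (\<Sum>g\<in>Hp. F g) + (\<Sum>g\<in>Hz. F g) + (\<Sum>g\<in>Hn. F g)"
      for F :: "'a \<Rightarrow> 'b::ab_group_add"
      unfolding H using fin by (subst sum.union_disjoint | force simp: defs)+
    define P N where "P = (\<Sum>g\<in>Hp. c g * (a \<bullet> g))" "N = (\<Sum>h\<in>Hn. c h * - (a \<bullet> h))"
    note PN = this
    have "a \<bullet> y = (\<Sum>g\<in>H. c g * (a \<bullet> g))" by (simp add: yc inner_sum_right)
    also have "\<dots> = P - N"
      by (subst split) (simp add: PN sum_negf defs)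
    finally have NP: "N \<le> P" using y by simp
    have N0: "0 \<le> N" unfolding PN using c by (intro sum_nonneg mult_nonneg_nonneg) (auto simp: defs)
    have old: "c g *\<^sub>R g \<in> convex_cone hull ?G" if "g \<in> Hp \<union> Hz" for g
      using that c by (intro convex_cone_hull_scaleR hull_inc) (auto simp: defs)
    show "y \<in> convex_cone hull ?G"
    proof (cases "P = 0")
      case True
      then have "N = 0" using NP N0 by simp
      then have "\<forall>h\<in>Hn. c h * - (a \<bullet> h) = 0"
        unfolding PN using fin c
        by (subst (asm) sum_nonneg_eq_0_iff) (auto simp: defs mult_nonneg_nonpos)
      then have "\<forall>h\<in>Hn. c h = 0" by (auto simp: defs)
      then have "y = (\<Sum>g\<in>Hp. c g *\<^sub>R g) + (\<Sum>g\<in>Hz. c g *\<^sub>R g)"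
        by (simp add: yc split)
      then show ?thesis
        by (auto intro!: convex_cone_hull_add convex_cone_hull_sum old)
    next
      case False
      then have P: "P > 0" using NP N0 by simp
      \<comment> \<open>The negative part \<open>N\<close> of \<open>a \<bullet> y\<close> is cancelled by the fraction \<open>N / P\<close> of the positive part.\<close>
      let ?D = "\<Sum>g\<in>Hp. \<Sum>h\<in>Hn. (c g * c h / P) *\<^sub>R ((a \<bullet> g) *\<^sub>R h - (a \<bullet> h) *\<^sub>R g)"
      have "?D = (\<Sum>g\<in>Hp. \<Sum>h\<in>Hn. ((c g * (a \<bullet> g)) * (c h / P)) *\<^sub>R h)
               + (\<Sum>g\<in>Hp. \<Sum>h\<in>Hn. ((c h * - (a \<bullet> h)) * (c g / P)) *\<^sub>R g)"
        by (simp add: sum.distrib[symmetric] algebra_simps)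
      also have "(\<Sum>g\<in>Hp. \<Sum>h\<in>Hn. ((c g * (a \<bullet> g)) * (c h / P)) *\<^sub>R h) = (\<Sum>h\<in>Hn. (P * (c h / P)) *\<^sub>R h)"
        unfolding PN(1) sum_distrib_right scaleR_sum_left by (rule sum.swap)
      also have "\<dots> = (\<Sum>h\<in>Hn. c h *\<^sub>R h)" using P by simp
      also have "(\<Sum>g\<in>Hp. \<Sum>h\<in>Hn. ((c h * - (a \<bullet> h)) * (c g / P)) *\<^sub>R g) = (\<Sum>g\<in>Hp. (N * (c g / P)) *\<^sub>R g)"
        unfolding PN(2) sum_distrib_right scaleR_sum_left ..
      finally have D: "(\<Sum>h\<in>Hn. c h *\<^sub>R h) = ?D - (\<Sum>g\<in>Hp. (N * (c g / P)) *\<^sub>R g)" by simp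
      have "y = (\<Sum>g\<in>Hp. (c g * (1 - N / P)) *\<^sub>R g) + (\<Sum>g\<in>Hz. c g *\<^sub>R g) + ?D"
        unfolding yc split D by (simp add: algebra_simps sum_subtractf)
      moreover have "(c g * (1 - N / P)) *\<^sub>R g \<in> convex_cone hull ?G" if "g \<in> Hp" for g
        using convex_cone_hull_scaleR[OF _ old[of g], of "1 - N / P"] that P NP by (simp add: mult.commute)
      moreover have "(c g * c h / P) *\<^sub>R ((a \<bullet> g) *\<^sub>R h - (a \<bullet> h) *\<^sub>R g) \<in> convex_cone hull ?G"
        if "g \<in> Hp" "h \<in> Hn" for g h
      proof (rule convex_cone_hull_scaleR)
        show "0 \<le> c g * c h / P" using c P by simp
        show "(a \<bullet> g) *\<^sub>R h - (a \<bullet> h) *\<^sub>R g \<in> convex_cone hull ?G"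
          using that by (intro hull_inc) (auto simp: defs)
      qed
      ultimately show ?thesis
        using old by (auto intro!: convex_cone_hull_add convex_cone_hull_sum)
    qed
  qed
qed

lemma inner_real_vec: "real_vec a \<bullet> real_vec b = of_int (\<Sum>i\<in>UNIV. a $ i * b $ i)"
  by (simp add: real_vec_def inner_vec_def)

lemma real_vec_lincomb:
  "of_int k *\<^sub>R real_vec a - of_int l *\<^sub>R real_vec b = real_vec (\<chi> i. k * a $ i - l * b $ i)"
  by (simp add: real_vec_def vec_eq_iff)

text \<open>A rational form of the Minkowski--Weyl theorem. The constraints are added one at a time; the new generators
  of each step are integral combinations of the old ones, so integrality is preserved.\<close>

lemma rational_cone_finitely_generated:
  fixes A :: "(int ^ 'n::finite) set"
  assumes "finite A"
  shows "\<exists>G :: (int ^ 'n) set. finite G \<and>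
    {y. \<forall>a\<in>A. 0 \<le> real_vec a \<bullet> y} = convex_cone hull (real_vec ` G)"
  using assms
proof (induction A)
  case empty
  let ?e = "\<lambda>i::'n. axis i (1::int)"
  let ?G = "range ?e \<union> range (\<lambda>i. - ?e i)"
  have re: "real_vec (?e i) = axis i 1" "real_vec (- ?e i) = - axis i 1" for i
    by (auto simp: real_vec_def vec_eq_iff axis_def)
  have "y \<in> convex_cone hull (real_vec ` ?G)" for y :: "real ^ 'n"
  proof -
    have "y = (\<Sum>i\<in>UNIV. (y $ i) *\<^sub>R axis i 1)"
      by (simp add: vec_eq_iff axis_def if_distrib[of "\<lambda>c. _ * c"] cong: if_cong)
    also have "\<dots> \<in> convex_cone hull (real_vec ` ?G)"
    proof (rule convex_cone_hull_sum)
      fix i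
      have "axis i 1 \<in> convex_cone hull (real_vec ` ?G)" "- axis i 1 \<in> convex_cone hull (real_vec ` ?G)"
        by (rule hull_inc, metis re UNIV_I UnI1 UnI2 imageI)+
      from convex_cone_hull_scaleR[OF _ this(1), of "y $ i"] convex_cone_hull_scaleR[OF _ this(2), of "- (y $ i)"]
      show "(y $ i) *\<^sub>R axis i 1 \<in> convex_cone hull (real_vec ` ?G)"
        by (cases "0 \<le> y $ i") auto
    qed
    finally show ?thesis .
  qed
  then show ?case by (intro exI[of _ ?G]) auto
next
  case (insert a A)
  then obtain G :: "(int ^ 'n) set" where G: "finite G"
    "{y. \<forall>a\<in>A. 0 \<le> real_vec a \<bullet> y} = convex_cone hull (real_vec ` G)" by blast
  let ?d = "\<lambda>g. \<Sum>i\<in>UNIV. a $ i * g $ i"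
  let ?G1 = "{g \<in> G. 0 \<le> ?d g}"
  let ?c = "\<lambda>(g,h). (\<chi> i. ?d g * h $ i - ?d h * g $ i) :: int ^ 'n"
  let ?P = "{g \<in> G. 0 < ?d g} \<times> {h \<in> G. ?d h < 0}"
  have "{y. \<forall>a\<in>insert a A. 0 \<le> real_vec a \<bullet> y} = convex_cone hull (real_vec ` G) \<inter> {y. 0 \<le> real_vec a \<bullet> y}"
    using G(2) by auto
  also have "\<dots> = convex_cone hull (real_vec ` (?G1 \<union> ?c ` ?P))"
  proof (subst convex_cone_hull_Int_halfspace, use G in simp, rule arg_cong[where f = "\<lambda>S. convex_cone hull S"])
    show "{g \<in> real_vec ` G. 0 \<le> real_vec a \<bullet> g} \<union>
      {(real_vec a \<bullet> g) *\<^sub>R h - (real_vec a \<bullet> h) *\<^sub>R g |g h. g \<in> real_vec ` G \<and> h \<in> real_vec ` G \<and>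
        0 < real_vec a \<bullet> g \<and> real_vec a \<bullet> h < 0} = real_vec ` (?G1 \<union> ?c ` ?P)" (is "?X \<union> ?Y = _")
    proof -
      have sgn: "0 \<le> real_vec a \<bullet> real_vec g \<longleftrightarrow> 0 \<le> ?d g" "0 < real_vec a \<bullet> real_vec g \<longleftrightarrow> 0 < ?d g"
        "real_vec a \<bullet> real_vec g < 0 \<longleftrightarrow> ?d g < 0" for g
        by (simp_all only: inner_real_vec of_int_0_le_iff of_int_0_less_iff of_int_less_0_iff)
      have "?X = real_vec ` ?G1"
        by (auto simp: sgn)
      moreover have "?Y = real_vec ` ?c ` ?P"
      proof (intro equalityI subsetI)
        fix x assume "x \<in> ?Y"
        then obtain g h where gh: "g \<in> G" "h \<in> G" "0 < ?d g" "?d h < 0"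
          and "x = (real_vec a \<bullet> real_vec g) *\<^sub>R real_vec h - (real_vec a \<bullet> real_vec h) *\<^sub>R real_vec g"
          by (auto simp: sgn)
        then have "x = real_vec (?c (g, h))"
          unfolding inner_real_vec real_vec_lincomb by simp
        with gh show "x \<in> real_vec ` ?c ` ?P"
          by blast
      next
        fix x assume "x \<in> real_vec ` ?c ` ?P"
        then obtain g h where gh: "g \<in> G" "h \<in> G" "0 < ?d g" "?d h < 0" and "x = real_vec (?c (g, h))"
          by auto
        then have "x = (real_vec a \<bullet> real_vec g) *\<^sub>R real_vec h - (real_vec a \<bullet> real_vec h) *\<^sub>R real_vec g"
          unfolding inner_real_vec real_vec_lincomb by simp
        with gh show "x \<in> ?Y"
          using sgn by blast
      qed
      ultimately show ?thesis by (simp only: image_Un)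
    qed
  qed
  finally show ?case using G(1) by (intro exI[of _ "?G1 \<union> ?c ` ?P"]) simp
qed

section \<open>Halfspace presentations of Newton polytopes and their Minkowski sums\<close>

lemma primitive_direction:
  fixes g :: "int ^ 'n::finite"
  assumes "g \<noteq> 0"
  shows "\<exists>\<kappa> d. primitive_vec \<kappa> \<and> 0 < d \<and> real_vec g = d *\<^sub>R real_vec \<kappa>"
proof -
  define d where "d = Gcd (range (\<lambda>i. g $ i))"
  have "d \<noteq> 0" using assms by (auto simp: d_def Gcd_0_iff vec_eq_iff)
  moreover have "d \<ge> 0" by (simp add: d_def)
  ultimately have d: "d > 0" by simp
  define \<kappa> where "\<kappa> = (\<chi> i. g $ i div d)"
  have "d dvd g $ i" for i unfolding d_def by (rule Gcd_dvd) simp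
  then have g: "g $ i = d * \<kappa> $ i" for i by (simp add: \<kappa>_def)
  have "range (\<lambda>i. g $ i) = (*) d ` range (\<lambda>i. \<kappa> $ i)" by (auto simp: g)
  then have "Gcd (range (\<lambda>i. g $ i)) = Gcd ((*) d ` range (\<lambda>i. \<kappa> $ i))" by (rule arg_cong)
  also have "\<dots> = normalize (d * Gcd (range (\<lambda>i. \<kappa> $ i)))" by (rule Gcd_mult)
  finally have "d = normalize (d * Gcd (range (\<lambda>i. \<kappa> $ i)))" unfolding d_def[symmetric] .
  then have "d * Gcd (range (\<lambda>i. \<kappa> $ i)) = d * 1" using d by (simp add: abs_mult)
  then have "primitive_vec \<kappa>" using d unfolding mult_cancel_left by (simp add: primitive_vec_def)
  moreover have "real_vec g = real_of_int d *\<^sub>R real_vec \<kappa>" by (simp add: real_vec_def vec_eq_iff g)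
  ultimately show ?thesis using d by (intro exI[of _ \<kappa>] exI[of _ "real_of_int d"]) simp
qed

lemma primitive_vec_nonzero: "primitive_vec \<kappa> \<Longrightarrow> real_vec \<kappa> \<noteq> 0"
  by (rule ccontr) (simp add: primitive_vec_def real_vec_def vec_eq_iff)

definition int_exponent :: "('n::finite \<Rightarrow>\<^sub>0 nat) \<Rightarrow> int ^ 'n" where
  "int_exponent \<alpha> = (\<chi> i. int (Poly_Mapping.lookup \<alpha> i))"

lemma real_vec_diff: "real_vec (a - b) = real_vec a - real_vec b"
  by (simp add: real_vec_def vec_eq_iff)

lemma real_vec_int_exponent: "real_vec (int_exponent \<alpha>) = exponent_vec \<alpha>"
  by (simp add: real_vec_def int_exponent_def exponent_vec_def)

lemma newton_polytope_induct:
  assumes "\<sigma> \<in> newton_polytope g" "\<And>\<alpha>. \<alpha> \<in> Poly_Mapping.keys g \<Longrightarrow> exponent_vec \<alpha> \<in> S" "convex S"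
  shows "\<sigma> \<in> S"
  using assms hull_minimal[of "exponent_vec ` Poly_Mapping.keys g" S convex]
  unfolding newton_polytope_def by blast

lemma exponent_vec_in_newton_polytope:
  "\<alpha> \<in> Poly_Mapping.keys g \<Longrightarrow> exponent_vec \<alpha> \<in> newton_polytope g"
  unfolding newton_polytope_def by (rule hull_inc) simp

lemma newton_polytope_ge:
  assumes "\<sigma> \<in> newton_polytope g" "\<And>\<beta>. \<beta> \<in> Poly_Mapping.keys g \<Longrightarrow> c \<le> u \<bullet> exponent_vec \<beta>"
  shows "c \<le> u \<bullet> \<sigma>"
  using newton_polytope_induct[OF assms(1), of "{x. u \<bullet> x \<ge> c}"] assms(2) convex_halfspace_ge[of c u]
  by auto

lemma support_vec_eqI:
  fixes f :: "'m::finite \<Rightarrow> 'n::finite cpoly"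
  assumes "\<alpha> \<in> Poly_Mapping.keys (f i)"
    "\<And>\<beta>. \<beta> \<in> Poly_Mapping.keys (f i) \<Longrightarrow> real_vec \<kappa> \<bullet> exponent_vec \<alpha> \<le> real_vec \<kappa> \<bullet> exponent_vec \<beta>"
  shows "support_vec f \<kappa> $ i = real_vec \<kappa> \<bullet> exponent_vec \<alpha>"
proof -
  have ge: "real_vec \<kappa> \<bullet> exponent_vec \<alpha> \<le> real_vec \<kappa> \<bullet> \<sigma>" if "\<sigma> \<in> newton_polytope (f i)" for \<sigma>
    using newton_polytope_ge[OF that] assms(2) by blast
  show ?thesis
    unfolding support_vec_def vec_lambda_beta
    using ge exponent_vec_in_newton_polytope[OF assms(1)]
    by (intro cInf_eq_minimum) auto
qed

lemma minimizing_exponent: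
  assumes "g \<noteq> 0"
  shows "\<exists>\<alpha>\<in>Poly_Mapping.keys g. \<forall>\<beta>\<in>Poly_Mapping.keys g. u \<bullet> exponent_vec \<alpha> \<le> u \<bullet> exponent_vec \<beta>"
proof -
  let ?S = "(\<lambda>\<alpha>. u \<bullet> exponent_vec \<alpha>) ` Poly_Mapping.keys g"
  have "Min ?S \<in> ?S" using assms by (intro Min_in) auto
  then obtain \<alpha> where "\<alpha> \<in> Poly_Mapping.keys g" "Min ?S = u \<bullet> exponent_vec \<alpha>" by blast
  then show ?thesis using Min_le[of ?S] by (intro bexI[of _ \<alpha>]) (auto simp flip: \<open>Min ?S = _\<close>)
qed

lemma support_vec_attained:
  fixes f :: "'m::finite \<Rightarrow> 'n::finite cpoly"
  assumes "f i \<noteq> 0"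
  obtains \<alpha> where "\<alpha> \<in> Poly_Mapping.keys (f i)" "support_vec f \<kappa> $ i = real_vec \<kappa> \<bullet> exponent_vec \<alpha>"
    "\<And>\<beta>. \<beta> \<in> Poly_Mapping.keys (f i) \<Longrightarrow> support_vec f \<kappa> $ i \<le> real_vec \<kappa> \<bullet> exponent_vec \<beta>"
proof -
  obtain \<alpha> where "\<alpha> \<in> Poly_Mapping.keys (f i)"
    "\<And>\<beta>. \<beta> \<in> Poly_Mapping.keys (f i) \<Longrightarrow> real_vec \<kappa> \<bullet> exponent_vec \<alpha> \<le> real_vec \<kappa> \<bullet> exponent_vec \<beta>"
    using minimizing_exponent[OF assms] by blast
  then show ?thesis using support_vec_eqI[of _ f i \<kappa>] that by simp
qed

text \<open>Exhibits the sum as the convex hull of a finite set, which makes it compact.\<close>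

lemma weighted_minkowski_sum_hull:
  "weighted_minkowski_sum \<tau> f =
    convex hull (\<Sum>i\<in>UNIV. (\<lambda>x. (\<tau> $ i) *\<^sub>R x) ` exponent_vec ` Poly_Mapping.keys (f i))"
proof -
  have "weighted_minkowski_sum \<tau> f = (\<Sum>i\<in>UNIV. (\<lambda>x. (\<tau> $ i) *\<^sub>R x) ` newton_polytope (f i))"
  proof (subst set_sum_alt, simp, unfold weighted_minkowski_sum_def, intro equalityI subsetI)
    fix x assume "x \<in> {sum s UNIV |s. \<forall>i\<in>UNIV. s i \<in> (*\<^sub>R) (\<tau> $ i) ` newton_polytope (f i)}"
    then obtain s where s: "x = sum s UNIV" "\<And>i. s i \<in> (*\<^sub>R) (\<tau> $ i) ` newton_polytope (f i)" by blast
    then have "\<forall>i. \<exists>\<sigma>. \<sigma> \<in> newton_polytope (f i) \<and> s i = (\<tau> $ i) *\<^sub>R \<sigma>" by blast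
    then obtain \<sigma> where "\<forall>i. \<sigma> i \<in> newton_polytope (f i) \<and> s i = (\<tau> $ i) *\<^sub>R \<sigma> i" by metis
    then show "x \<in> {(\<Sum>i\<in>UNIV. (\<tau> $ i) *\<^sub>R \<sigma> i) |\<sigma>. \<forall>i. \<sigma> i \<in> newton_polytope (f i)}"
      using s by auto
  qed blast
  then show ?thesis
    unfolding newton_polytope_def convex_hull_set_sum by (simp add: convex_hull_scaling)
qed

lemma compact_convex_weighted_minkowski_sum:
  "compact (weighted_minkowski_sum \<tau> f)" "convex (weighted_minkowski_sum \<tau> f)"
proof -
  have "finite (\<Sum>i\<in>I. (\<lambda>x. (\<tau> $ i) *\<^sub>R x) ` exponent_vec ` Poly_Mapping.keys (f i))" for I
    by (induction I rule: infinite_finite_induct) (auto intro!: finite_set_plus)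
  then show "compact (weighted_minkowski_sum \<tau> f)"
    unfolding weighted_minkowski_sum_hull by (rule finite_imp_compact_convex_hull)
qed (simp add: weighted_minkowski_sum_hull)

text \<open>For a choice \<open>\<alpha>\<close> of one exponent from each support, the functionals minimised at \<open>\<alpha>\<close> on all supports at once
  form a rational cone, on which the support function of every weighted sum is linear. A point outside a
  weighted sum is separated from it by some functional; on the cone of that functional, the separation is
  the negativity of a linear form, so one of the finitely many generators of the cone separates as well.
  The weights may vanish, so that the presentations of the single polytopes are included.\<close>

lemma common_integral_normals:
  fixes f :: "'m::finite \<Rightarrow> 'n::finite cpoly"
  assumes nz: "\<And>i. f i \<noteq> 0"
  shows "\<exists>K. finite K \<and> (\<forall>\<kappa>\<in>K. primitive_vec \<kappa>) \<and>
    (\<forall>\<tau>. (\<forall>i. 0 \<le> \<tau> $ i) \<longrightarrow> weighted_minkowski_sum \<tau> f =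
        (\<Inter>\<kappa>\<in>K. {\<sigma>. support_vec f \<kappa> \<bullet> \<tau> \<le> real_vec \<kappa> \<bullet> \<sigma>}))"
proof -
  let ?C = "PiE UNIV (\<lambda>i. Poly_Mapping.keys (f i))"
  define A where "A = (\<lambda>\<alpha>. \<Union>i. (\<lambda>\<beta>. int_exponent \<beta> - int_exponent (\<alpha> i)) ` Poly_Mapping.keys (f i))"
  have "finite (A \<alpha>)" for \<alpha> by (simp add: A_def)
  then have "\<forall>\<alpha>. \<exists>G :: (int ^ 'n) set. finite G \<and>
    {y. \<forall>a\<in>A \<alpha>. 0 \<le> real_vec a \<bullet> y} = convex_cone hull (real_vec ` G)"
    using rational_cone_finitely_generated by blast
  then obtain G :: "('m \<Rightarrow> 'n \<Rightarrow>\<^sub>0 nat) \<Rightarrow> (int ^ 'n) set" where finG: "\<And>\<alpha>. finite (G \<alpha>)" and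
    G: "\<And>\<alpha>. {y. \<forall>a\<in>A \<alpha>. 0 \<le> real_vec a \<bullet> y} = convex_cone hull (real_vec ` G \<alpha>)" by metis
  obtain prim :: "int ^ 'n \<Rightarrow> int ^ 'n" and d where prim: "\<And>g. g \<noteq> 0 \<Longrightarrow> primitive_vec (prim g)"
     "\<And>g. g \<noteq> 0 \<Longrightarrow> 0 < d g" "\<And>g. g \<noteq> 0 \<Longrightarrow> real_vec g = d g *\<^sub>R real_vec (prim g)"
    using primitive_direction by metis
  define K where "K = prim ` ((\<Union>\<alpha>\<in>?C. G \<alpha>) - {0})"
  have fin: "finite ?C" by (intro finite_PiE) auto
  have "finite K" unfolding K_def using fin finG by blast
  moreover have "\<forall>\<kappa>\<in>K. primitive_vec \<kappa>" using prim by (auto simp: K_def)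
  moreover have "weighted_minkowski_sum \<tau> f = (\<Inter>\<kappa>\<in>K. {\<sigma>. support_vec f \<kappa> \<bullet> \<tau> \<le> real_vec \<kappa> \<bullet> \<sigma>})"
    if \<tau>: "\<forall>i. 0 \<le> \<tau> $ i" for \<tau>
  proof (intro equalityI subsetI)
    fix \<sigma> assume "\<sigma> \<in> weighted_minkowski_sum \<tau> f"
    then obtain s where s: "\<And>i. s i \<in> newton_polytope (f i)" "\<sigma> = (\<Sum>i\<in>UNIV. (\<tau> $ i) *\<^sub>R s i)"
      by (auto simp: weighted_minkowski_sum_def)
    have "support_vec f \<kappa> \<bullet> \<tau> \<le> real_vec \<kappa> \<bullet> \<sigma>" for \<kappa>
    proof -
      have "support_vec f \<kappa> $ i \<le> real_vec \<kappa> \<bullet> s i" for i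
        by (rule support_vec_attained[of f i \<kappa>, OF nz]) (blast intro: newton_polytope_ge[OF s(1)])
      then have "(\<Sum>i\<in>UNIV. support_vec f \<kappa> $ i * \<tau> $ i) \<le> (\<Sum>i\<in>UNIV. \<tau> $ i * (real_vec \<kappa> \<bullet> s i))"
        using \<tau> by (intro sum_mono) (metis mult.commute mult_left_mono)
      then show ?thesis by (simp add: s(2) inner_vec_def[of "support_vec f \<kappa>"] inner_sum_right)
    qed
    then show "\<sigma> \<in> (\<Inter>\<kappa>\<in>K. {\<sigma>. support_vec f \<kappa> \<bullet> \<tau> \<le> real_vec \<kappa> \<bullet> \<sigma>})" by simp
  next
    fix \<sigma> assume \<sigma>: "\<sigma> \<in> (\<Inter>\<kappa>\<in>K. {\<sigma>. support_vec f \<kappa> \<bullet> \<tau> \<le> real_vec \<kappa> \<bullet> \<sigma>})"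
    show "\<sigma> \<in> weighted_minkowski_sum \<tau> f"
    proof (rule ccontr)
      assume "\<sigma> \<notin> weighted_minkowski_sum \<tau> f"
      then obtain a b where ab: "a \<bullet> \<sigma> < b" "\<And>x. x \<in> weighted_minkowski_sum \<tau> f \<Longrightarrow> b < a \<bullet> x"
        using separating_hyperplane_closed_point[OF compact_convex_weighted_minkowski_sum(2)
          compact_imp_closed[OF compact_convex_weighted_minkowski_sum(1)], of \<sigma> \<tau> f] by blast
      have "\<exists>\<alpha>\<in>Poly_Mapping.keys (f i). \<forall>\<beta>\<in>Poly_Mapping.keys (f i). a \<bullet> exponent_vec \<alpha> \<le> a \<bullet> exponent_vec \<beta>" for i
        using minimizing_exponent[OF nz] by blast
      then obtain \<alpha> where \<alpha>: "\<And>i. \<alpha> i \<in> Poly_Mapping.keys (f i)"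
        "\<And>i \<beta>. \<beta> \<in> Poly_Mapping.keys (f i) \<Longrightarrow> a \<bullet> exponent_vec (\<alpha> i) \<le> a \<bullet> exponent_vec \<beta>" by metis
      \<comment> \<open>\<open>\<alpha>\<close> picks exponents at which the separating functional \<open>a\<close> is minimal.\<close>
      define w where "w = \<sigma> - (\<Sum>i\<in>UNIV. (\<tau> $ i) *\<^sub>R exponent_vec (\<alpha> i))"
      have "(\<Sum>i\<in>UNIV. (\<tau> $ i) *\<^sub>R exponent_vec (\<alpha> i)) \<in> weighted_minkowski_sum \<tau> f"
        unfolding weighted_minkowski_sum_def
        by (intro CollectI exI[of _ "\<lambda>i. exponent_vec (\<alpha> i)"] conjI refl allI exponent_vec_in_newton_polytope \<alpha>(1))
      then have aw: "w \<bullet> a < 0" using ab(1) ab(2) unfolding w_def inner_commute[of _ a] inner_diff_right by fastforce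
      have "a \<in> {y. \<forall>a\<in>A \<alpha>. 0 \<le> real_vec a \<bullet> y}"
        using \<alpha>(2) by (auto simp: A_def real_vec_diff real_vec_int_exponent inner_diff_left inner_commute[of _ a])
      then have "a \<in> convex_cone hull (real_vec ` G \<alpha>)" using G by simp
      moreover have "convex_cone hull (real_vec ` G \<alpha>) \<subseteq> {y. 0 \<le> w \<bullet> y}"
        if "\<And>g. g \<in> G \<alpha> \<Longrightarrow> 0 \<le> w \<bullet> real_vec g"
        using that by (intro hull_minimal convex_cone_halfspace_ge) auto
      ultimately obtain g where g: "g \<in> G \<alpha>" "w \<bullet> real_vec g < 0" using aw by force
      then have g0: "g \<noteq> 0" by (auto simp: real_vec_def inner_vec_def)
      define \<kappa> where "\<kappa> = prim g"
      have gk: "real_vec g = d g *\<^sub>R real_vec \<kappa>" and dg: "0 < d g" using prim g0 by (auto simp: \<kappa>_def)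
      have "\<alpha> \<in> ?C" using \<alpha> by auto
      then have "\<kappa> \<in> K" unfolding K_def \<kappa>_def using g g0 by blast
      have "real_vec g \<in> {y. \<forall>a\<in>A \<alpha>. 0 \<le> real_vec a \<bullet> y}"
        unfolding G using g by (intro hull_inc) simp
      then have "real_vec \<kappa> \<bullet> exponent_vec (\<alpha> i) \<le> real_vec \<kappa> \<bullet> exponent_vec \<beta>"
        if "\<beta> \<in> Poly_Mapping.keys (f i)" for i \<beta>
        using that dg by (auto simp: A_def gk real_vec_diff real_vec_int_exponent inner_diff_left
            inner_commute[of _ "real_vec \<kappa>"] zero_le_mult_iff)
      then have "support_vec f \<kappa> $ i = real_vec \<kappa> \<bullet> exponent_vec (\<alpha> i)" for i
        by (intro support_vec_eqI \<alpha>(1))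
      then have "support_vec f \<kappa> \<bullet> \<tau> = real_vec \<kappa> \<bullet> (\<sigma> - w)"
        by (simp add: w_def inner_vec_def[of "support_vec f \<kappa>"] inner_sum_right mult.commute)
      moreover have "real_vec \<kappa> \<bullet> w < 0"
        using g(2) dg by (simp add: gk mult_less_0_iff inner_commute)
      moreover have "support_vec f \<kappa> \<bullet> \<tau> \<le> real_vec \<kappa> \<bullet> \<sigma>" using \<sigma> \<open>\<kappa> \<in> K\<close> by blast
      ultimately show False by (simp add: inner_diff_right)
    qed
  qed
  ultimately show ?thesis by (intro exI[of _ K] conjI allI impI)
qed

lemma halfspace_presentation_exists:
  fixes f :: "'m::finite \<Rightarrow> 'n::finite cpoly"
  assumes nz: "\<And>i. f i \<noteq> 0"
  shows "\<exists>N \<mu> \<nu>. halfspace_presentations f N \<mu> \<nu> \<and> minkowski_presentation f (normals N \<mu>)"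
proof -
  obtain K where K: "finite K" "\<forall>\<kappa>\<in>K. primitive_vec \<kappa>"
    and pres: "\<forall>\<tau>. (\<forall>i. 0 \<le> \<tau> $ i) \<longrightarrow> weighted_minkowski_sum \<tau> f =
        (\<Inter>\<kappa>\<in>K. {\<sigma>. support_vec f \<kappa> \<bullet> \<tau> \<le> real_vec \<kappa> \<bullet> \<sigma>})"
    using common_integral_normals[of f, OF nz] by (elim exE conjE) (rule that)
  obtain e where e: "bij_betw e {1..card K} K"
    using ex_bij_betw_nat_finite_1[OF K(1)] by blast
  then have eK: "e ` {1..card K} = K" by (simp add: bij_betw_def)
  have "newton_polytope (f i) = weighted_minkowski_sum (axis i 1) f" for i
  proof (intro equalityI subsetI)
    fix \<sigma> assume \<sigma>: "\<sigma> \<in> newton_polytope (f i)"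
    have "\<forall>j. \<exists>x. x \<in> newton_polytope (f j)"
      using exponent_vec_in_newton_polytope keys_eq_empty nz by (metis ex_in_conv)
    then obtain s where s: "\<And>j. s j \<in> newton_polytope (f j)"
      by metis
    have "\<sigma> = (\<Sum>j\<in>UNIV. (axis i 1 $ j) *\<^sub>R (s(i := \<sigma>)) j)"
      by (simp add: axis_def if_distrib[of "\<lambda>c. c *\<^sub>R _"] cong: if_cong)
    then show "\<sigma> \<in> weighted_minkowski_sum (axis i 1) f"
      unfolding weighted_minkowski_sum_def using s \<sigma> by (intro CollectI exI[of _ "s(i := \<sigma>)"]) simp
  qed (auto simp: weighted_minkowski_sum_def axis_def if_distrib[of "\<lambda>c. c *\<^sub>R _"] cong: if_cong)
  then have K_pres: "newton_polytope (f i) = (\<Inter>\<kappa>\<in>K. {\<sigma>. support_vec f \<kappa> $ i \<le> real_vec \<kappa> \<bullet> \<sigma>})" for i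
    using pres[rule_format, of "axis i 1"] by (simp add: inner_axis) (simp add: axis_def)
  then have "newton_polytope (f i) = (\<Inter>j\<in>{1..card K}. {\<sigma>. support_vec f (e j) $ i \<le> real_vec (e j) \<bullet> \<sigma>})" for i
  proof -
    have "(\<Inter>\<kappa>\<in>e ` {1..card K}. {\<sigma>. support_vec f \<kappa> $ i \<le> real_vec \<kappa> \<bullet> \<sigma>}) =
      (\<Inter>j\<in>{1..card K}. {\<sigma>. support_vec f (e j) $ i \<le> real_vec (e j) \<bullet> \<sigma>})"
      by (simp only: image_image)
    then show ?thesis unfolding eK K_pres .
  qed
  then have "halfspace_presentations f (\<lambda>_. card K) (\<lambda>_. e) (\<lambda>i j. support_vec f (e j) $ i)"
    unfolding halfspace_presentations_def using K(2) eK by auto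
  moreover have "normals (\<lambda>_::'m. card K) (\<lambda>_. e) = K" unfolding normals_def using eK by blast
  moreover have "minkowski_presentation f K"
    unfolding minkowski_presentation_def using pres by (auto simp: orthant_def less_imp_le)
  ultimately show ?thesis by metis
qed

section \<open>Lower bounds for exponential sums\<close>

text \<open>Sequential compactness of a finite power of the unit interval, for an index set that is not a type.\<close>

lemma finite_family_convergent_subseq:
  fixes g :: "'i \<Rightarrow> nat \<Rightarrow> real"
  assumes "finite A" "\<And>\<alpha> k. \<alpha> \<in> A \<Longrightarrow> g \<alpha> k \<in> {0..1}"
  shows "\<exists>r. strict_mono (r :: nat \<Rightarrow> nat) \<and> (\<forall>\<alpha>\<in>A. convergent (\<lambda>k. g \<alpha> (r k)))"
  using assms
proof (induction A)
  case empty
  then show ?case by (auto intro!: exI[of _ id] strict_monoI)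
next
  case (insert \<alpha> A)
  then obtain r where r: "strict_mono (r :: nat \<Rightarrow> nat)" "\<forall>\<alpha>\<in>A. convergent (\<lambda>k. g \<alpha> (r k))"
    by auto
  have "seq_compact {0..1::real}" using compact_Icc compact_eq_seq_compact_metric by blast
  then obtain l s where s: "strict_mono (s :: nat \<Rightarrow> nat)" "((\<lambda>k. g \<alpha> (r k)) \<circ> s) \<longlonglongrightarrow> l"
    using insert.prems unfolding seq_compact_def by (metis insertI1)
  have "convergent (\<lambda>k. g \<beta> (r (s k)))" if "\<beta> \<in> insert \<alpha> A" for \<beta>
  proof (cases "\<beta> = \<alpha>")
    case True
    then show ?thesis using s(2) by (auto simp: convergent_def comp_def)
  next
    case False
    then have "convergent (\<lambda>k. g \<beta> (r k))" using that r by auto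
    then show ?thesis using LIMSEQ_subseq_LIMSEQ[OF _ s(1)] by (auto simp: convergent_def comp_def)
  qed
  moreover have "strict_mono (\<lambda>k. r (s k))" using strict_mono_o[OF r(1) s(1)] by (simp add: comp_def)
  ultimately show ?case by (intro exI[of _ "\<lambda>k. r (s k)"]) auto
qed

text \<open>Suppose the bound fails along a sequence \<open>y\<close>. After division by the largest monomial and passage to a
  subsequence all monomials converge; let \<open>S\<close> be the set of exponents whose limits are positive. The
  exponents outside \<open>S\<close> have normalised logarithms tending to minus infinity, which forces \<open>S\<close> to span a face.
  The limits on \<open>S\<close> are again the values of monomials at some point, up to a common factor, because the
  range of a linear map is closed. Hence the truncation to \<open>S\<close> has a zero.\<close>

lemma exp_sum_lower_bound:
  fixes E :: "'a::euclidean_space set" and c :: "'a \<Rightarrow> complex"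
  assumes fin: "finite E" and ne: "E \<noteq> {}"
    and nonvanishing: "\<And>S y. S \<subseteq> E \<Longrightarrow> S \<noteq> {} \<Longrightarrow> (convex hull S) face_of (convex hull E) \<Longrightarrow>
      E \<inter> convex hull S = S \<Longrightarrow> (\<Sum>v\<in>S. c v * of_real (exp (v \<bullet> y))) \<noteq> 0"
  shows "\<exists>C>0. \<forall>y. \<forall>v\<in>E. C * exp (v \<bullet> y) \<le> norm (\<Sum>v\<in>E. c v * of_real (exp (v \<bullet> y)))"
proof (rule ccontr)
  define F where "F y = (\<Sum>v\<in>E. c v * of_real (exp (v \<bullet> y)))" for y
  define h where "h y = Max ((\<lambda>v. v \<bullet> y) ` E)" for y
  assume contra: "\<not> ?thesis"
  have "\<exists>y. \<exists>v\<in>E. norm (F y) < inverse (real (Suc k)) * exp (v \<bullet> y)" for k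
    using contra unfolding F_def
    by (metis inverse_positive_iff_positive not_le of_nat_0_less_iff zero_less_Suc)
  then obtain y0 v0 where y0: "\<And>k. v0 k \<in> E" "\<And>k. norm (F (y0 k)) < inverse (real (Suc k)) * exp (v0 k \<bullet> y0 k)"
    by metis
  have le_h: "v \<bullet> y \<le> h y" if "v \<in> E" for v y unfolding h_def using fin that by simp
  have h_attained: "\<exists>v\<in>E. h y = v \<bullet> y" for y
  proof -
    have "h y \<in> (\<lambda>v. v \<bullet> y) ` E" unfolding h_def using fin ne by (intro Max_in) auto
    then show ?thesis by blast
  qed
  define a0 where "a0 v k = exp (v \<bullet> y0 k - h (y0 k))" for v k
  have a0: "a0 v k \<in> {0..1}" if "v \<in> E" for v k using le_h[OF that] by (simp add: a0_def)
  obtain r where r: "strict_mono (r :: nat \<Rightarrow> nat)" "\<forall>v\<in>E. convergent (\<lambda>k. a0 v (r k))"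
    using finite_family_convergent_subseq[of E a0] fin a0 by blast
  define y where "y k = y0 (r k)" for k
  define b where "b v k = v \<bullet> y k - h (y k)" for v k
  define l where "l v = lim (\<lambda>k. a0 v (r k))" for v
  have lim: "(\<lambda>k. exp (b v k)) \<longlonglongrightarrow> l v" if "v \<in> E" for v
    using r(2) that unfolding l_def by (simp add: convergent_LIMSEQ_iff a0_def b_def y_def)
  have l0: "0 \<le> l v" if "v \<in> E" for v
    using lim[OF that] by (rule LIMSEQ_le_const) auto
  have "norm (\<Sum>v\<in>E. c v * of_real (exp (b v k))) \<le> inverse (real (Suc k))" for k
  proof -
    have "(\<Sum>v\<in>E. c v * of_real (exp (b v k))) = F (y k) * of_real (exp (- h (y k)))"
      unfolding F_def sum_distrib_right
      by (intro sum.cong refl) (simp add: b_def mult.assoc flip: of_real_mult exp_add)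
    then have "norm (\<Sum>v\<in>E. c v * of_real (exp (b v k))) = norm (F (y k)) * exp (- h (y k))"
      by (simp add: norm_mult)
    also have "\<dots> \<le> (inverse (real (Suc (r k))) * exp (h (y k))) * exp (- h (y k))"
      using y0(2)[of "r k"] le_h[OF y0(1), of "r k" "y k"] unfolding y_def
      by (intro mult_right_mono order.trans[OF less_imp_le[OF y0(2)]] mult_left_mono) auto
    also have "\<dots> = inverse (real (Suc (r k)))" by (simp flip: exp_add mult.assoc add: mult.assoc)
    also have "\<dots> \<le> inverse (real (Suc k))"
      using seq_suble[OF r(1), of k] by (simp add: field_simps)
    finally show ?thesis .
  qed
  then have "(\<lambda>k. \<Sum>v\<in>E. c v * of_real (exp (b v k))) \<longlonglongrightarrow> 0"
    using LIMSEQ_inverse_real_of_nat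
    by (rule Lim_null_comparison[OF always_eventually[OF allI]])
  moreover have "(\<lambda>k. \<Sum>v\<in>E. c v * of_real (exp (b v k))) \<longlonglongrightarrow> (\<Sum>v\<in>E. c v * of_real (l v))"
    by (intro tendsto_intros lim)
  ultimately have sum0: "(\<Sum>v\<in>E. c v * of_real (l v)) = 0" using LIMSEQ_unique by blast
  define S where "S = {v\<in>E. 0 < l v}"
  have S: "S \<subseteq> E" "finite S" using fin by (auto simp: S_def)
  have "1 \<le> (\<Sum>v\<in>E. exp (b v k))" for k
  proof -
    obtain v where v: "v \<in> E" "h (y k) = v \<bullet> y k" using h_attained by blast
    then have "1 = exp (b v k)" by (simp add: b_def)
    also have "\<dots> \<le> (\<Sum>v\<in>E. exp (b v k))" using v fin by (intro member_le_sum) auto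
    finally show ?thesis .
  qed
  then have "1 \<le> (\<Sum>v\<in>E. l v)"
    by (intro LIMSEQ_le_const[OF tendsto_sum[OF lim]]) auto
  then have "S \<noteq> {}" using l0 unfolding S_def
    by (metis (mono_tags, lifting) antisym_conv2 empty_Collect_eq linorder_not_le sum_nonpos zero_less_one order_less_le_trans)
  have bS: "(\<lambda>k. b v k) \<longlonglongrightarrow> ln (l v)" if "v \<in> S" for v
    using tendsto_ln[OF lim[of v]] that by (simp add: S_def)
  have bnS: "eventually (\<lambda>k. b v k \<le> B) sequentially" if "v \<in> E - S" for v B
  proof -
    have "l v = 0" using that l0[of v] by (auto simp: S_def)
    then have "eventually (\<lambda>k. exp (b v k) < exp B) sequentially"
      using order_tendstoD(2)[OF lim[of v], of "exp B"] that by auto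
    then show ?thesis by eventually_elim simp
  qed
  \<comment> \<open>A common point of both hulls would have the same normalised height computed in two ways: convergent from \<open>S\<close>,
    tending to minus infinity from the other exponents.\<close>
  have disj: "affine hull S \<inter> convex hull (E - S) = {}"
  proof (rule ccontr)
    assume "affine hull S \<inter> convex hull (E - S) \<noteq> {}"
    then obtain x where x: "x \<in> affine hull S" "x \<in> convex hull (E - S)" by blast
    obtain u where u: "sum u S = 1" "(\<Sum>v\<in>S. u v *\<^sub>R v) = x"
      using x(1) S(2) by (auto simp: affine_hull_finite)
    obtain w where w: "\<And>v. v \<in> E - S \<Longrightarrow> 0 \<le> w v" "sum w (E - S) = 1" "(\<Sum>v\<in>E - S. w v *\<^sub>R v) = x"
      using x(2) fin by (auto simp: convex_hull_finite)
    have comb: "(\<Sum>v\<in>A. u v * b v k) = x \<bullet> y k - h (y k)" if "sum u A = 1" "(\<Sum>v\<in>A. u v *\<^sub>R v) = x" for A u k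
      unfolding b_def using that
      by (simp add: right_diff_distrib sum_subtractf flip: sum_distrib_right that(2)) (simp add: inner_sum_left)
    define B where "B = (\<Sum>v\<in>S. u v * ln (l v))"
    have "(\<lambda>k. \<Sum>v\<in>S. u v * b v k) \<longlonglongrightarrow> B"
      unfolding B_def by (intro tendsto_intros bS)
    then have l1: "(\<lambda>k. x \<bullet> y k - h (y k)) \<longlonglongrightarrow> B" using comb[OF u] by simp
    have "eventually (\<lambda>k. \<forall>v\<in>E-S. b v k \<le> B - 1) sequentially"
      using bnS fin by (intro eventually_ball_finite) auto
    then have "eventually (\<lambda>k. x \<bullet> y k - h (y k) \<le> B - 1) sequentially"
    proof eventually_elim
      case (elim k)
      have "x \<bullet> y k - h (y k) = (\<Sum>v\<in>E - S. w v * b v k)" using comb[OF w(2,3)] by simp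
      also have "\<dots> \<le> (\<Sum>v\<in>E - S. w v * (B - 1))"
        using elim w(1) by (intro sum_mono mult_left_mono) auto
      also have "\<dots> = B - 1" by (simp add: w(2) flip: sum_distrib_right)
      finally show ?case .
    qed
    then have "B \<le> B - 1" by (intro tendsto_upperbound[OF l1]) auto
    then show False by simp
  qed
  have face: "(convex hull S) face_of (convex hull E)"
    using face_of_convex_hulls[OF fin S(1) disj] .
  have "E \<inter> convex hull S = S"
    using disj S(1) convex_hull_subset_affine_hull[of S] hull_subset[of S convex] hull_subset[of "E - S" convex] by blast
  note nz = nonvanishing[OF S(1) \<open>S \<noteq> {}\<close> face this]
  obtain o0 where o0: "o0 \<in> S" using \<open>S \<noteq> {}\<close> by blast
  define d where "d v = v - o0" for v
  \<comment> \<open>The Gram map of the differences \<open>d v\<close>. It replaces the evaluation map \<open>z \<mapsto> (d v \<bullet> z)\<^sub>v\<close>, whose target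
    is a function space, by an endomorphism with closed range. The resulting error \<open>e\<close> vanishes because \<open>\<Sum>\<^sub>v e v *\<^sub>R d v = 0\<close> makes it
    orthogonal to all vectors \<open>(d v \<bullet> x)\<^sub>v\<close>, and it is itself a limit of such vectors.\<close>
  define T where "T z = (\<Sum>v\<in>S. (d v \<bullet> z) *\<^sub>R d v)" for z
  define \<beta> where "\<beta> v = ln (l v) - ln (l o0)" for v
  have dlim: "(\<lambda>k. d v \<bullet> y k) \<longlonglongrightarrow> \<beta> v" if "v \<in> S" for v
    using tendsto_diff[OF bS[OF that] bS[OF o0]] by (simp add: b_def d_def \<beta>_def inner_diff_left)
  have "linear T"
    unfolding T_def by (intro linearI) (simp_all add: inner_add_right scaleR_add_left sum.distrib scaleR_sum_right)
  then have "closed (range T)" by (intro closed_subspace linear_subspace_image) auto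
  moreover have "(\<lambda>k. T (y k)) \<longlonglongrightarrow> (\<Sum>v\<in>S. \<beta> v *\<^sub>R d v)"
    unfolding T_def by (intro tendsto_intros dlim)
  ultimately have "(\<Sum>v\<in>S. \<beta> v *\<^sub>R d v) \<in> range T"
    by (meson closed_sequentially rangeI)
  then obtain z where z: "(\<Sum>v\<in>S. \<beta> v *\<^sub>R d v) = T z" by blast
  define e where "e v = \<beta> v - d v \<bullet> z" for v
  have e0: "(\<Sum>v\<in>S. e v *\<^sub>R d v) = 0"
    using z by (simp add: e_def T_def scaleR_diff_left sum_subtractf)
  have "(\<lambda>k. \<Sum>v\<in>S. e v * (d v \<bullet> y k - d v \<bullet> z)) \<longlonglongrightarrow> (\<Sum>v\<in>S. e v * (\<beta> v - d v \<bullet> z))"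
    by (intro tendsto_intros dlim)
  moreover have "(\<Sum>v\<in>S. e v * (d v \<bullet> y k - d v \<bullet> z)) = (\<Sum>v\<in>S. e v *\<^sub>R d v) \<bullet> (y k - z)" for k
    by (simp add: inner_sum_left inner_diff_right right_diff_distrib sum_subtractf)
  ultimately have "(\<Sum>v\<in>S. e v * e v) = 0"
    unfolding e0 by (simp add: LIMSEQ_const_iff e_def)
  then have "\<forall>v\<in>S. e v = 0" using S(2) by (subst (asm) sum_nonneg_eq_0_iff) auto
  then have "ln (l v) = v \<bullet> z + (ln (l o0) - o0 \<bullet> z)" if "v \<in> S" for v
    using that unfolding e_def \<beta>_def d_def by (force simp: inner_diff_left)
  then have "l v = exp (v \<bullet> z) * exp (ln (l o0) - o0 \<bullet> z)" if "v \<in> S" for v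
    using that by (metis (mono_tags, lifting) S_def exp_add exp_ln mem_Collect_eq)
  then have "(\<Sum>v\<in>S. c v * of_real (l v)) = (\<Sum>v\<in>S. c v * of_real (exp (v \<bullet> z))) * of_real (exp (ln (l o0) - o0 \<bullet> z))"
    by (simp add: sum_distrib_right mult.assoc)
  moreover have "(\<Sum>v\<in>S. c v * of_real (l v)) = (\<Sum>v\<in>E. c v * of_real (l v))"
    using fin l0 by (intro sum.mono_neutral_left) (auto simp: S_def not_less intro: antisym)
  ultimately show False using nz[of z] sum0 by simp
qed

section \<open>Oscillation of the argument of an exponential sum\<close>

lemma Rolle_card:
  fixes g g' :: "real \<Rightarrow> real"
  assumes "finite Z" "Z \<noteq> {}" "\<And>z. z \<in> Z \<Longrightarrow> g z = 0"
    and deriv: "\<And>x. (g has_real_derivative g' x) (at x)"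
  shows "\<exists>Z'. finite Z' \<and> card Z = Suc (card Z') \<and> (\<forall>z\<in>Z'. g' z = 0 \<and> z < Max Z)"
  using assms(1-3)
proof (induction Z rule: finite_linorder_max_induct)
  case (insert b Z)
  show ?case
  proof (cases "Z = {}")
    case True
    then show ?thesis by (intro exI[of _ "{}"]) simp
  next
    case False
    then obtain Z' where Z': "finite Z'" "card Z = Suc (card Z')" "\<forall>z\<in>Z'. g' z = 0 \<and> z < Max Z"
      using insert by auto
    let ?m = "Max Z"
    have m: "?m \<in> Z" using False insert by simp
    then have "?m < b" using insert by blast
    moreover have "g ?m = g b" using insert.prems m by simp
    moreover have "continuous_on {?m..b} g"
      using deriv by (meson DERIV_continuous_on has_field_derivative_at_within)
    moreover have "g differentiable (at x)" for x using deriv real_differentiable_def by blast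
    ultimately obtain z where z: "?m < z" "z < b" "DERIV g z :> 0" using Rolle by metis
    then have "g' z = 0" using deriv DERIV_unique by blast
    have "z \<notin> Z'" using Z' z by fastforce
    have "Max (insert b Z) = b" using insert.hyps False \<open>?m < b\<close> by (subst Max_insert) auto
    moreover have "b \<notin> Z" using insert by blast
    ultimately show ?thesis
      using Z' z \<open>g' z = 0\<close> \<open>z \<notin> Z'\<close> \<open>?m < b\<close> insert.hyps
      by (intro exI[of _ "insert z Z'"]) auto
  qed
qed simp

text \<open>Descartes' bound for real exponents: dividing by one of the exponentials and differentiating removes one
  term and, by Rolle, at most one zero.\<close>

lemma real_exp_sum_zeros:
  fixes B :: "real set" and b :: "real \<Rightarrow> real"
  assumes "finite B" "finite Z" "card B \<le> card Z" "\<And>z. z \<in> Z \<Longrightarrow> (\<Sum>\<beta>\<in>B. b \<beta> * exp (\<beta> * z)) = 0"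
  shows "\<forall>\<beta>\<in>B. b \<beta> = 0"
  using assms
proof (induction B arbitrary: Z b)
  case (insert \<beta>0 B)
  define g where "g z = (\<Sum>\<beta>\<in>insert \<beta>0 B. b \<beta> * exp ((\<beta> - \<beta>0) * z))" for z
  define g' where "g' z = (\<Sum>\<beta>\<in>insert \<beta>0 B. b \<beta> * (\<beta> - \<beta>0) * exp ((\<beta> - \<beta>0) * z))" for z
  have "g z = (\<Sum>\<beta>\<in>insert \<beta>0 B. b \<beta> * exp (\<beta> * z)) * exp (- \<beta>0 * z)" for z
    unfolding g_def sum_distrib_right by (intro sum.cong refl) (simp add: algebra_simps flip: exp_add)
  then have g0: "g z = 0" if "z \<in> Z" for z using insert.prems that by simp
  have deriv: "(g has_real_derivative g' x) (at x)" for x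
    unfolding g_def g'_def by (rule DERIV_sum) (auto intro!: derivative_eq_intros)
  have "Z \<noteq> {}" using insert by auto
  then obtain Z' where Z': "finite Z'" "card Z = Suc (card Z')" "\<forall>z\<in>Z'. g' z = 0"
    using Rolle_card[OF insert.prems(1) _ g0 deriv] by blast
  have "(\<Sum>\<beta>\<in>B. (b \<beta> * (\<beta> - \<beta>0)) * exp (\<beta> * z)) = g' z * exp (\<beta>0 * z)" for z
    unfolding g'_def using insert.hyps
    by (simp add: sum_distrib_right) (intro sum.cong refl, simp add: algebra_simps flip: exp_add)
  then have "\<forall>\<beta>\<in>B. b \<beta> * (\<beta> - \<beta>0) = 0"
    using Z' insert.prems(2) insert.hyps by (intro insert.IH[of Z' "\<lambda>\<beta>. b \<beta> * (\<beta> - \<beta>0)"]) auto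
  then have B: "\<forall>\<beta>\<in>B. b \<beta> = 0" using insert.hyps(2) by (metis eq_iff_diff_eq_0 mult_eq_0_iff)
  obtain z where "z \<in> Z" using \<open>Z \<noteq> {}\<close> by blast
  then have "b \<beta>0 = 0" using g0[of z] insert.hyps B by (simp add: g_def)
  with B show ?case by simp
qed simp

text \<open>The real part of the exponential sum vanishes whenever the argument \<open>Im l\<close> passes an odd multiple of \<open>pi / 2\<close>.
  A variation exceeding \<open>pi * (card E + 2)\<close> would produce more zeros than a nonzero real exponential sum with
  \<open>card E\<close> terms can have, and the real part cannot vanish identically, since the argument also passes
  multiples of \<open>pi\<close>.\<close>

lemma Im_log_exp_sum_oscillation:
  fixes E :: "'i set" and c :: "'i \<Rightarrow> complex" and e :: "'i \<Rightarrow> real" and l :: "real \<Rightarrow> complex"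
  assumes fin: "finite E" and cont: "continuous_on UNIV l"
    and log: "\<And>t. exp (l t) = (\<Sum>i\<in>E. c i * of_real (exp (e i * t)))"
  shows "Im (l t1) - Im (l t0) \<le> pi * (real (card E) + 2)"
proof (rule ccontr)
  assume "\<not> ?thesis"
  then have big: "Im (l t1) - Im (l t0) > pi * (real (card E) + 2)" by simp
  define u where "u t = Im (l t)" for t
  have "connected (range u)"
    unfolding u_def using cont by (intro connected_continuous_image continuous_intros) auto
  then have range: "w \<in> range u" if "u t0 \<le> w" "w \<le> u t1" for w
    using connectedD_interval[of "range u" "u t0" "u t1" w] that by auto
  define k where "k = \<lceil>(u t0 - pi/2) / pi\<rceil>"
  have k1: "(u t0 - pi/2) \<le> pi * k"
    using mult_left_mono[OF le_of_int_ceiling[of "(u t0 - pi/2) / pi"], of pi] unfolding k_def by simp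
  have "real_of_int k < (u t0 - pi/2) / pi + 1"
    using of_int_ceiling_le_add_one unfolding k_def by linarith
  then have k2: "pi * k < u t0 - pi/2 + pi"
    using pi_gt_zero by (simp add: field_simps)
  \<comment> \<open>\<open>k\<close> is chosen such that \<open>w 0, \<dots>, w (card E)\<close> are consecutive odd multiples of \<open>pi / 2\<close>, the first of them the least one at or above \<open>u t0\<close>.\<close>
  define w where "w j = pi/2 + pi * k + pi * real j" for j
  have "\<exists>t. u t = w j" if "j \<le> card E" for j
  proof -
    have "pi * real j \<le> pi * real (card E)" "0 \<le> pi * real j" using that by simp_all
    then have "u t0 \<le> w j" "w j \<le> u t1"
      using k1 k2 big pi_gt_zero unfolding w_def u_def distrib_left by linarith+
    then show ?thesis using range by (metis imageE)
  qed
  then obtain \<tau> where \<tau>: "\<And>j. j \<le> card E \<Longrightarrow> u (\<tau> j) = w j" by metis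
  define Z where "Z = \<tau> ` {..card E}"
  have "inj_on \<tau> {..card E}"
  proof (rule inj_onI)
    fix i j assume "i \<in> {..card E}" "j \<in> {..card E}" "\<tau> i = \<tau> j"
    then have "w i = w j" using \<tau> by (metis atMost_iff)
    then show "i = j" by (simp add: w_def)
  qed
  then have cardZ: "card Z = Suc (card E)" by (simp add: Z_def card_image)
  have Re_exp: "Re (exp (l t)) = exp (Re (l t)) * cos (u t)" for t by (simp add: Re_exp u_def)
  have cos_w: "cos (w j) = 0" for j
  proof -
    have "w j = pi/2 + pi * of_int (k + int j)" by (simp add: w_def algebra_simps)
    also have "cos \<dots> = 0"
    proof -
      have "sin (pi * of_int (k + int j)) = 0"
        unfolding sin_zero_iff_int2 by (intro exI[of _ "k + int j"]) simp
      then show ?thesis unfolding cos_add by simp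
    qed
    finally show ?thesis .
  qed
  define B where "B = e ` E"
  define b where "b \<beta> = (\<Sum>i\<in>{i\<in>E. e i = \<beta>}. Re (c i))" for \<beta>
  have Re_sum: "Re (exp (l t)) = (\<Sum>\<beta>\<in>B. b \<beta> * exp (\<beta> * t))" for t
  proof -
    have "Re (exp (l t)) = (\<Sum>i\<in>E. Re (c i) * exp (e i * t))" by (simp add: log)
    also have "\<dots> = (\<Sum>\<beta>\<in>B. \<Sum>i\<in>{i\<in>E. e i = \<beta>}. Re (c i) * exp (e i * t))"
      unfolding B_def using fin by (rule sum.image_gen)
    also have "\<dots> = (\<Sum>\<beta>\<in>B. b \<beta> * exp (\<beta> * t))"
      unfolding b_def sum_distrib_right by (intro sum.cong) auto
    finally show ?thesis .
  qed
  have "(\<Sum>\<beta>\<in>B. b \<beta> * exp (\<beta> * z)) = 0" if "z \<in> Z" for z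
    using that \<tau> by (auto simp: Z_def cos_w Re_exp simp flip: Re_sum)
  moreover have "card B \<le> card Z" using card_image_le[OF fin, of e] by (simp add: B_def cardZ)
  ultimately have "\<forall>\<beta>\<in>B. b \<beta> = 0"
    using fin by (intro real_exp_sum_zeros[of B Z]) (auto simp: B_def Z_def)
  then have "cos (u t) = 0" for t using Re_sum[of t] Re_exp[of t] by simp
  moreover have "\<exists>t. u t = w 0 + pi/2"
  proof -
    have "0 \<le> pi * real (card E)" by simp
    then have "u t0 \<le> w 0 + pi/2" "w 0 + pi/2 \<le> u t1"
      using k1 k2 big pi_gt_zero unfolding w_def u_def distrib_left of_nat_0 mult_zero_right by linarith+
    then show ?thesis using range by (metis imageE)
  qed
  then obtain t where "u t = w 0 + pi/2" by blast
  then have "cos (u t) = - sin (w 0)" by (simp add: cos_add)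
  moreover have "sin (w 0) \<noteq> 0" using cos_w[of 0] sin_cos_squared_add[of "w 0"] by auto
  ultimately show False by simp
qed

section \<open>Integration in logarithmic coordinates\<close>

lemma lborel_integral_translate:
  fixes h :: "'a::euclidean_space \<Rightarrow> 'b::{banach, second_countable_topology}"
  assumes "h \<in> borel_measurable borel"
  shows "integral\<^sup>L lborel (\<lambda>y. h (y + w)) = integral\<^sup>L lborel h"
    and "integrable lborel (\<lambda>y. h (y + w)) \<longleftrightarrow> integrable lborel h"
proof -
  have [measurable]: "(+) w \<in> borel_measurable borel" by simp
  show "integral\<^sup>L lborel (\<lambda>y. h (y + w)) = integral\<^sup>L lborel h"
    using integral_distr[of "(+) w" lborel borel h] assms by (simp add: lborel_distr_plus add.commute)
  show "integrable lborel (\<lambda>y. h (y + w)) \<longleftrightarrow> integrable lborel h"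
    using integrable_distr_eq[of "(+) w" lborel borel h] assms by (simp add: lborel_distr_plus add.commute)
qed

text \<open>By translation invariance the difference \<open>g (y + v) - g y\<close> integrates to \<open>0\<close>; writing it as the integral of
  \<open>g'\<close> over the segment and exchanging the integrals gives the integral of \<open>g'\<close>.\<close>

lemma integral_directional_derivative_eq_0:
  fixes g g' :: "'a::euclidean_space \<Rightarrow> complex"
  assumes int_g: "integrable lborel g" and int_g': "integrable lborel g'"
    and cont: "continuous_on UNIV g'"
    and deriv: "\<And>y a. ((\<lambda>a. g (y + a *\<^sub>R v)) has_vector_derivative g' (y + a *\<^sub>R v)) (at a)"
  shows "integral\<^sup>L lborel g' = 0"
proof -
  have g'_meas[measurable]: "g' \<in> borel_measurable borel" using cont by (rule borel_measurable_continuous_onI)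
  have g_meas[measurable]: "g \<in> borel_measurable borel" using int_g by simp
  define k where "k a y = indicator {0..1} a *\<^sub>R g' (y + a *\<^sub>R v)" for a :: real and y
  have [measurable]: "case_prod k \<in> borel_measurable (lborel \<Otimes>\<^sub>M lborel)"
    unfolding k_def by measurable
  have int_norm: "integrable lborel (\<lambda>y. norm (g' y))" using int_g' by simp
  have "(\<integral>y. norm (k a y) \<partial>lborel) = indicator {0..1} a * (\<integral>y. norm (g' y) \<partial>lborel)" for a
    unfolding k_def using lborel_integral_translate(1)[of "\<lambda>y. norm (g' y)" "a *\<^sub>R v"] by simp
  moreover have "integrable lborel (\<lambda>a::real. indicator {0..1} a * c)" for c :: real
    by (intro integrable_mult_left) simp
  ultimately have "integrable lborel (\<lambda>a. \<integral>y. norm (k a y) \<partial>lborel)" by simp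
  moreover have "integrable lborel (k a)" for a
    unfolding k_def using int_g' lborel_integral_translate(2)[of g' "a *\<^sub>R v"] by simp
  ultimately have "integrable (lborel \<Otimes>\<^sub>M lborel) (case_prod k)"
    by (intro lborel_pair.Fubini_integrable) auto
  then have "(\<integral>y. (\<integral>a. k a y \<partial>lborel) \<partial>lborel) = (\<integral>a. (\<integral>y. k a y \<partial>lborel) \<partial>lborel)"
    by (rule lborel_pair.Fubini_integral)
  moreover have "(\<integral>y. k a y \<partial>lborel) = indicator {0..1} a *\<^sub>R integral\<^sup>L lborel g'" for a
    unfolding k_def using lborel_integral_translate(1)[of g' "a *\<^sub>R v"] by simp
  moreover have "(\<integral>a. k a y \<partial>lborel) = g (y + v) - g y" for y
  proof -
    have "(\<integral>a. k a y \<partial>lborel) = g (y + 1 *\<^sub>R v) - g (y + 0 *\<^sub>R v)"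
      unfolding k_def
    proof (rule integral_FTC_Icc)
      show "continuous_on {0..1} (\<lambda>x. g' (y + x *\<^sub>R v))"
        by (intro continuous_on_compose2[OF cont] continuous_intros) auto
      show "((\<lambda>x. g (y + x *\<^sub>R v)) has_vector_derivative g' (y + x *\<^sub>R v)) (at x within {0..1})" for x
        using deriv by (rule has_vector_derivative_at_within)
    qed simp
    then show ?thesis by simp
  qed
  moreover have "(\<integral>y. g (y + v) - g y \<partial>lborel) = 0"
    using int_g lborel_integral_translate[of g v] by simp
  ultimately show ?thesis by simp
qed

text \<open>Comparison with a product of one-dimensional exponentials, using \<open>\<Sum>\<^sub>b |y \<bullet> b| \<le> DIM('a) * norm y\<close>.\<close>

lemma exp_minus_norm_integrable:
  fixes \<epsilon> :: real
  assumes "\<epsilon> > 0"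
  shows "integrable lborel (\<lambda>y::'a::euclidean_space. exp (- \<epsilon> * norm y))"
proof -
  have half: "(\<integral>\<^sup>+x. ennreal (exp (- d * x)) * indicator {0..} x \<partial>lborel) = ennreal (1 / d)" if "d > 0" for d :: real
  proof -
    have "((\<lambda>x. - exp (- d * x) / d) \<longlongrightarrow> - 0 / d) at_top"
      using that by (intro tendsto_intros filterlim_compose[OF exp_at_bot]
          filterlim_tendsto_neg_mult_at_bot[OF tendsto_const _ filterlim_ident]) auto
    then have "(\<integral>\<^sup>+x. ennreal (exp (- d * x)) * indicator {0..} x \<partial>lborel) = ennreal (- 0 / d - (- exp (- d * 0) / d))"
      using that by (intro nn_integral_FTC_atLeast) (auto intro!: derivative_eq_intros)
    then show ?thesis by simp
  qed
  have line: "(\<integral>\<^sup>+x. ennreal (exp (- d * \<bar>x\<bar>)) \<partial>lborel) < \<infinity>" if "d > 0" for d :: real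
  proof -
    let ?h = "\<lambda>x::real. ennreal (exp (- d * x)) * indicator {0..} x"
    have "(\<integral>\<^sup>+x. ennreal (exp (- d * \<bar>x\<bar>)) \<partial>lborel) \<le> (\<integral>\<^sup>+x. ?h x + ?h (0 + (-1) * x) \<partial>lborel)"
      by (intro nn_integral_mono) (auto split: split_indicator)
    also have "\<dots> = integral\<^sup>N lborel ?h + (\<integral>\<^sup>+x. ?h (0 + (-1) * x) \<partial>lborel)"
      by (intro nn_integral_add) measurable
    also have "(\<integral>\<^sup>+x. ?h (0 + (-1) * x) \<partial>lborel) = integral\<^sup>N lborel ?h"
      using nn_integral_real_affine[of ?h "-1" 0] by simp
    finally show ?thesis unfolding half[OF that] by (simp add: ennreal_add_eq_top less_top order.strict_trans1)
  qed
  define d where "d = \<epsilon> / DIM('a)"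
  have d: "d > 0" using assms by (simp add: d_def)
  have "exp (- \<epsilon> * norm y) \<le> (\<Prod>b\<in>Basis. exp (- d * \<bar>y \<bullet> b\<bar>))" for y :: 'a
  proof -
    have "(\<Sum>b\<in>(Basis::'a set). \<bar>y \<bullet> b\<bar>) \<le> DIM('a) * norm y"
      by (rule sum_bounded_above) (rule Basis_le_norm)
    then have "d * (\<Sum>b\<in>Basis. \<bar>y \<bullet> b\<bar>) \<le> d * (DIM('a) * norm y)" using d by (intro mult_left_mono) auto
    also have "\<dots> = \<epsilon> * norm y" by (simp add: d_def)
    finally have "exp (- \<epsilon> * norm y) \<le> exp (\<Sum>b\<in>Basis. - d * \<bar>y \<bullet> b\<bar>)"
      by (simp add: sum_negf sum_distrib_left)
    then show ?thesis by (simp only: exp_sum[OF finite_Basis])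
  qed
  then have "(\<integral>\<^sup>+y. ennreal (exp (- \<epsilon> * norm y)) \<partial>(lborel :: 'a measure)) \<le>
      (\<integral>\<^sup>+y. (\<Prod>b\<in>Basis. ennreal (exp (- d * \<bar>y \<bullet> b\<bar>))) \<partial>(lborel :: 'a measure))"
    by (intro nn_integral_mono) (simp only: prod_ennreal exp_ge_zero ennreal_leI)
  also have "\<dots> = (\<Prod>b\<in>(Basis::'a set). (\<integral>\<^sup>+x. ennreal (exp (- d * \<bar>x\<bar>)) \<partial>lborel))"
    by (rule nn_integral_lborel_prod) auto
  also have "\<dots> < \<infinity>"
    using line[OF d] by (simp add: power_eq_top_ennreal less_top[symmetric])
  finally show ?thesis by (intro integrableI_bounded) auto
qed

lemma norm_exp_minus_1_minus_le:
  fixes z :: complex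
  shows "norm (exp z - 1 - z) \<le> (norm z)\<^sup>2 * exp (norm z)"
proof -
  have "norm (exp z - (\<Sum>k\<le>1. z ^ k / fact k)) \<le> exp \<bar>Re z\<bar> * norm z ^ Suc 1 / fact 1"
    by (rule Taylor_exp)
  also have "(\<Sum>k\<le>1. z ^ k / fact k) = 1 + z" by simp
  also have "exp \<bar>Re z\<bar> * norm z ^ Suc 1 / fact 1 \<le> (norm z)\<^sup>2 * exp (norm z)"
    using abs_Re_le_cmod[of z] by (simp add: power2_eq_square mult.commute[of _ "exp _"] mult_right_mono)
  finally show ?thesis by (simp add: algebra_simps)
qed

text \<open>Differentiation under the integral sign, with the remainder of the exponential series bounded quadratically.
  The factor \<open>exp (r * w y)\<close> in the integrability hypothesis absorbs the polynomial factors \<open>w y\<close> and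
  \<open>(w y)\<^sup>2\<close> as well as the growth of the integrand in a small neighbourhood of \<open>p0\<close>.\<close>

lemma laplace_transform_has_derivative:
  fixes B :: "'a::real_normed_vector \<Rightarrow> 'b::euclidean_space \<Rightarrow> complex" and w :: "'b \<Rightarrow> real"
  assumes add: "\<And>p q y. B (p + q) y = B p y + B q y"
    and scale: "\<And>c p y. B (c *\<^sub>R p) y = of_real c * B p y"
    and bound: "\<And>p y. norm (B p y) \<le> norm p * w y"
    and w0: "\<And>y. 0 \<le> w y"
    and meas[measurable]: "\<And>p. B p \<in> borel_measurable M"
    and r: "r > 0" and int: "integrable M (\<lambda>y. exp (Re (B p0 y) + r * w y))"
  shows "((\<lambda>p. \<integral>y. exp (B p y) \<partial>M) has_derivative (\<lambda>v. \<integral>y. B v y * exp (B p0 y) \<partial>M)) (at p0)"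
    and "integrable M (\<lambda>y. exp (B p0 y))"
proof -
  have w_le: "w y \<le> (1/r) * exp (r * w y)" for y
  proof -
    have "r * w y \<le> exp (r * w y)" using exp_ge_add_one_self[of "r * w y"] by linarith
    then show ?thesis using r by (simp add: field_simps)
  qed
  have intD: "integrable M (\<lambda>y. B v y * exp (B p0 y))" for v
  proof (rule Bochner_Integration.integrable_bound)
    show "integrable M (\<lambda>y. (norm v * (1/r)) * exp (Re (B p0 y) + r * w y))"
      using int by (rule integrable_mult_right)
    have "norm (B v y * exp (B p0 y)) \<le> (norm v * (1/r)) * exp (Re (B p0 y) + r * w y)" for y
    proof -
      have "norm (B v y * exp (B p0 y)) \<le> (norm v * w y) * exp (Re (B p0 y))"
        unfolding norm_mult norm_exp_eq_Re by (intro mult_right_mono bound) auto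
      also have "\<dots> \<le> (norm v * ((1/r) * exp (r * w y))) * exp (Re (B p0 y))"
        by (intro mult_right_mono mult_left_mono w_le) auto
      finally show ?thesis by (simp add: exp_add mult_ac)
    qed
    then show "AE y in M. norm (B v y * exp (B p0 y)) \<le> norm ((norm v * (1/r)) * exp (Re (B p0 y) + r * w y))"
      using r by (intro AE_I2) (simp add: abs_mult)
  qed measurable
  have intE: "integrable M (\<lambda>y. exp (B (p0 + h) y))" if h: "norm h \<le> r" for h
  proof (rule Bochner_Integration.integrable_bound[OF int])
    have "norm (exp (B (p0 + h) y)) \<le> exp (Re (B p0 y) + r * w y)" for y
    proof -
      have "Re (B h y) \<le> norm h * w y" using bound[of h y] complex_Re_le_cmod[of "B h y"] by linarith
      also have "\<dots> \<le> r * w y" by (intro mult_right_mono h w0)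
      finally show ?thesis by (simp add: norm_exp_eq_Re add)
    qed
    then show "AE y in M. norm (exp (B (p0 + h) y)) \<le> norm (exp (Re (B p0 y) + r * w y))" by simp
  qed measurable
  from intE[of 0] r show int0: "integrable M (\<lambda>y. exp (B p0 y))" by simp
  define D where "D v = (\<integral>y. B v y * exp (B p0 y) \<partial>M)" for v
  define K where "K = (\<integral>y. exp (Re (B p0 y) + r * w y) \<partial>M)"
  have K0: "0 \<le> K" unfolding K_def by (rule integral_nonneg_AE) simp
  have Dlin: "bounded_linear D"
  proof (rule bounded_linear_intro[where K = "1/r * K"])
    show "D (u + v) = D u + D v" for u v
      unfolding D_def using intD by (simp add: add distrib_right)
    show "D (c *\<^sub>R v) = c *\<^sub>R D v" for c v
      unfolding D_def by (simp add: scale scaleR_conv_of_real mult.assoc)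
    show "norm (D v) \<le> norm v * (1/r * K)" for v
    proof -
      have "norm (D v) \<le> (\<integral>y. (norm v * (1/r)) * exp (Re (B p0 y) + r * w y) \<partial>M)"
        unfolding D_def
      proof (rule Bochner_Integration.integral_norm_bound_integral[OF intD])
        show "integrable M (\<lambda>y. (norm v * (1/r)) * exp (Re (B p0 y) + r * w y))"
          using int by (rule integrable_mult_right)
        fix y
        have "norm (B v y * exp (B p0 y)) \<le> (norm v * w y) * exp (Re (B p0 y))"
          unfolding norm_mult norm_exp_eq_Re by (intro mult_right_mono bound) auto
        also have "\<dots> \<le> (norm v * ((1/r) * exp (r * w y))) * exp (Re (B p0 y))"
          by (intro mult_right_mono mult_left_mono w_le) auto
        finally show "norm (B v y * exp (B p0 y)) \<le> (norm v * (1/r)) * exp (Re (B p0 y) + r * w y)"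
          by (simp add: exp_add mult_ac)
      qed
      then show ?thesis by (simp add: K_def mult.assoc)
    qed
  qed
  define C where "C = (16 / r\<^sup>2) * K"
  have remainder: "norm ((\<integral>y. exp (B (p0 + h) y) \<partial>M) - (\<integral>y. exp (B p0 y) \<partial>M) - D h) \<le> (norm h)\<^sup>2 * C"
    if h: "norm h \<le> r / 2" for h
  proof -
    have hr: "norm h \<le> r" using h r by simp
    have "norm (\<integral>y. exp (B (p0 + h) y) - exp (B p0 y) - B h y * exp (B p0 y) \<partial>M)
       \<le> (\<integral>y. ((norm h)\<^sup>2 * (16 / r\<^sup>2)) * exp (Re (B p0 y) + r * w y) \<partial>M)"
    proof (rule Bochner_Integration.integral_norm_bound_integral)
      show "integrable M (\<lambda>y. exp (B (p0 + h) y) - exp (B p0 y) - B h y * exp (B p0 y))"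
        using intE[OF hr] int0 intD by simp
      show "integrable M (\<lambda>y. ((norm h)\<^sup>2 * (16 / r\<^sup>2)) * exp (Re (B p0 y) + r * w y))"
        using int by (rule integrable_mult_right)
      fix y
      have "exp (B (p0 + h) y) - exp (B p0 y) - B h y * exp (B p0 y) = (exp (B h y) - 1 - B h y) * exp (B p0 y)"
        by (simp add: add exp_add algebra_simps)
      then have "norm (exp (B (p0 + h) y) - exp (B p0 y) - B h y * exp (B p0 y))
          \<le> ((norm (B h y))\<^sup>2 * exp (norm (B h y))) * exp (Re (B p0 y))"
        unfolding norm_mult norm_exp_eq_Re
        by (simp only:) (simp add: norm_mult norm_exp_minus_1_minus_le mult_right_mono)
      also have "\<dots> \<le> ((norm h * w y)\<^sup>2 * exp (norm h * w y)) * exp (Re (B p0 y))"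
        using bound[of h y] by (intro mult_right_mono mult_mono power_mono) auto
      also have "\<dots> \<le> ((norm h * (4/r * exp (r/4 * w y)))\<^sup>2 * exp (r/2 * w y)) * exp (Re (B p0 y))"
      proof -
        have "w y \<le> 4/r * exp (r/4 * w y)"
        proof -
          have "r/4 * w y \<le> exp (r/4 * w y)" using exp_ge_add_one_self[of "r/4 * w y"] by linarith
          then show ?thesis using r by (simp add: field_simps)
        qed
        moreover have "norm h * w y \<le> r/2 * w y" using h w0 by (intro mult_right_mono)
        ultimately show ?thesis using w0[of y]
          by (intro mult_right_mono mult_mono power_mono mult_left_mono) auto
      qed
      also have "\<dots> = ((norm h)\<^sup>2 * (16 / r\<^sup>2)) * exp (Re (B p0 y) + r * w y)"
      proof -
        have "(exp (r/4 * w y))\<^sup>2 * exp (r/2 * w y) = exp (r * w y)"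
          by (simp add: power2_eq_square flip: exp_add)
        then show ?thesis by (simp add: power_mult_distrib exp_add power_divide mult_ac)
      qed
      finally show "norm (exp (B (p0 + h) y) - exp (B p0 y) - B h y * exp (B p0 y))
         \<le> ((norm h)\<^sup>2 * (16 / r\<^sup>2)) * exp (Re (B p0 y) + r * w y)" .
    qed
    then show ?thesis using intE[OF hr] int0 intD by (simp add: D_def C_def K_def mult_ac)
  qed
  have "((\<lambda>p. \<integral>y. exp (B p y) \<partial>M) has_derivative D) (at p0)"
    unfolding has_derivative_at
  proof (intro conjI Dlin)
    let ?q = "\<lambda>h. norm ((\<integral>y. exp (B (p0 + h) y) \<partial>M) - (\<integral>y. exp (B p0 y) \<partial>M) - D h) / norm h"
    show "?q \<midarrow>0\<rightarrow> 0"
    proof (rule Lim_null_comparison)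
      have "eventually (\<lambda>h::'a. norm h < r / 2) (at 0)"
        using r by (auto simp: eventually_at dist_norm intro!: exI[of _ "r/2"])
      then show "eventually (\<lambda>h. norm (?q h) \<le> norm h * C) (at 0)"
      proof eventually_elim
        case (elim h)
        then show ?case
          using remainder[of h] by (cases "h = 0") (auto simp: divide_le_eq power2_eq_square mult_ac)
      qed
      have "((\<lambda>h::'a. norm h * C) \<longlongrightarrow> norm (0::'a) * C) (at 0)"
        by (intro tendsto_intros)
      then show "((\<lambda>h::'a. norm h * C) \<longlongrightarrow> 0) (at 0)" by simp
    qed
  qed
  then show "((\<lambda>p. \<integral>y. exp (B p y) \<partial>M) has_derivative (\<lambda>v. \<integral>y. B v y * exp (B p0 y) \<partial>M)) (at p0)"
    unfolding D_def .
qed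

definition exp_vec :: "real ^ 'n::finite \<Rightarrow> real ^ 'n" where "exp_vec y = (\<chi> i. exp (y $ i))"
definition ln_vec :: "real ^ 'n::finite \<Rightarrow> real ^ 'n" where "ln_vec x = (\<chi> i. ln (x $ i))"

text \<open>The density of the multiplicative Haar measure \<open>dz\<^sub>1 \<dots> dz\<^sub>n / (z\<^sub>1 \<dots> z\<^sub>n)\<close> on the orthant.\<close>

definition orthant_density :: "real ^ 'n::finite \<Rightarrow> real" where
  "orthant_density x = indicator orthant x / (\<Prod>i\<in>UNIV. x $ i)"

lemma prod_Basis_vec:
  fixes F :: "real ^ 'n::finite \<Rightarrow> 'c::comm_monoid_mult"
  shows "(\<Prod>b\<in>Basis. F b) = (\<Prod>i\<in>UNIV. F (axis i 1))"
proof -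
  have Basis_eq: "(Basis :: (real ^ 'n) set) = range (\<lambda>i. axis i 1)" by (auto simp: Basis_vec_def)
  have inj: "inj (\<lambda>i::'n. axis i (1::real))" by (auto simp: inj_def axis_eq_axis)
  show ?thesis unfolding Basis_eq prod.reindex[OF inj] o_def ..
qed

lemma open_orthant: "open (orthant :: (real ^ 'n::finite) set)"
proof -
  have eq: "(orthant :: (real ^ 'n) set) = (\<Inter>i\<in>UNIV. {x. 0 < x $ i})" by (auto simp: orthant_def)
  show ?thesis
    unfolding eq by (intro open_INT ballI open_Collect_less continuous_intros finite)
qed

lemma measurable_component[measurable]: "(\<lambda>x::real ^ 'n::finite. x $ i) \<in> borel_measurable borel"
  by (intro borel_measurable_continuous_onI continuous_intros)

lemma measurable_orthant_density[measurable]: "orthant_density \<in> borel_measurable borel"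
proof -
  have [measurable]: "orthant \<in> sets borel" using open_orthant by (rule borel_open)
  show ?thesis unfolding orthant_density_def[abs_def] by measurable
qed

lemma measurable_ln_vec[measurable]: "ln_vec \<in> borel_measurable borel"
proof -
  have "(\<lambda>x::real ^ 'n::finite. ln_vec x \<bullet> axis j 1) \<in> borel_measurable borel" for j
    by (simp add: ln_vec_def inner_axis)
  then show ?thesis
    by (subst borel_measurable_euclidean_space) (auto simp: Basis_vec_def)
qed

lemma orthant_density_nonneg: "0 \<le> orthant_density x"
  by (auto simp: orthant_density_def orthant_def indicator_def intro: prod_nonneg less_imp_le)

lemma nn_integral_inverse_interval:
  fixes a b :: real
  assumes "a \<le> b"
  shows "(\<integral>\<^sup>+u. ennreal (indicator {exp a<..<exp b} u / u) \<partial>lborel) = ennreal (b - a)"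
proof -
  have "(\<integral>\<^sup>+u. ennreal (indicator {exp a<..<exp b} u / u) \<partial>lborel) =
     (\<integral>\<^sup>+u. ennreal (1 / u) * indicator {exp a..exp b} u \<partial>lborel)"
    using AE_lborel_singleton[of "exp a"] AE_lborel_singleton[of "exp b"]
    by (intro nn_integral_cong_AE) (auto split: split_indicator)
  also have "\<dots> = ennreal (ln (exp b) - ln (exp a))"
  proof (rule nn_integral_FTC_Icc)
    fix x assume "x \<in> {exp a..exp b}"
    then have "0 < x" using exp_gt_zero[of a] by (simp only: atLeastAtMost_iff) linarith
    then show "DERIV ln x :> 1 / x" "0 \<le> 1 / x" by (auto intro!: derivative_eq_intros)
  qed (use assms in auto)
  finally show ?thesis by simp
qed

text \<open>Lebesgue measure is determined by its values on boxes, and there the substitution splits into the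
  one-dimensional integrals of \<open>1 / u\<close>.\<close>

lemma lborel_eq_distr_ln_vec:
  "lborel = distr (density lborel (\<lambda>x. ennreal (orthant_density x))) borel (ln_vec :: real ^ 'n::finite \<Rightarrow> _)"
proof (rule lborel_eqI)
  fix l u :: "real ^ 'n"
  assume lu: "\<And>b. b \<in> Basis \<Longrightarrow> l \<bullet> b \<le> u \<bullet> b"
  then have lu': "l $ i \<le> u $ i" for i using lu[of "axis i 1"] by (simp add: inner_axis)
  let ?H = "density lborel (\<lambda>x::real ^ 'n. ennreal (orthant_density x))"
  have [measurable]: "ln_vec -` box l u \<in> sets borel"
    using measurable_sets[OF measurable_ln_vec, of "box l u"] by simp
  have "emeasure (distr ?H borel ln_vec) (box l u) = emeasure ?H (ln_vec -` box l u)"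
    by (subst emeasure_distr) auto
  also have "\<dots> = (\<integral>\<^sup>+x. ennreal (orthant_density x) * indicator (ln_vec -` box l u) x \<partial>lborel)"
    by (rule emeasure_density) auto
  also have "\<dots> = (\<integral>\<^sup>+x. (\<Prod>b\<in>Basis. ennreal (indicator {exp (l \<bullet> b)<..<exp (u \<bullet> b)} (x \<bullet> b) / (x \<bullet> b))) \<partial>lborel)"
  proof (intro nn_integral_cong)
    fix x :: "real ^ 'n"
    have iff: "0 < t \<and> a < ln t \<and> ln t < b \<longleftrightarrow> exp a < t \<and> t < exp b" for a b t :: real
      using exp_gt_zero[of a] by (smt (verit) exp_less_cancel_iff exp_ln)
    have "ennreal (orthant_density x) * indicator (ln_vec -` box l u) x =
      ennreal (indicator (orthant \<inter> ln_vec -` box l u) x / (\<Prod>i\<in>UNIV. x $ i))"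
      by (auto simp: orthant_density_def split: split_indicator)
    also have "indicator (orthant \<inter> ln_vec -` box l u) x = (\<Prod>i\<in>UNIV. indicator {exp (l $ i)<..<exp (u $ i)} (x $ i) :: real)"
    proof -
      have "x \<in> orthant \<inter> ln_vec -` box l u \<longleftrightarrow> (\<forall>i. x $ i \<in> {exp (l $ i)<..<exp (u $ i)})"
        unfolding greaterThanLessThan_iff iff[symmetric]
        by (auto simp: orthant_def ln_vec_def mem_box_cart)
      then show ?thesis
        by (cases "x \<in> orthant \<inter> ln_vec -` box l u") (auto simp: indicator_def)
    qed
    finally show "ennreal (orthant_density x) * indicator (ln_vec -` box l u) x =
      (\<Prod>b\<in>Basis. ennreal (indicator {exp (l \<bullet> b)<..<exp (u \<bullet> b)} (x \<bullet> b) / (x \<bullet> b)))"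
      unfolding prod_Basis_vec inner_axis
      by (subst prod_ennreal) (auto simp: prod_dividef indicator_def intro!: less_imp_le order.strict_trans[OF exp_gt_zero])
  qed
  also have "\<dots> = (\<Prod>b\<in>Basis. \<integral>\<^sup>+v. ennreal (indicator {exp (l \<bullet> b)<..<exp (u \<bullet> b)} v / v) \<partial>lborel)"
    by (rule nn_integral_lborel_prod) auto
  also have "\<dots> = (\<Prod>b\<in>Basis. ennreal ((u - l) \<bullet> b))"
    using lu by (intro prod.cong refl) (subst nn_integral_inverse_interval, auto simp: inner_diff_left)
  also have "\<dots> = ennreal (\<Prod>b\<in>Basis. (u - l) \<bullet> b)"
    using lu by (intro prod_ennreal) (auto simp: inner_diff_left)
  finally show "emeasure (distr ?H borel ln_vec) (box l u) = ennreal (\<Prod>b\<in>Basis. (u - l) \<bullet> b)" .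
qed simp

lemma logarithmic_substitution:
  fixes h :: "real ^ 'n::finite \<Rightarrow> complex"
  assumes [measurable]: "h \<in> borel_measurable borel"
  shows "integrable lborel (\<lambda>x. orthant_density x *\<^sub>R h (ln_vec x)) \<longleftrightarrow> integrable lborel h"
    and "(\<integral>x. orthant_density x *\<^sub>R h (ln_vec x) \<partial>lborel) = integral\<^sup>L lborel h"
proof -
  let ?H = "density lborel (\<lambda>x::real ^ 'n. ennreal (orthant_density x))"
  have [measurable]: "(\<lambda>x. h (ln_vec x)) \<in> borel_measurable borel" by measurable
  have "integrable lborel h \<longleftrightarrow> integrable ?H (\<lambda>x. h (ln_vec x))"
    by (subst lborel_eq_distr_ln_vec, rule integrable_distr_eq) auto
  also have "\<dots> \<longleftrightarrow> integrable lborel (\<lambda>x. orthant_density x *\<^sub>R h (ln_vec x))"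
    by (rule integrable_density) (auto simp: orthant_density_nonneg)
  finally show "integrable lborel (\<lambda>x. orthant_density x *\<^sub>R h (ln_vec x)) \<longleftrightarrow> integrable lborel h" ..
  have "integral\<^sup>L lborel h = integral\<^sup>L ?H (\<lambda>x. h (ln_vec x))"
    by (subst lborel_eq_distr_ln_vec, rule integral_distr) auto
  also have "\<dots> = (\<integral>x. orthant_density x *\<^sub>R h (ln_vec x) \<partial>lborel)"
    by (rule integral_density) (auto simp: orthant_density_nonneg)
  finally show "(\<integral>x. orthant_density x *\<^sub>R h (ln_vec x) \<partial>lborel) = integral\<^sup>L lborel h" ..
qed

section \<open>Holomorphic functions of several variables and continuation by recurrences\<close>

text \<open>The pointwise form of the notion of holomorphy, for which closure properties are convenient to state.\<close>

definition complex_differentiable_at ::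
    "((complex ^ 'n::finite) \<times> (complex ^ 'm::finite) \<Rightarrow> complex) \<Rightarrow> (complex ^ 'n) \<times> (complex ^ 'm) \<Rightarrow> bool" where
  "complex_differentiable_at F p \<longleftrightarrow>
     (\<exists>D. (F has_derivative D) (at p) \<and> (\<forall>c v w. D (c *s v, c *s w) = c * D (v, w)))"

lemma holomorphic_several_on_iff:
  "holomorphic_several_on F U \<longleftrightarrow> open U \<and> (\<forall>p\<in>U. complex_differentiable_at F p)"
  by (simp add: holomorphic_several_on_def complex_differentiable_at_def)

lemma complex_differentiable_const: "complex_differentiable_at (\<lambda>_. c) p"
  unfolding complex_differentiable_at_def by (intro exI[of _ "\<lambda>_. 0"]) auto

lemma complex_differentiable_add:
  assumes "complex_differentiable_at F p" "complex_differentiable_at G p"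
  shows "complex_differentiable_at (\<lambda>p. F p + G p) p"
proof -
  from assms obtain D E where *: "(F has_derivative D) (at p)" "\<And>c v w. D (c *s v, c *s w) = c * D (v, w)"
    "(G has_derivative E) (at p)" "\<And>c v w. E (c *s v, c *s w) = c * E (v, w)"
    unfolding complex_differentiable_at_def by blast
  show ?thesis
    unfolding complex_differentiable_at_def
    by (intro exI[of _ "\<lambda>h. D h + E h"] conjI has_derivative_add *) (simp add: * distrib_left)
qed

lemma complex_differentiable_mult:
  assumes "complex_differentiable_at F p" "complex_differentiable_at G p"
  shows "complex_differentiable_at (\<lambda>p. F p * G p) p"
proof -
  from assms obtain D E where *: "(F has_derivative D) (at p)" "\<And>c v w. D (c *s v, c *s w) = c * D (v, w)"
    "(G has_derivative E) (at p)" "\<And>c v w. E (c *s v, c *s w) = c * E (v, w)"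
    unfolding complex_differentiable_at_def by blast
  show ?thesis
    unfolding complex_differentiable_at_def
    by (intro exI[of _ "\<lambda>h. F p * E h + D h * G p"] conjI has_derivative_mult *) (simp add: * algebra_simps)
qed

lemma complex_differentiable_sum:
  assumes "\<And>i. i \<in> I \<Longrightarrow> complex_differentiable_at (F i) p"
  shows "complex_differentiable_at (\<lambda>p. \<Sum>i\<in>I. F i p) p"
  using assms
  by (induction I rule: infinite_finite_induct)
     (auto intro: complex_differentiable_const complex_differentiable_add)

lemma complex_differentiable_prod:
  assumes "\<And>i. i \<in> I \<Longrightarrow> complex_differentiable_at (F i) p"
  shows "complex_differentiable_at (\<lambda>p. \<Prod>i\<in>I. F i p) p"
  using assms
  by (induction I rule: infinite_finite_induct)
     (auto intro: complex_differentiable_const complex_differentiable_mult)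

lemma complex_differentiable_compose:
  assumes "complex_differentiable_at F p" "(g has_field_derivative g') (at (F p))"
  shows "complex_differentiable_at (\<lambda>p. g (F p)) p"
proof -
  from assms(1) obtain D where *: "(F has_derivative D) (at p)" "\<And>c v w. D (c *s v, c *s w) = c * D (v, w)"
    unfolding complex_differentiable_at_def by blast
  have "((\<lambda>p. g (F p)) has_derivative (\<lambda>h. g' * D h)) (at p)"
    using has_derivative_compose[OF *(1) assms(2)[unfolded has_field_derivative_def]] .
  then show ?thesis
    unfolding complex_differentiable_at_def by (intro exI[of _ "\<lambda>h. g' * D h"]) (simp add: *)
qed

lemma complex_differentiable_shift:
  assumes "complex_differentiable_at F (p + v)"
  shows "complex_differentiable_at (\<lambda>p. F (p + v)) p"
proof -
  from assms obtain D where *: "(F has_derivative D) (at (p + v))" "\<And>c v w. D (c *s v, c *s w) = c * D (v, w)"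
    unfolding complex_differentiable_at_def by blast
  have "((\<lambda>p. p + v) has_derivative (\<lambda>h. h)) (at p)" by (auto intro!: derivative_eq_intros)
  from has_derivative_compose[OF this *(1)] show ?thesis
    unfolding complex_differentiable_at_def using *(2) by (intro exI[of _ D]) simp
qed

lemma complex_differentiable_cong:
  assumes "complex_differentiable_at F p" "open U" "p \<in> U" "\<And>q. q \<in> U \<Longrightarrow> G q = F q"
  shows "complex_differentiable_at G p"
proof -
  from assms(1) obtain D where *: "(F has_derivative D) (at p)" "\<And>c v w. D (c *s v, c *s w) = c * D (v, w)"
    unfolding complex_differentiable_at_def by blast
  have "(G has_derivative D) (at p)"
    using has_derivative_transform_within_open[OF *(1) assms(2,3)] assms(4) by metis
  then show ?thesis unfolding complex_differentiable_at_def using *(2) by blast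
qed

lemma complex_differentiable_linear:
  assumes "linear F" "\<And>c v w. F (c *s v, c *s w) = c * F (v, w)"
  shows "complex_differentiable_at F p"
  unfolding complex_differentiable_at_def
  using assms linear_imp_has_derivative by blast

lemma complex_differentiable_component: "complex_differentiable_at (\<lambda>p. snd p $ i) p"
  by (rule complex_differentiable_linear) (auto intro!: linearI)

text \<open>Each recurrence defines an operator that extends functions from the region \<open>form l > - r l\<close> to the region
  where \<open>r l\<close> is increased by \<open>1\<close>, because its right-hand side only looks at points where \<open>form l\<close> is larger by at
  least \<open>1\<close> and no other form is smaller. The composite \<open>T\<close> of these operators over all \<open>l\<close> pushes all
  bounds down at once and fixes \<open>\<Phi>0\<close> on the original region. The iterates of \<open>T\<close> agree wherever they are both
  defined, since \<open>T g\<close> on a region depends only on \<open>g\<close> on the previous one. This purely algebraic argument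
  replaces the identity theorem.\<close>

lemma entire_continuation:
  fixes \<Phi>0 :: "(complex ^ 'n::finite) \<times> (complex ^ 'm::finite) \<Rightarrow> complex"
    and form :: "'i \<Rightarrow> (complex ^ 'n) \<times> (complex ^ 'm) \<Rightarrow> real"
  assumes fin: "finite \<Lambda>" and cont: "\<And>l. continuous_on UNIV (form l)"
    and hol: "\<And>p. (\<forall>l\<in>\<Lambda>. 0 < form l p) \<Longrightarrow> complex_differentiable_at \<Phi>0 p"
    and rec: "\<And>l. l \<in> \<Lambda> \<Longrightarrow> \<exists>J c v. finite (J :: 'j set) \<and>
       (\<forall>j\<in>J. (\<forall>p. complex_differentiable_at (c j) p) \<and> (\<forall>p. \<forall>k\<in>\<Lambda>. form k p \<le> form k (p + v j)) \<and>
          (\<forall>p. form l p + 1 \<le> form l (p + v j))) \<and>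
       (\<forall>p. (\<forall>k\<in>\<Lambda>. 0 < form k p) \<longrightarrow> \<Phi>0 p = (\<Sum>j\<in>J. c j p * \<Phi>0 (p + v j)))"
  shows "\<exists>\<Phi>. (\<forall>p. complex_differentiable_at \<Phi> p) \<and> (\<forall>p. (\<forall>l\<in>\<Lambda>. 0 < form l p) \<longrightarrow> \<Phi> p = \<Phi>0 p)"
proof -
  define region where "region r = {p. \<forall>l\<in>\<Lambda>. - r l < form l p}" for r :: "'i \<Rightarrow> real"
  define raise where "raise S r = (\<lambda>l. if l \<in> S then r l + 1 else r l)" for S :: "'i set" and r :: "'i \<Rightarrow> real"
  define extends where "extends S T \<longleftrightarrow>
      (\<forall>r g. (\<forall>p\<in>region r. complex_differentiable_at g p) \<longrightarrow>
          (\<forall>p\<in>region (raise S r). complex_differentiable_at (T g) p)) \<and>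
      (\<forall>r g h. (\<forall>p\<in>region r. g p = h p) \<longrightarrow> (\<forall>p\<in>region (raise S r). T g p = T h p)) \<and>
      (\<forall>p\<in>region (\<lambda>_. 0). T \<Phi>0 p = \<Phi>0 p)" for S T
  have "\<exists>T. extends S T"
    if "finite S" "S \<subseteq> \<Lambda>" for S
    using that
  proof (induction S)
    case empty
    then show ?case by (intro exI[of _ "\<lambda>g. g"]) (simp add: extends_def raise_def)
  next
    case (insert l S)
    have "S \<subseteq> \<Lambda>" using insert.prems by simp
    from insert.IH[OF this] obtain T where T: "extends S T" by blast
    have T1: "complex_differentiable_at (T g) p"
      if "\<forall>p\<in>region r. complex_differentiable_at g p" "p \<in> region (raise S r)" for r g p
      using T that unfolding extends_def by blast
    have T2: "T g p = T h p" if "\<forall>p\<in>region r. g p = h p" "p \<in> region (raise S r)" for r g h p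
      using T that unfolding extends_def by blast
    have T3: "T \<Phi>0 p = \<Phi>0 p" if "p \<in> region (\<lambda>_. 0)" for p
      using T that unfolding extends_def by blast
    have "l \<in> \<Lambda>" using insert.prems by simp
    from rec[OF this] obtain J c v where J: "finite (J :: 'j set)"
      and shift: "\<forall>j\<in>J. (\<forall>p. complex_differentiable_at (c j) p) \<and>
          (\<forall>p. \<forall>k\<in>\<Lambda>. form k p \<le> form k (p + v j)) \<and> (\<forall>p. form l p + 1 \<le> form l (p + v j))"
      and rec_l: "\<forall>p. (\<forall>k\<in>\<Lambda>. 0 < form k p) \<longrightarrow> \<Phi>0 p = (\<Sum>j\<in>J. c j p * \<Phi>0 (p + v j))"
      by (elim exE conjE) (rule that)
    have c: "complex_differentiable_at (c j) p" and vl: "form l p + 1 \<le> form l (p + v j)" if "j \<in> J" for j p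
      using shift that by blast+
    have v: "form k p \<le> form k (p + v j)" if "j \<in> J" "k \<in> \<Lambda>" for j p k
      using shift that by blast
    define R where "R g p = (\<Sum>j\<in>J. c j p * g (p + v j))" for g p
    have into: "p + v j \<in> region (raise S r)" if "p \<in> region (raise (insert l S) r)" "j \<in> J" for p j r
      unfolding region_def
    proof (intro CollectI ballI)
      fix k assume "k \<in> \<Lambda>"
      then have "- raise (insert l S) r k < form k p" using that(1) by (simp add: region_def)
      moreover have "form k p \<le> form k (p + v j)" using v that \<open>k \<in> \<Lambda>\<close> by blast
      ultimately show "- raise S r k < form k (p + v j)"
        using vl[OF that(2), of p] insert.hyps by (cases "k = l") (auto simp: raise_def)
    qed
    have "extends (insert l S) (\<lambda>g. R (T g))"
      unfolding extends_def
    proof (intro conjI allI impI ballI)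
      fix r g p assume "\<forall>p\<in>region r. complex_differentiable_at g p" "p \<in> region (raise (insert l S) r)"
      then show "complex_differentiable_at (R (T g)) p"
        unfolding R_def using into T1 c
        by (intro complex_differentiable_sum complex_differentiable_mult complex_differentiable_shift) blast+
    next
      fix r p and g h :: "(complex ^ 'n) \<times> (complex ^ 'm) \<Rightarrow> complex"
      assume "\<forall>p\<in>region r. g p = h p" "p \<in> region (raise (insert l S) r)"
      then show "R (T g) p = R (T h) p"
        unfolding R_def using into T2 by (intro sum.cong refl) (metis)
    next
      fix p assume p: "p \<in> region (\<lambda>_. 0)"
      have "p + v j \<in> region (\<lambda>_. 0)" if "j \<in> J" for j
        using p v[OF that, of _ p] by (force simp: region_def)
      then have "R (T \<Phi>0) p = (\<Sum>j\<in>J. c j p * \<Phi>0 (p + v j))"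
        unfolding R_def using T3 by (intro sum.cong refl) simp
      also have "\<dots> = \<Phi>0 p" using p by (intro rec_l[rule_format, symmetric]) (simp add: region_def)
      finally show "R (T \<Phi>0) p = \<Phi>0 p" .
    qed
    then show ?case by blast
  qed
  from this[OF fin order.refl] obtain T where T: "extends \<Lambda> T" by blast
  define level where "level k = region (\<lambda>_. real k)" for k
  have level_Suc: "region (raise \<Lambda> (\<lambda>_. real k)) = level (Suc k)" for k
    by (auto simp: region_def raise_def level_def)
  have T1: "\<forall>p\<in>level (Suc k). complex_differentiable_at (T g) p"
    if "\<forall>p\<in>level k. complex_differentiable_at g p" for k g
  proof -
    have "\<forall>p\<in>region (raise \<Lambda> (\<lambda>_. real k)). complex_differentiable_at (T g) p"
      using T that unfolding extends_def level_def by blast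
    then show ?thesis unfolding level_Suc .
  qed
  have T2: "\<forall>p\<in>level (Suc k). T g p = T h p" if "\<forall>p\<in>level k. g p = h p" for k g h
  proof -
    have "\<forall>p\<in>region (raise \<Lambda> (\<lambda>_. real k)). T g p = T h p"
      using T that unfolding extends_def level_def by blast
    then show ?thesis unfolding level_Suc .
  qed
  have T3: "T \<Phi>0 p = \<Phi>0 p" if "p \<in> region (\<lambda>_. 0)" for p
    using T that unfolding extends_def by blast
  define \<Psi> where "\<Psi> k = (T ^^ k) \<Phi>0" for k
  have \<Psi>_Suc: "\<Psi> (Suc k) = T (\<Psi> k)" for k by (simp add: \<Psi>_def)
  have level_mono: "level j \<subseteq> level k" if "j \<le> k" for j k
    using that by (fastforce simp: level_def region_def)
  have hol_level: "\<forall>p\<in>level k. complex_differentiable_at (\<Psi> k) p" for k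
  proof (induction k)
    case 0
    then show ?case using hol by (simp add: level_def region_def \<Psi>_def)
  next
    case (Suc k)
    then show ?case using T1 unfolding \<Psi>_Suc by blast
  qed
  have stable: "\<forall>p\<in>level k. \<Psi> (Suc k) p = \<Psi> k p" for k
  proof (induction k)
    case 0
    then show ?case using T3 by (simp add: level_def \<Psi>_def)
  next
    case (Suc k)
    then show ?case using T2[of k "\<Psi> (Suc k)" "\<Psi> k"] unfolding \<Psi>_Suc by blast
  qed
  have consistent: "\<Psi> j p = \<Psi> k p" if "p \<in> level k" "k \<le> j" for j k p
    using that(2)
  proof (induction j rule: dec_induct)
    case (step n)
    then show ?case using stable[of n] that(1) level_mono[OF step(1)] by auto
  qed simp
  have consistent': "\<Psi> j p = \<Psi> k p" if "p \<in> level j" "p \<in> level k" for j k p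
    using consistent[OF that(1), of k] consistent[OF that(2), of j] by (cases "j \<le> k") auto
  \<comment> \<open>Any level that contains \<open>p\<close> will do.\<close>
  define N where "N p = nat \<lceil>\<Sum>l\<in>\<Lambda>. \<bar>form l p\<bar>\<rceil> + 1" for p
  have N: "p \<in> level (N p)" for p
    unfolding level_def region_def
  proof (intro CollectI ballI)
    fix l assume "l \<in> \<Lambda>"
    then have "\<bar>form l p\<bar> \<le> (\<Sum>l\<in>\<Lambda>. \<bar>form l p\<bar>)" using fin by (intro member_le_sum) auto
    also have "\<dots> < real (N p)" unfolding N_def by linarith
    finally show "- real (N p) < form l p" by linarith
  qed
  have open_level: "open (level k)" for k
  proof -
    have "level k = (\<Inter>l\<in>\<Lambda>. {p. - real k < form l p})" by (auto simp: level_def region_def)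
    moreover have "open (\<Inter>l\<in>\<Lambda>. {p. - real k < form l p})"
      using fin by (intro open_INT ballI open_Collect_less cont continuous_on_const)
    ultimately show ?thesis by metis
  qed
  show ?thesis
  proof (intro exI[of _ "\<lambda>p. \<Psi> (N p) p"] conjI allI impI)
    fix p
    show "complex_differentiable_at (\<lambda>p. \<Psi> (N p) p) p"
    proof (rule complex_differentiable_cong)
      show "complex_differentiable_at (\<Psi> (N p)) p" using hol_level N by blast
      show "open (level (N p))" by (rule open_level)
      show "p \<in> level (N p)" by (rule N)
      show "\<Psi> (N q) q = \<Psi> (N p) q" if "q \<in> level (N p)" for q
        using consistent' N that by blast
    qed
  next
    fix p assume "\<forall>l\<in>\<Lambda>. 0 < form l p"
    then have "p \<in> level 0" by (simp add: level_def region_def)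
    then show "\<Psi> (N p) p = \<Phi>0 p" using consistent'[OF N, of p 0] by (simp add: \<Psi>_def)
  qed
qed

section \<open>Logarithms of completely nonvanishing polynomials\<close>

lemma exponent_vec_inj: "exponent_vec \<alpha> = exponent_vec \<beta> \<longleftrightarrow> \<alpha> = \<beta>"
  by (auto simp: exponent_vec_def vec_eq_iff intro: poly_mapping_eqI)

lemma lookup_truncated_poly:
  "Poly_Mapping.lookup (truncated_poly F g) \<alpha> =
     (if exponent_vec \<alpha> \<in> F then Poly_Mapping.lookup g \<alpha> else 0)"
proof -
  have "finite {\<alpha> \<in> Poly_Mapping.keys g. exponent_vec \<alpha> \<in> F}" by simp
  then show ?thesis
    by (simp add: truncated_poly_def lookup_sum lookup_single when_def in_keys_iff)
qed

lemma eval_truncated_poly: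
  "eval_poly (truncated_poly F g) z = (\<Sum>\<alpha>\<in>{\<alpha> \<in> Poly_Mapping.keys g. exponent_vec \<alpha> \<in> F}.
     Poly_Mapping.lookup g \<alpha> * (\<Prod>i\<in>UNIV. (z $ i) ^ Poly_Mapping.lookup \<alpha> i))"
proof -
  have "Poly_Mapping.keys (truncated_poly F g) = {\<alpha> \<in> Poly_Mapping.keys g. exponent_vec \<alpha> \<in> F}"
    by (auto simp: in_keys_iff lookup_truncated_poly split: if_splits)
  then show ?thesis
    unfolding eval_poly_def by (simp add: lookup_truncated_poly)
qed

lemma exp_vec_in_orthant: "exp_vec y \<in> orthant"
  by (simp add: exp_vec_def orthant_def)

lemma exp_vec_ln_vec: "x \<in> orthant \<Longrightarrow> exp_vec (ln_vec x) = x"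
  by (simp add: exp_vec_def ln_vec_def orthant_def vec_eq_iff)

lemma monomial_exp_vec:
  "(\<Prod>i\<in>UNIV. (complex_vec (exp_vec y) $ i) ^ Poly_Mapping.lookup \<alpha> i) = of_real (exp (exponent_vec \<alpha> \<bullet> y))"
proof -
  have "(\<Prod>i\<in>UNIV. (complex_vec (exp_vec y) $ i) ^ Poly_Mapping.lookup \<alpha> i)
      = (\<Prod>i\<in>UNIV. of_real (exp (real (Poly_Mapping.lookup \<alpha> i) * y $ i)))"
    by (simp add: complex_vec_def exp_vec_def exp_of_nat_mult)
  also have "\<dots> = of_real (exp (\<Sum>i\<in>UNIV. real (Poly_Mapping.lookup \<alpha> i) * y $ i))"
    by (simp add: exp_sum)
  finally show ?thesis by (simp add: exponent_vec_def inner_vec_def)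
qed

lemma eval_poly_exp_vec:
  "eval_poly g (complex_vec (exp_vec y)) =
     (\<Sum>\<alpha>\<in>Poly_Mapping.keys g. Poly_Mapping.lookup g \<alpha> * of_real (exp (exponent_vec \<alpha> \<bullet> y)))"
  by (simp add: eval_poly_def monomial_exp_vec)

lemma completely_nonvanishing_imp_nonzero:
  assumes "completely_nonvanishing_on g (complex_vec ` orthant)"
  shows "g \<noteq> 0"
proof
  assume "g = 0"
  have "newton_polytope g face_of newton_polytope g"
    unfolding newton_polytope_def by (rule face_of_refl) simp
  moreover have "complex_vec (exp_vec 0) \<in> complex_vec ` orthant" using exp_vec_in_orthant by blast
  ultimately have "eval_poly (truncated_poly (newton_polytope g) g) (complex_vec (exp_vec 0)) \<noteq> 0"
    using assms unfolding completely_nonvanishing_on_def by blast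
  then show False using \<open>g = 0\<close> by (simp add: eval_truncated_poly)
qed

text \<open>In logarithmic coordinates the truncations of \<open>g\<close> to faces are partial exponential sums, so that complete
  nonvanishing supplies the hypothesis of \<open>exp_sum_lower_bound\<close>.\<close>

lemma completely_nonvanishing_lower_bound:
  assumes cnv: "completely_nonvanishing_on g (complex_vec ` orthant)"
  shows "\<exists>C>0. \<forall>y. \<forall>\<alpha>\<in>Poly_Mapping.keys g.
    C * exp (exponent_vec \<alpha> \<bullet> y) \<le> norm (eval_poly g (complex_vec (exp_vec y)))"
proof -
  let ?E = "exponent_vec ` Poly_Mapping.keys g"
  define c where "c v = Poly_Mapping.lookup g (inv exponent_vec v)" for v
  have inj: "inj exponent_vec" by (simp add: inj_def exponent_vec_inj)
  have c: "c (exponent_vec \<alpha>) = Poly_Mapping.lookup g \<alpha>" for \<alpha> by (simp add: c_def inv_f_f[OF inj])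
  have sum_eq: "(\<Sum>v\<in>exponent_vec ` A. c v * of_real (exp (v \<bullet> y))) =
     (\<Sum>\<alpha>\<in>A. Poly_Mapping.lookup g \<alpha> * of_real (exp (exponent_vec \<alpha> \<bullet> y)))" for A y
    using inj by (subst sum.reindex) (auto simp: c inj_on_def)
  have "\<exists>C>0. \<forall>y. \<forall>v\<in>?E. C * exp (v \<bullet> y) \<le> norm (\<Sum>v\<in>?E. c v * of_real (exp (v \<bullet> y)))"
  proof (rule exp_sum_lower_bound)
    show "finite ?E" by simp
    show "?E \<noteq> {}" using completely_nonvanishing_imp_nonzero[OF cnv] by simp
    fix S y assume S: "S \<subseteq> ?E" "S \<noteq> {}" "(convex hull S) face_of (convex hull ?E)" "?E \<inter> convex hull S = S"
    let ?A = "{\<alpha> \<in> Poly_Mapping.keys g. exponent_vec \<alpha> \<in> convex hull S}"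
    have "S = exponent_vec ` ?A" using S(4) by auto
    then have "(\<Sum>v\<in>S. c v * of_real (exp (v \<bullet> y))) =
      (\<Sum>\<alpha>\<in>?A. Poly_Mapping.lookup g \<alpha> * of_real (exp (exponent_vec \<alpha> \<bullet> y)))"
      using sum_eq[of y ?A] by simp
    also have "\<dots> = eval_poly (truncated_poly (convex hull S) g) (complex_vec (exp_vec y))"
      by (simp add: eval_truncated_poly monomial_exp_vec)
    also have "\<dots> \<noteq> 0"
    proof -
      have "convex hull S \<noteq> {}" using S(2) by simp
      moreover have "complex_vec (exp_vec y) \<in> complex_vec ` orthant" using exp_vec_in_orthant by blast
      ultimately show ?thesis
        using cnv S(3) unfolding completely_nonvanishing_on_def newton_polytope_def by blast
    qed
    finally show "(\<Sum>v\<in>S. c v * of_real (exp (v \<bullet> y))) \<noteq> 0" .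
  qed
  then show ?thesis unfolding sum_eq eval_poly_exp_vec by simp
qed

text \<open>Near \<open>a\<close>, a continuous logarithm differs from the principal logarithm of \<open>F t / F a\<close> by a constant.\<close>

lemma logarithm_has_vector_derivative:
  fixes l :: "real \<Rightarrow> complex"
  assumes cont: "continuous_on UNIV l" and log: "\<And>t. exp (l t) = F t"
    and deriv: "(F has_vector_derivative F') (at a)"
  shows "(l has_vector_derivative F' / F a) (at a)"
proof -
  have Fa: "F a \<noteq> 0" using log[of a] exp_not_eq_zero by metis
  let ?k = "\<lambda>t. l a + ln (F t * inverse (F a))"
  have "((\<lambda>t. F t * inverse (F a)) has_vector_derivative F' * inverse (F a)) (at a)"
    using deriv by (rule has_vector_derivative_mult_left)
  moreover have "(Ln has_field_derivative inverse 1) (at (F a * inverse (F a)))"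
    using has_field_derivative_Ln[of 1] Fa by simp
  ultimately have "((Ln \<circ> (\<lambda>t. F t * inverse (F a))) has_vector_derivative F' * inverse (F a) * inverse 1) (at a)"
    by (rule field_vector_diff_chain_at)
  then have d: "(?k has_vector_derivative F' / F a) (at a)"
    by (auto intro!: derivative_eq_intros simp: o_def divide_inverse)
  have "l \<midarrow>a\<rightarrow> l a"
    using cont by (simp add: continuous_on_eq_continuous_at isCont_def)
  then have "(\<lambda>t. Im (l t)) \<midarrow>a\<rightarrow> Im (l a)" by (rule tendsto_Im)
  then have "eventually (\<lambda>t. \<bar>Im (l t) - Im (l a)\<bar> < pi) (at a)"
    using pi_gt_zero unfolding tendsto_iff dist_real_def by blast
  then have ev: "eventually (\<lambda>t. l t = ?k t) (at a)"
  proof eventually_elim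
    case (elim t)
    have "F t * inverse (F a) = exp (l t - l a)" by (simp add: exp_diff log divide_inverse)
    then have "ln (F t * inverse (F a)) = l t - l a" using elim by (simp only:) (rule Ln_exp, auto)
    then show ?case by simp
  qed
  have ev': "eventually (\<lambda>t. ?k t = l t) (at a)" using ev by (rule eventually_mono) (rule sym)
  have "F a * inverse (F a) = 1" using Fa by simp
  then have "l a = ?k a" by simp
  then show ?thesis
    using has_derivative_transform_eventually[OF d[unfolded has_vector_derivative_def], of l] ev'
    unfolding has_vector_derivative_def by simp
qed

locale log_branch_setting =
  fixes f :: "'m::finite \<Rightarrow> 'n::finite cpoly"
    and L :: "'m \<Rightarrow> real ^ 'n \<Rightarrow> complex"
  assumes nonvanishing: "\<And>i. completely_nonvanishing_on (f i) (complex_vec ` orthant)"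
    and branches: "log_branches f L"
begin

definition logf :: "'m \<Rightarrow> real ^ 'n \<Rightarrow> complex" where "logf i y = L i (exp_vec y)"

lemma f_nonzero: "f i \<noteq> 0"
  using nonvanishing by (rule completely_nonvanishing_imp_nonzero)

lemma exp_logf: "exp (logf i y) =
    (\<Sum>\<alpha>\<in>Poly_Mapping.keys (f i). Poly_Mapping.lookup (f i) \<alpha> * of_real (exp (exponent_vec \<alpha> \<bullet> y)))"
  using branches exp_vec_in_orthant[of y] unfolding log_branches_def logf_def eval_poly_exp_vec[symmetric] by blast

lemma continuous_logf: "continuous_on UNIV (logf i)"
proof -
  have "continuous_on UNIV (exp_vec :: real ^ 'n \<Rightarrow> _)"
    unfolding exp_vec_def[abs_def] by (intro continuous_intros)
  then show ?thesis
    unfolding logf_def[abs_def]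
  proof (rule continuous_on_compose2[rotated])
    show "continuous_on orthant (L i)" using branches by (simp add: log_branches_def)
    show "range exp_vec \<subseteq> (orthant :: (real ^ 'n) set)" using exp_vec_in_orthant by blast
  qed
qed

text \<open>For fixed \<open>y\<close>, the exponents satisfying the bound form a halfspace, so that it passes from the support to
  its convex hull.\<close>

lemma Re_logf_ge: "\<exists>C. \<forall>y. \<forall>\<sigma>\<in>newton_polytope (f i). \<sigma> \<bullet> y - C \<le> Re (logf i y)"
proof -
  obtain C where C: "C > 0" "\<And>y \<alpha>. \<alpha> \<in> Poly_Mapping.keys (f i) \<Longrightarrow>
    C * exp (exponent_vec \<alpha> \<bullet> y) \<le> norm (eval_poly (f i) (complex_vec (exp_vec y)))"
    using completely_nonvanishing_lower_bound[OF nonvanishing[of i]] by blast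
  have "\<sigma> \<bullet> y - (- ln C) \<le> Re (logf i y)" if "\<sigma> \<in> newton_polytope (f i)" for \<sigma> y
  proof -
    have "exponent_vec \<alpha> \<bullet> y + ln C \<le> Re (logf i y)" if "\<alpha> \<in> Poly_Mapping.keys (f i)" for \<alpha>
    proof -
      have "exp (exponent_vec \<alpha> \<bullet> y + ln C) \<le> norm (exp (logf i y))"
        using C(2)[OF that, of y] C(1) by (simp add: exp_add exp_logf eval_poly_exp_vec mult.commute)
      then show ?thesis by (simp add: norm_exp_eq_Re)
    qed
    then have "ln C - Re (logf i y) \<le> (- y) \<bullet> exponent_vec \<beta>" if "\<beta> \<in> Poly_Mapping.keys (f i)" for \<beta>
      using that by (simp add: inner_commute[of y] algebra_simps)
    then have "ln C - Re (logf i y) \<le> (- y) \<bullet> \<sigma>"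
      by (rule newton_polytope_ge[OF that])
    then show ?thesis by (simp add: inner_commute[of \<sigma> y])
  qed
  then show ?thesis by blast
qed

text \<open>Every point lies on a line through the origin, and the bound for the oscillation along a line depends only on
  the number of terms.\<close>

lemma Im_logf_bounded: "\<exists>C. \<forall>y. \<bar>Im (logf i y)\<bar> \<le> C"
proof -
  let ?K = "pi * (real (card (Poly_Mapping.keys (f i))) + 2)"
  have "\<bar>Im (logf i y)\<bar> \<le> \<bar>Im (logf i 0)\<bar> + ?K" for y
  proof -
    define l where "l t = logf i (t *\<^sub>R y)" for t :: real
    have cont: "continuous_on UNIV l"
      unfolding l_def by (intro continuous_on_compose2[OF continuous_logf] continuous_intros) auto
    have "exp (l t) = (\<Sum>\<alpha>\<in>Poly_Mapping.keys (f i). Poly_Mapping.lookup (f i) \<alpha> *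
        of_real (exp ((exponent_vec \<alpha> \<bullet> y) * t)))" for t
      by (simp add: l_def exp_logf mult.commute)
    note osc = Im_log_exp_sum_oscillation[OF finite_keys cont this]
    show ?thesis using osc[of 1 0] osc[of 0 1] by (simp add: l_def) 
  qed
  then show ?thesis by blast
qed

lemma norm_logf_linear_growth: "\<exists>A B. 0 \<le> B \<and> (\<forall>y. norm (logf i y) \<le> A + B * norm y)"
proof -
  obtain C where C: "\<And>y \<sigma>. \<sigma> \<in> newton_polytope (f i) \<Longrightarrow> \<sigma> \<bullet> y - C \<le> Re (logf i y)"
    using Re_logf_ge[of i] by blast
  obtain K where K: "\<And>y. \<bar>Im (logf i y)\<bar> \<le> K" using Im_logf_bounded[of i] by blast
  obtain \<alpha>0 where \<alpha>0: "\<alpha>0 \<in> Poly_Mapping.keys (f i)" using f_nonzero[of i] keys_eq_empty by blast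
  define S where "S = 1 + (\<Sum>\<alpha>\<in>Poly_Mapping.keys (f i). norm (Poly_Mapping.lookup (f i) \<alpha>))"
  define b where "b = (\<Sum>\<alpha>\<in>Poly_Mapping.keys (f i). norm (exponent_vec \<alpha>))"
  have S: "1 \<le> S" unfolding S_def by (simp add: sum_nonneg)
  have b: "norm (exponent_vec \<alpha>) \<le> b" if "\<alpha> \<in> Poly_Mapping.keys (f i)" for \<alpha>
    unfolding b_def using that by (intro member_le_sum) auto
  have up: "Re (logf i y) \<le> ln S + b * norm y" for y
  proof -
    have "exp (Re (logf i y)) = norm (exp (logf i y))" by (simp add: norm_exp_eq_Re)
    also have "\<dots> \<le> (\<Sum>\<alpha>\<in>Poly_Mapping.keys (f i). norm (Poly_Mapping.lookup (f i) \<alpha>) * exp (b * norm y))"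
      unfolding exp_logf
    proof (rule sum_norm_le)
      fix \<alpha> assume "\<alpha> \<in> Poly_Mapping.keys (f i)"
      have "exponent_vec \<alpha> \<bullet> y \<le> norm (exponent_vec \<alpha>) * norm y" by (rule norm_cauchy_schwarz)
      also have "\<dots> \<le> b * norm y" by (intro mult_right_mono b \<open>\<alpha> \<in> _\<close> norm_ge_zero)
      finally show "norm (Poly_Mapping.lookup (f i) \<alpha> * of_real (exp (exponent_vec \<alpha> \<bullet> y)))
         \<le> norm (Poly_Mapping.lookup (f i) \<alpha>) * exp (b * norm y)"
        by (simp add: norm_mult mult_left_mono)
    qed
    also have "\<dots> \<le> S * exp (b * norm y)"
      unfolding S_def sum_distrib_right[symmetric] by (intro mult_right_mono) auto
    also have "\<dots> = exp (ln S + b * norm y)" using S by (simp add: exp_add)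
    finally show ?thesis by simp
  qed
  have low: "- C - b * norm y \<le> Re (logf i y)" for y
  proof -
    have "- (exponent_vec \<alpha>0 \<bullet> y) \<le> norm (exponent_vec \<alpha>0) * norm y"
      using norm_cauchy_schwarz[of "- exponent_vec \<alpha>0" y] by simp
    also have "\<dots> \<le> b * norm y" using b[OF \<alpha>0] by (simp add: mult_right_mono)
    finally show ?thesis using C[OF exponent_vec_in_newton_polytope[OF \<alpha>0], of y] by linarith
  qed
  have b0: "0 \<le> b" unfolding b_def by (simp add: sum_nonneg)
  have "norm (logf i y) \<le> (\<bar>C\<bar> + \<bar>ln S\<bar> + K) + b * norm y" for y
    using cmod_le[of "logf i y"] up[of y] low[of y] K[of y] mult_nonneg_nonneg[OF b0 norm_ge_zero[of y]]
    by linarith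
  then show ?thesis using b0 by blast
qed

lemma logf_directional_derivative:
  "((\<lambda>a. logf i (y + a *\<^sub>R v)) has_vector_derivative
     (\<Sum>\<alpha>\<in>Poly_Mapping.keys (f i). Poly_Mapping.lookup (f i) \<alpha> * of_real (exponent_vec \<alpha> \<bullet> v) *
        exp (of_real (exponent_vec \<alpha> \<bullet> (y + a *\<^sub>R v)) - logf i (y + a *\<^sub>R v)))) (at a)"
proof -
  let ?F = "\<lambda>a. \<Sum>\<alpha>\<in>Poly_Mapping.keys (f i). Poly_Mapping.lookup (f i) \<alpha> * of_real (exp (exponent_vec \<alpha> \<bullet> (y + a *\<^sub>R v)))"
  let ?F' = "\<Sum>\<alpha>\<in>Poly_Mapping.keys (f i). Poly_Mapping.lookup (f i) \<alpha> *
     of_real (exp (exponent_vec \<alpha> \<bullet> (y + a *\<^sub>R v)) * (exponent_vec \<alpha> \<bullet> v))"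
  have "((\<lambda>a. logf i (y + a *\<^sub>R v)) has_vector_derivative ?F' / ?F a) (at a)"
  proof (rule logarithm_has_vector_derivative)
    show "continuous_on UNIV (\<lambda>a. logf i (y + a *\<^sub>R v))"
      by (intro continuous_on_compose2[OF continuous_logf] continuous_intros) auto
    show "exp (logf i (y + t *\<^sub>R v)) = ?F t" for t by (rule exp_logf)
    show "(?F has_vector_derivative ?F') (at a)"
    proof (rule has_vector_derivative_sum)
      fix \<alpha>
      have "((\<lambda>a. exp (exponent_vec \<alpha> \<bullet> (y + a *\<^sub>R v))) has_real_derivative
          exp (exponent_vec \<alpha> \<bullet> (y + a *\<^sub>R v)) * (exponent_vec \<alpha> \<bullet> v)) (at a)"
        by (auto intro!: derivative_eq_intros simp: inner_add_right)
      note has_vector_derivative_of_real[OF this]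
      from has_vector_derivative_mult_right[OF this]
      show "((\<lambda>a. Poly_Mapping.lookup (f i) \<alpha> * of_real (exp (exponent_vec \<alpha> \<bullet> (y + a *\<^sub>R v)))) has_vector_derivative
         Poly_Mapping.lookup (f i) \<alpha> * of_real (exp (exponent_vec \<alpha> \<bullet> (y + a *\<^sub>R v)) * (exponent_vec \<alpha> \<bullet> v))) (at a)"
        .
    qed
  qed
  also have "?F' / ?F a = (\<Sum>\<alpha>\<in>Poly_Mapping.keys (f i). Poly_Mapping.lookup (f i) \<alpha> * of_real (exponent_vec \<alpha> \<bullet> v) *
        exp (of_real (exponent_vec \<alpha> \<bullet> (y + a *\<^sub>R v)) - logf i (y + a *\<^sub>R v)))"
    unfolding exp_logf[symmetric] sum_divide_distrib
    by (intro sum.cong refl) (simp add: exp_diff exp_of_real mult_ac)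
  finally show ?thesis .
qed

section \<open>The Euler--Mellin integral and its recurrences\<close>

text \<open>The exponent of the integrand in logarithmic coordinates; it is complex linear in the parameters.\<close>

definition phase :: "(complex ^ 'n) \<times> (complex ^ 'm) \<Rightarrow> real ^ 'n \<Rightarrow> complex" where
  "phase p y = (\<Sum>j\<in>UNIV. fst p $ j * of_real (y $ j)) - (\<Sum>i\<in>UNIV. snd p $ i * logf i y)"

definition mellin :: "(complex ^ 'n) \<times> (complex ^ 'm) \<Rightarrow> complex" where
  "mellin p = (\<integral>y. exp (phase p y) \<partial>lborel)"

text \<open>Controls all the linear forms \<open>p \<mapsto> phase p y\<close> at once, see \<open>norm_phase_le\<close>.\<close>

definition growth :: "real ^ 'n \<Rightarrow> real" where
  "growth y = (\<Sum>j\<in>UNIV. \<bar>y $ j\<bar>) + (\<Sum>i\<in>UNIV. norm (logf i y))"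

text \<open>Adding \<open>shift i \<alpha>\<close> to the parameters multiplies the integrand by \<open>z\<^sup>\<alpha> / f\<^sub>i(z)\<close>.\<close>

definition shift :: "'m \<Rightarrow> ('n \<Rightarrow>\<^sub>0 nat) \<Rightarrow> (complex ^ 'n) \<times> (complex ^ 'm)" where
  "shift i \<alpha> = (complex_vec (exponent_vec \<alpha>), axis i 1)"

lemma phase_add: "phase (p + q) y = phase p y + phase q y"
  by (simp add: phase_def algebra_simps sum.distrib)

lemma phase_scaleR: "phase (c *\<^sub>R p) y = of_real c * phase p y"
  by (simp add: phase_def scaleR_right_diff_distrib scaleR_sum_right flip: scaleR_conv_of_real)

lemma phase_complex_scale: "phase (c *s v, c *s w) y = c * phase (v, w) y"
  by (simp add: phase_def right_diff_distrib sum_distrib_left mult.assoc)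

lemma phase_shift: "phase (shift i \<alpha>) y = of_real (exponent_vec \<alpha> \<bullet> y) - logf i y"
  by (simp add: phase_def shift_def complex_vec_def inner_vec_def axis_def if_distrib[of "\<lambda>c. c * _"] cong: if_cong)

lemma continuous_phase: "continuous_on UNIV (phase p)"
  unfolding phase_def[abs_def] by (intro continuous_intros continuous_logf)

lemma measurable_phase[measurable]: "phase p \<in> borel_measurable borel"
  using continuous_phase by (rule borel_measurable_continuous_onI)

lemma growth_nonneg: "0 \<le> growth y"
  unfolding growth_def by (intro add_nonneg_nonneg sum_nonneg) auto

lemma norm_phase_le: "norm (phase p y) \<le> norm p * growth y"
proof -
  have fst: "norm (fst p $ j) \<le> norm p" for j
    using order.trans[OF Finite_Cartesian_Product.norm_nth_le[of "fst p" j] norm_fst_le[of "fst p" "snd p"]] by simp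
  have snd: "norm (snd p $ i) \<le> norm p" for i
    using order.trans[OF Finite_Cartesian_Product.norm_nth_le[of "snd p" i] norm_snd_le[of "snd p" "fst p"]] by simp
  have "norm (phase p y) \<le> (\<Sum>j\<in>UNIV. norm (fst p $ j * of_real (y $ j))) + (\<Sum>i\<in>UNIV. norm (snd p $ i * logf i y))"
    unfolding phase_def by (intro order.trans[OF norm_triangle_ineq4] add_mono norm_sum)
  also have "\<dots> \<le> (\<Sum>j\<in>UNIV. norm p * \<bar>y $ j\<bar>) + (\<Sum>i\<in>UNIV. norm p * norm (logf i y))"
    using fst snd by (intro add_mono sum_mono) (auto simp: norm_mult intro!: mult_right_mono)
  also have "\<dots> = norm p * growth y" by (simp add: growth_def distrib_left sum_distrib_left)
  finally show ?thesis .
qed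

lemma growth_linear: "\<exists>A B. 0 < B \<and> (\<forall>y. growth y \<le> A + B * norm y)"
proof -
  have "\<forall>i. \<exists>A B. 0 \<le> B \<and> (\<forall>y. norm (logf i y) \<le> A + B * norm y)" using norm_logf_linear_growth by blast
  then obtain A B where AB: "\<And>i. 0 \<le> B i" "\<And>i y. norm (logf i y) \<le> A i + B i * norm y" by metis
  have "growth y \<le> (\<Sum>i\<in>UNIV. A i) + (1 + real CARD('n) + (\<Sum>i\<in>UNIV. B i)) * norm y" for y
  proof -
    have "(\<Sum>j\<in>UNIV. \<bar>y $ j\<bar>) \<le> real CARD('n) * norm y"
      by (rule sum_bounded_above) (rule component_le_norm_cart)
    moreover have "(\<Sum>i\<in>UNIV. norm (logf i y)) \<le> (\<Sum>i\<in>UNIV. A i + B i * norm y)"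
      using AB by (intro sum_mono) auto
    ultimately show ?thesis
      by (simp add: growth_def sum.distrib algebra_simps sum_distrib_left add_increasing)
  qed
  moreover have "0 < 1 + real CARD('n) + (\<Sum>i\<in>UNIV. B i)"
    using AB(1) by (simp add: add_pos_nonneg sum_nonneg)
  ultimately show ?thesis by blast
qed

text \<open>As \<open>Re s\<close> is interior, the point \<open>Re s + e y / |y|\<close> still lies in the weighted Minkowski sum, hence is a
  weighted sum of points of the Newton polytopes. Pairing it with \<open>y\<close> and applying the lower bound for each
  \<open>log |f\<^sub>i|\<close> gains the term \<open>e |y|\<close>; the imaginary parts of \<open>t\<close> only contribute a constant because the
  arguments of the \<open>f\<^sub>i\<close> are bounded.\<close>

lemma Re_phase_le:
  assumes "p \<in> convergence_domain f"
  shows "\<exists>C \<epsilon>. 0 < \<epsilon> \<and> (\<forall>y. Re (phase p y) \<le> C - \<epsilon> * norm y)"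
proof -
  obtain s t where p: "p = (s, t)" by (cases p)
  have \<tau>: "0 < Re (t $ i)" for i
    using assms by (simp add: p convergence_domain_def orthant_def Re_vec_def)
  have "Re_vec s \<in> interior (weighted_minkowski_sum (Re_vec t) f)"
    using assms by (simp add: p convergence_domain_def)
  then obtain e where e: "0 < e" "cball (Re_vec s) e \<subseteq> weighted_minkowski_sum (Re_vec t) f"
    by (meson mem_interior_cball)
  obtain C where C: "\<And>i y \<sigma>. \<sigma> \<in> newton_polytope (f i) \<Longrightarrow> \<sigma> \<bullet> y - C i \<le> Re (logf i y)"
    using Re_logf_ge by metis
  obtain K where K: "\<And>i y. \<bar>Im (logf i y)\<bar> \<le> K i" using Im_logf_bounded by metis
  have "Re (phase p y) \<le> (\<Sum>i\<in>UNIV. Re (t $ i) * C i + \<bar>Im (t $ i)\<bar> * K i) - e * norm y" for y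
  proof -
    define u where "u = Re_vec s + e *\<^sub>R (if y = 0 then 0 else (1 / norm y) *\<^sub>R y)"
    have "u \<in> cball (Re_vec s) e" using e by (simp add: u_def dist_norm)
    then obtain \<sigma> where \<sigma>: "\<And>i. \<sigma> i \<in> newton_polytope (f i)" "u = (\<Sum>i\<in>UNIV. (Re_vec t $ i) *\<^sub>R \<sigma> i)"
      using e(2) unfolding weighted_minkowski_sum_def by blast
    have "Re_vec s \<bullet> y + e * norm y = u \<bullet> y"
      by (simp add: u_def inner_add_left power2_norm_eq_inner[symmetric] power2_eq_square)
    also have "\<dots> = (\<Sum>i\<in>UNIV. Re (t $ i) * (\<sigma> i \<bullet> y))" by (simp add: \<sigma>(2) inner_sum_left Re_vec_def)
    also have "\<dots> \<le> (\<Sum>i\<in>UNIV. Re (t $ i) * (Re (logf i y) + C i))"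
    proof (intro sum_mono mult_left_mono)
      show "\<sigma> i \<bullet> y \<le> Re (logf i y) + C i" for i using C[OF \<sigma>(1), of i y] by linarith
    qed (use \<tau> less_imp_le in blast)
    finally have 1: "Re_vec s \<bullet> y + e * norm y \<le> (\<Sum>i\<in>UNIV. Re (t $ i) * (Re (logf i y) + C i))" .
    have 2: "Im (t $ i) * Im (logf i y) \<le> \<bar>Im (t $ i)\<bar> * K i" for i
      using K[of i y] by (metis abs_ge_self abs_ge_zero abs_mult mult_left_mono order.trans)
    have "Re (phase p y) = Re_vec s \<bullet> y - (\<Sum>i\<in>UNIV. Re (t $ i) * Re (logf i y)) + (\<Sum>i\<in>UNIV. Im (t $ i) * Im (logf i y))"
      by (simp add: p phase_def Re_vec_def inner_vec_def sum_subtractf)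
    also have "\<dots> \<le> Re_vec s \<bullet> y - (\<Sum>i\<in>UNIV. Re (t $ i) * Re (logf i y)) + (\<Sum>i\<in>UNIV. \<bar>Im (t $ i)\<bar> * K i)"
      using 2 by (intro add_left_mono sum_mono)
    also have "\<dots> \<le> (\<Sum>i\<in>UNIV. Re (t $ i) * C i + \<bar>Im (t $ i)\<bar> * K i) - e * norm y"
      using 1 by (simp add: distrib_left sum.distrib)
    finally show ?thesis .
  qed
  then show ?thesis using e(1) by blast
qed

lemma integrable_exp_phase_growth:
  assumes "p \<in> convergence_domain f"
  shows "\<exists>r>0. integrable lborel (\<lambda>y. exp (Re (phase p y) + r * growth y))"
proof -
  obtain C \<epsilon> where C: "0 < \<epsilon>" "\<And>y. Re (phase p y) \<le> C - \<epsilon> * norm y"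
    using Re_phase_le[OF assms] by blast
  obtain A B where AB: "0 < B" "\<And>y. growth y \<le> A + B * norm y" using growth_linear by blast
  define r where "r = \<epsilon> / (2 * B)"
  have r: "0 < r" using C AB by (simp add: r_def)
  have [measurable]: "growth \<in> borel_measurable borel"
    unfolding growth_def[abs_def]
    by (intro borel_measurable_continuous_onI continuous_intros continuous_logf)
  have "integrable lborel (\<lambda>y. exp (Re (phase p y) + r * growth y))"
  proof (rule Bochner_Integration.integrable_bound)
    show "integrable lborel (\<lambda>y::real ^ 'n. exp (C + r * A) * exp (- (\<epsilon>/2) * norm y))"
      using C(1) by (intro integrable_mult_right exp_minus_norm_integrable) simp
    have "exp (Re (phase p y) + r * growth y) \<le> exp (C + r * A) * exp (- (\<epsilon>/2) * norm y)" for y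
    proof -
      have "r * growth y \<le> r * (A + B * norm y)" using r AB(2) by (intro mult_left_mono) auto
      also have "\<dots> = r * A + \<epsilon> / 2 * norm y" using AB(1) by (simp add: r_def field_simps)
      finally show ?thesis using C(2)[of y] by (simp flip: exp_add)
    qed
    then show "AE y in lborel. norm (exp (Re (phase p y) + r * growth y))
        \<le> norm (exp (C + r * A) * exp (- (\<epsilon>/2) * norm y))" by simp
  qed measurable
  with r show ?thesis by blast
qed

lemma integrable_exp_phase:
  assumes "p \<in> convergence_domain f"
  shows "integrable lborel (\<lambda>y. exp (phase p y))"
proof -
  obtain r where r: "0 < r" "integrable lborel (\<lambda>y. exp (Re (phase p y) + r * growth y))"
    using integrable_exp_phase_growth[OF assms] by blast
  show ?thesis
    by (rule laplace_transform_has_derivative(2)[OF phase_add phase_scaleR norm_phase_le growth_nonneg _ r]) simp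
qed

lemma complex_differentiable_mellin:
  assumes "p \<in> convergence_domain f"
  shows "complex_differentiable_at mellin p"
proof -
  obtain r where r: "0 < r" "integrable lborel (\<lambda>y. exp (Re (phase p y) + r * growth y))"
    using integrable_exp_phase_growth[OF assms] by blast
  have "(mellin has_derivative (\<lambda>v. \<integral>y. phase v y * exp (phase p y) \<partial>lborel)) (at p)"
    unfolding mellin_def[abs_def]
    by (rule laplace_transform_has_derivative(1)[OF phase_add phase_scaleR norm_phase_le growth_nonneg _ r]) simp
  then show ?thesis
    unfolding complex_differentiable_at_def
    by (intro exI conjI allI) (assumption, simp add: phase_complex_scale mult.assoc)
qed

lemma euler_mellin_eq_mellin:
  assumes "(s, t) \<in> convergence_domain f"
  shows "set_integrable lborel orthant (euler_mellin_integrand L s t)"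
    and "euler_mellin L s t = mellin (s, t)"
proof -
  have eq: "indicator orthant x *\<^sub>R euler_mellin_integrand L s t x =
      orthant_density x *\<^sub>R exp (phase (s, t) (ln_vec x))" for x
  proof (cases "x \<in> orthant")
    case True
    have "exp (phase (s, t) (ln_vec x)) = monomial_power x s / poly_power L x t"
      unfolding phase_def logf_def exp_vec_ln_vec[OF True] exp_diff monomial_power_def poly_power_def
      by (simp add: ln_vec_def exp_sum)
    then show ?thesis
      using True by (simp add: euler_mellin_integrand_def orthant_density_def scaleR_conv_of_real)
  qed (simp add: orthant_density_def)
  have [measurable]: "(\<lambda>y. exp (phase (s, t) y)) \<in> borel_measurable borel" by measurable
  show "set_integrable lborel orthant (euler_mellin_integrand L s t)"
    unfolding set_integrable_def eq using integrable_exp_phase[OF assms]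
    by (subst logarithmic_substitution(1)) auto
  show "euler_mellin L s t = mellin (s, t)"
    unfolding euler_mellin_def set_lebesgue_integral_def eq mellin_def
    by (rule logarithmic_substitution(2)) simp
qed

text \<open>This is \<open>1 = f\<^sub>i / f\<^sub>i\<close>, expanded into monomials.\<close>

lemma exp_phase_split:
  "exp (phase p y) = (\<Sum>\<alpha>\<in>Poly_Mapping.keys (f i). Poly_Mapping.lookup (f i) \<alpha> * exp (phase (p + shift i \<alpha>) y))"
proof -
  have "(\<Sum>\<alpha>\<in>Poly_Mapping.keys (f i). Poly_Mapping.lookup (f i) \<alpha> * exp (phase (p + shift i \<alpha>) y))
     = exp (phase p y) * exp (- logf i y) * exp (logf i y)"
    unfolding exp_logf sum_distrib_left
    by (intro sum.cong refl) (simp add: phase_add phase_shift exp_add exp_diff exp_minus exp_of_real divide_inverse mult_ac)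
  then show ?thesis by (simp add: mult.assoc flip: exp_add)
qed

lemma mellin_split:
  assumes "\<And>\<alpha>. \<alpha> \<in> Poly_Mapping.keys (f i) \<Longrightarrow> p + shift i \<alpha> \<in> convergence_domain f"
  shows "mellin p = (\<Sum>\<alpha>\<in>Poly_Mapping.keys (f i). Poly_Mapping.lookup (f i) \<alpha> * mellin (p + shift i \<alpha>))"
  unfolding mellin_def exp_phase_split[of p _ i]
  using integrable_exp_phase[OF assms] by (subst Bochner_Integration.integral_sum) auto

lemma exp_phase_directional_derivative:
  "((\<lambda>a. exp (phase p (y + a *\<^sub>R v))) has_vector_derivative
     pairing v (fst p) * exp (phase p (y + a *\<^sub>R v)) -
     (\<Sum>i\<in>UNIV. \<Sum>\<alpha>\<in>Poly_Mapping.keys (f i). snd p $ i * Poly_Mapping.lookup (f i) \<alpha> *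
        of_real (exponent_vec \<alpha> \<bullet> v) * exp (phase (p + shift i \<alpha>) (y + a *\<^sub>R v)))) (at a)"
proof -
  let ?z = "y + a *\<^sub>R v"
  define D where "D i = (\<Sum>\<alpha>\<in>Poly_Mapping.keys (f i). Poly_Mapping.lookup (f i) \<alpha> * of_real (exponent_vec \<alpha> \<bullet> v) *
        exp (of_real (exponent_vec \<alpha> \<bullet> ?z) - logf i ?z))" for i
  have 1: "((\<lambda>a. fst p $ j * of_real ((y + a *\<^sub>R v) $ j)) has_vector_derivative fst p $ j * of_real (v $ j)) (at a)" for j
    by (intro has_vector_derivative_mult_right has_vector_derivative_of_real) (auto intro!: derivative_eq_intros)
  have 2: "((\<lambda>a. snd p $ i * logf i (y + a *\<^sub>R v)) has_vector_derivative snd p $ i * D i) (at a)" for i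
    unfolding D_def by (intro has_vector_derivative_mult_right logf_directional_derivative)
  have "((\<lambda>a. phase p (y + a *\<^sub>R v)) has_vector_derivative
      (\<Sum>j\<in>UNIV. fst p $ j * of_real (v $ j)) - (\<Sum>i\<in>UNIV. snd p $ i * D i)) (at a)"
    unfolding phase_def by (intro has_vector_derivative_diff has_vector_derivative_sum 1 2)
  from field_vector_diff_chain_at[OF this DERIV_exp]
  have "((\<lambda>a. exp (phase p (y + a *\<^sub>R v))) has_vector_derivative
      ((\<Sum>j\<in>UNIV. fst p $ j * of_real (v $ j)) - (\<Sum>i\<in>UNIV. snd p $ i * D i)) * exp (phase p ?z)) (at a)"
    by (simp add: o_def)
  also have "((\<Sum>j\<in>UNIV. fst p $ j * of_real (v $ j)) - (\<Sum>i\<in>UNIV. snd p $ i * D i)) * exp (phase p ?z) =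
     pairing v (fst p) * exp (phase p ?z) - (\<Sum>i\<in>UNIV. \<Sum>\<alpha>\<in>Poly_Mapping.keys (f i). snd p $ i *
       Poly_Mapping.lookup (f i) \<alpha> * of_real (exponent_vec \<alpha> \<bullet> v) * exp (phase (p + shift i \<alpha>) ?z))"
    unfolding left_diff_distrib D_def sum_distrib_left sum_distrib_right
    by (intro arg_cong2[of _ _ _ _ minus] sum.cong refl)
       (simp_all add: pairing_def sum_distrib_left sum_distrib_right phase_add phase_shift exp_add mult_ac)
  finally show ?thesis .
qed

text \<open>Integration by parts in the direction \<open>v\<close>: the derivative of the integrand is a combination of shifted
  integrands and integrates to \<open>0\<close>.\<close>

lemma mellin_directional:
  assumes p: "p \<in> convergence_domain f"
    and shift: "\<And>i \<alpha>. \<alpha> \<in> Poly_Mapping.keys (f i) \<Longrightarrow> p + shift i \<alpha> \<in> convergence_domain f"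
  shows "pairing v (fst p) * mellin p =
     (\<Sum>i\<in>UNIV. \<Sum>\<alpha>\<in>Poly_Mapping.keys (f i). snd p $ i * Poly_Mapping.lookup (f i) \<alpha> *
        of_real (exponent_vec \<alpha> \<bullet> v) * mellin (p + shift i \<alpha>))"
proof -
  define W where "W y = pairing v (fst p) * exp (phase p y) -
     (\<Sum>i\<in>UNIV. \<Sum>\<alpha>\<in>Poly_Mapping.keys (f i). snd p $ i * Poly_Mapping.lookup (f i) \<alpha> *
        of_real (exponent_vec \<alpha> \<bullet> v) * exp (phase (p + shift i \<alpha>) y))" for y
  have int: "integrable lborel (\<lambda>y. exp (phase p y))"
     "\<And>i \<alpha>. \<alpha> \<in> Poly_Mapping.keys (f i) \<Longrightarrow> integrable lborel (\<lambda>y. exp (phase (p + shift i \<alpha>) y))"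
    using integrable_exp_phase p shift by auto
  have intS: "integrable lborel (\<lambda>y. \<Sum>\<alpha>\<in>Poly_Mapping.keys (f i). snd p $ i * Poly_Mapping.lookup (f i) \<alpha> *
        of_real (exponent_vec \<alpha> \<bullet> v) * exp (phase (p + shift i \<alpha>) y))" for i
    by (intro Bochner_Integration.integrable_sum integrable_mult_right int)
  have "integral\<^sup>L lborel W = 0"
  proof (rule integral_directional_derivative_eq_0)
    show "integrable lborel (\<lambda>y. exp (phase p y))" by (rule int)
    show "integrable lborel W"
      unfolding W_def by (intro Bochner_Integration.integrable_diff Bochner_Integration.integrable_sum integrable_mult_right int)
    show "continuous_on UNIV W"
      unfolding W_def by (intro continuous_intros continuous_phase)
    show "((\<lambda>a. exp (phase p (y + a *\<^sub>R v))) has_vector_derivative W (y + a *\<^sub>R v)) (at a)" for y a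
      unfolding W_def by (rule exp_phase_directional_derivative)
  qed
  moreover have "integral\<^sup>L lborel W = pairing v (fst p) * mellin p -
     (\<Sum>i\<in>UNIV. \<Sum>\<alpha>\<in>Poly_Mapping.keys (f i). snd p $ i * Poly_Mapping.lookup (f i) \<alpha> *
        of_real (exponent_vec \<alpha> \<bullet> v) * mellin (p + shift i \<alpha>))"
    unfolding W_def[abs_def] mellin_def
    using int intS by (simp add: Bochner_Integration.integral_sum Bochner_Integration.integral_diff Bochner_Integration.integrable_sum)
  ultimately show ?thesis by simp
qed

section \<open>Meromorphic continuation\<close>

text \<open>The argument of the Gamma factor that belongs to the normal \<open>\<kappa>\<close>.\<close>

definition facet_form :: "int ^ 'n \<Rightarrow> (complex ^ 'n) \<times> (complex ^ 'm) \<Rightarrow> complex" where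
  "facet_form \<kappa> p = pairing (real_vec \<kappa>) (fst p) - pairing (support_vec f \<kappa>) (snd p)"

text \<open>The lattice distance of the exponent \<open>\<alpha>\<close> from the face of the \<open>i\<close>-th Newton polytope on which \<open>\<kappa>\<close> is minimal. The
  rounding is exact on the support, by \<open>gap_eq\<close>.\<close>

definition gap :: "int ^ 'n \<Rightarrow> 'm \<Rightarrow> ('n \<Rightarrow>\<^sub>0 nat) \<Rightarrow> nat" where
  "gap \<kappa> i \<alpha> = nat \<lfloor>real_vec \<kappa> \<bullet> exponent_vec \<alpha> - support_vec f \<kappa> $ i\<rfloor>"

lemma gap_eq:
  assumes "\<alpha> \<in> Poly_Mapping.keys (f i)"
  shows "real_vec \<kappa> \<bullet> exponent_vec \<alpha> - support_vec f \<kappa> $ i = real (gap \<kappa> i \<alpha>)"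
proof -
  obtain \<alpha>0 where \<alpha>0: "support_vec f \<kappa> $ i = real_vec \<kappa> \<bullet> exponent_vec \<alpha>0"
    "\<And>\<beta>. \<beta> \<in> Poly_Mapping.keys (f i) \<Longrightarrow> support_vec f \<kappa> $ i \<le> real_vec \<kappa> \<bullet> exponent_vec \<beta>"
    by (rule support_vec_attained[of f i \<kappa>, OF f_nonzero]) (rule that)
  have "real_vec \<kappa> \<bullet> exponent_vec \<alpha> - support_vec f \<kappa> $ i \<in> \<int>"
    unfolding \<alpha>0(1) real_vec_int_exponent[symmetric] inner_real_vec by (intro Ints_diff Ints_of_int)
  moreover have "0 \<le> real_vec \<kappa> \<bullet> exponent_vec \<alpha> - support_vec f \<kappa> $ i" using \<alpha>0(2)[OF assms] by simp
  ultimately show ?thesis by (auto simp: gap_def elim!: Ints_cases)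
qed

lemma facet_form_shift:
  assumes "\<alpha> \<in> Poly_Mapping.keys (f i)"
  shows "facet_form \<kappa> (p + shift i \<alpha>) = facet_form \<kappa> p + of_nat (gap \<kappa> i \<alpha>)"
proof -
  have "facet_form \<kappa> (p + shift i \<alpha>) = facet_form \<kappa> p + of_real (real_vec \<kappa> \<bullet> exponent_vec \<alpha> - support_vec f \<kappa> $ i)"
    by (simp add: facet_form_def shift_def pairing_def complex_vec_def inner_vec_def axis_def
        algebra_simps sum.distrib if_distrib[of "\<lambda>c. _ * c"] if_distrib[of "\<lambda>c. c * _"] cong: if_cong)
  then show ?thesis by (simp add: gap_eq[OF assms])
qed

lemma linear_facet_form: "linear (facet_form \<kappa>)"
  unfolding facet_form_def pairing_def
  by (intro linearI) (simp_all add: algebra_simps sum.distrib scaleR_sum_right scaleR_diff_right)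

lemma complex_differentiable_facet_form: "complex_differentiable_at (facet_form \<kappa>) p"
  by (rule complex_differentiable_linear[OF linear_facet_form])
     (simp add: facet_form_def pairing_def right_diff_distrib sum_distrib_left mult_ac)

lemma complex_differentiable_rGamma_facet_form: "complex_differentiable_at (\<lambda>p. rGamma (facet_form \<kappa> p)) p"
proof -
  obtain g' where "(rGamma has_field_derivative g') (at (facet_form \<kappa> p))"
    using field_differentiable_rGamma field_differentiable_def by blast
  then show ?thesis by (rule complex_differentiable_compose[OF complex_differentiable_facet_form])
qed

lemma continuous_facet_form: "continuous_on UNIV (facet_form \<kappa>)"
  using linear_facet_form by (simp add: linear_continuous_on linear_conv_bounded_linear)

lemma complex_differentiable_pochhammer:
  assumes "complex_differentiable_at F p"
  shows "complex_differentiable_at (\<lambda>p. pochhammer (F p) n) p"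
  unfolding pochhammer_prod
  by (intro complex_differentiable_prod complex_differentiable_add complex_differentiable_const assms)

lemma Re_facet_form: "Re (facet_form \<kappa> (s, t)) = real_vec \<kappa> \<bullet> Re_vec s - support_vec f \<kappa> \<bullet> Re_vec t"
  by (simp add: facet_form_def pairing_def Re_vec_def inner_vec_def)

text \<open>The interior of a finite intersection of proper closed halfspaces is the intersection of the open ones.\<close>

lemma convergence_domain_iff:
  assumes K: "finite K" "\<forall>\<kappa>\<in>K. primitive_vec \<kappa>" and pres: "minkowski_presentation f K"
  shows "p \<in> convergence_domain f \<longleftrightarrow> (\<forall>i. 0 < Re (snd p $ i)) \<and> (\<forall>\<kappa>\<in>K. 0 < Re (facet_form \<kappa> p))"
proof -
  obtain s t where p: "p = (s, t)" by (cases p)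
  have "interior (weighted_minkowski_sum (Re_vec t) f) = (\<Inter>\<kappa>\<in>K. {\<sigma>. support_vec f \<kappa> \<bullet> Re_vec t < real_vec \<kappa> \<bullet> \<sigma>})"
    (is "_ = ?O") if "Re_vec t \<in> orthant"
  proof (rule equalityI)
    have eq: "weighted_minkowski_sum (Re_vec t) f = (\<Inter>\<kappa>\<in>K. {\<sigma>. support_vec f \<kappa> \<bullet> Re_vec t \<le> real_vec \<kappa> \<bullet> \<sigma>})"
      using pres that by (simp add: minkowski_presentation_def)
    show "interior (weighted_minkowski_sum (Re_vec t) f) \<subseteq> ?O"
    proof (rule INT_greatest)
      fix \<kappa> assume "\<kappa> \<in> K"
      then have "weighted_minkowski_sum (Re_vec t) f \<subseteq> {\<sigma>. real_vec \<kappa> \<bullet> \<sigma> \<ge> support_vec f \<kappa> \<bullet> Re_vec t}"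
        unfolding eq by blast
      from interior_mono[OF this] interior_halfspace_ge[OF primitive_vec_nonzero[OF bspec[OF K(2) \<open>\<kappa> \<in> K\<close>]]]
      show "interior (weighted_minkowski_sum (Re_vec t) f) \<subseteq> {\<sigma>. support_vec f \<kappa> \<bullet> Re_vec t < real_vec \<kappa> \<bullet> \<sigma>}"
        by auto
    qed
    show "?O \<subseteq> interior (weighted_minkowski_sum (Re_vec t) f)"
    proof (rule interior_maximal)
      show "?O \<subseteq> weighted_minkowski_sum (Re_vec t) f" unfolding eq by (auto intro: less_imp_le)
      show "open ?O" using K(1) by (intro open_INT ballI open_halfspace_gt)
    qed
  qed
  then show ?thesis
    by (auto simp: p convergence_domain_def Re_facet_form orthant_def Re_vec_def)
qed

text \<open>Subtracting \<open>t\<^sub>i\<close> times the offset \<open>support_vec f \<kappa> $ i\<close> times the expansion \<open>mellin_split\<close> from the integration by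
  parts in the direction \<open>\<kappa>\<close> replaces the pairings \<open>\<langle>\<kappa>, \<alpha>\<rangle>\<close> by the gaps, which vanish on the face where \<open>\<kappa>\<close> is minimal.\<close>

lemma mellin_facet_recurrence:
  assumes p: "p \<in> convergence_domain f"
    and shift: "\<And>i \<alpha>. \<alpha> \<in> Poly_Mapping.keys (f i) \<Longrightarrow> p + shift i \<alpha> \<in> convergence_domain f"
  shows "facet_form \<kappa> p * mellin p =
     (\<Sum>i\<in>UNIV. \<Sum>\<alpha>\<in>Poly_Mapping.keys (f i). snd p $ i * Poly_Mapping.lookup (f i) \<alpha> *
        of_nat (gap \<kappa> i \<alpha>) * mellin (p + shift i \<alpha>))"
proof -
  have split: "mellin p = (\<Sum>\<alpha>\<in>Poly_Mapping.keys (f i). Poly_Mapping.lookup (f i) \<alpha> * mellin (p + shift i \<alpha>))" for i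
    by (rule mellin_split) (rule shift)
  have directional: "pairing (real_vec \<kappa>) (fst p) * mellin p =
     (\<Sum>i\<in>UNIV. \<Sum>\<alpha>\<in>Poly_Mapping.keys (f i). snd p $ i * Poly_Mapping.lookup (f i) \<alpha> *
        of_real (exponent_vec \<alpha> \<bullet> real_vec \<kappa>) * mellin (p + shift i \<alpha>))"
    by (rule mellin_directional[OF p]) (rule shift)
  have "pairing (support_vec f \<kappa>) (snd p) * mellin p =
     (\<Sum>i\<in>UNIV. of_real (support_vec f \<kappa> $ i) * snd p $ i * mellin p)"
    by (simp add: pairing_def sum_distrib_right)
  also have "\<dots> = (\<Sum>i\<in>UNIV. of_real (support_vec f \<kappa> $ i) * snd p $ i *
      (\<Sum>\<alpha>\<in>Poly_Mapping.keys (f i). Poly_Mapping.lookup (f i) \<alpha> * mellin (p + shift i \<alpha>)))"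
    by (intro sum.cong refl arg_cong2[of _ _ _ _ "(*)"] split)
  finally have "facet_form \<kappa> p * mellin p =
     (\<Sum>i\<in>UNIV. \<Sum>\<alpha>\<in>Poly_Mapping.keys (f i). snd p $ i * Poly_Mapping.lookup (f i) \<alpha> *
        of_real (exponent_vec \<alpha> \<bullet> real_vec \<kappa>) * mellin (p + shift i \<alpha>)) -
     (\<Sum>i\<in>UNIV. of_real (support_vec f \<kappa> $ i) * snd p $ i *
      (\<Sum>\<alpha>\<in>Poly_Mapping.keys (f i). Poly_Mapping.lookup (f i) \<alpha> * mellin (p + shift i \<alpha>)))"
    unfolding facet_form_def left_diff_distrib directional by (rule arg_cong)
  also have "\<dots> = (\<Sum>i\<in>UNIV. \<Sum>\<alpha>\<in>Poly_Mapping.keys (f i). snd p $ i * Poly_Mapping.lookup (f i) \<alpha> *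
        of_real (real_vec \<kappa> \<bullet> exponent_vec \<alpha> - support_vec f \<kappa> $ i) * mellin (p + shift i \<alpha>))"
    unfolding sum_subtractf[symmetric] sum_distrib_left
    by (intro sum.cong refl) (simp add: algebra_simps inner_commute)
  also have "\<dots> = (\<Sum>i\<in>UNIV. \<Sum>\<alpha>\<in>Poly_Mapping.keys (f i). snd p $ i * Poly_Mapping.lookup (f i) \<alpha> *
        of_nat (gap \<kappa> i \<alpha>) * mellin (p + shift i \<alpha>))"
    by (intro sum.cong refl) (simp add: gap_eq)
  finally show ?thesis .
qed

text \<open>Multiplication by the reciprocal Gamma factors \<open>h\<close> turns \<open>mellin_split\<close> and \<open>mellin_facet_recurrence\<close> into
  recurrences for \<open>mellin * h\<close>: a shift raises each \<open>facet_form \<kappa>\<close> by a natural number, so that the quotient of the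
  old and the new Gamma factors is a Pochhammer polynomial. The first kind raises the form \<open>Re t\<^sub>i\<close> and the
  second kind \<open>Re (facet_form \<kappa>0)\<close>, as \<open>entire_continuation\<close> demands.\<close>

lemma entire_quotient:
  assumes K: "finite K" "\<forall>\<kappa>\<in>K. primitive_vec \<kappa>" and pres: "minkowski_presentation f K"
  shows "\<exists>\<Phi>. (\<forall>p. complex_differentiable_at \<Phi> p) \<and>
    (\<forall>p\<in>convergence_domain f. \<Phi> p = mellin p * (\<Prod>\<kappa>\<in>K. rGamma (facet_form \<kappa> p)))"
proof -
  define h where "h A p = (\<Prod>\<kappa>\<in>A. rGamma (facet_form \<kappa> p))" for A p
  define \<Phi>0 where "\<Phi>0 p = mellin p * h K p" for p
  define \<Lambda> where "\<Lambda> = Inl ` K \<union> range (Inr :: 'm \<Rightarrow> (int ^ 'n) + 'm)"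
  define form where "form l p = (case l of Inl \<kappa> \<Rightarrow> Re (facet_form \<kappa> p) | Inr i \<Rightarrow> Re (snd p $ i))"
    for l :: "(int ^ 'n) + 'm" and p
  have dom: "p \<in> convergence_domain f \<longleftrightarrow> (\<forall>l\<in>\<Lambda>. 0 < form l p)" for p
    unfolding convergence_domain_iff[OF K pres] by (auto simp: \<Lambda>_def form_def ball_Un)
  have form_shift: "form k p \<le> form k (p + shift i \<alpha>)" if "\<alpha> \<in> Poly_Mapping.keys (f i)" for i \<alpha> k p
    by (cases k) (auto simp: form_def facet_form_shift[OF that], auto simp: shift_def axis_def)
  have dom_shift: "p + shift i \<alpha> \<in> convergence_domain f"
    if "p \<in> convergence_domain f" "\<alpha> \<in> Poly_Mapping.keys (f i)" for p i \<alpha>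
    using that form_shift[OF that(2)] unfolding dom by (meson less_le_trans)
  have h_shift: "h A p = (\<Prod>\<kappa>\<in>A. pochhammer (facet_form \<kappa> p) (gap \<kappa> i \<alpha>)) * h A (p + shift i \<alpha>)"
    if "\<alpha> \<in> Poly_Mapping.keys (f i)" for A p i \<alpha>
    unfolding h_def prod.distrib[symmetric] facet_form_shift[OF that]
    by (intro prod.cong refl pochhammer_rGamma)
  have hol: "complex_differentiable_at \<Phi>0 p" if "p \<in> convergence_domain f" for p
    unfolding \<Phi>0_def[abs_def] h_def
    by (intro complex_differentiable_mult complex_differentiable_prod complex_differentiable_mellin that
        complex_differentiable_rGamma_facet_form)
  have "\<exists>\<Phi>. (\<forall>p. complex_differentiable_at \<Phi> p) \<and> (\<forall>p. (\<forall>l\<in>\<Lambda>. 0 < form l p) \<longrightarrow> \<Phi> p = \<Phi>0 p)"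
  proof (rule entire_continuation)
    show "finite \<Lambda>" using K(1) by (simp add: \<Lambda>_def)
    show "continuous_on UNIV (form l)" for l
      unfolding form_def[abs_def] by (cases l) (auto intro!: continuous_intros continuous_facet_form)
    show "complex_differentiable_at \<Phi>0 p" if "\<forall>l\<in>\<Lambda>. 0 < form l p" for p
      using hol that dom by blast
    fix l assume "l \<in> \<Lambda>"
    then consider i where "l = Inr i" | \<kappa>0 where "l = Inl \<kappa>0" "\<kappa>0 \<in> K" by (auto simp: \<Lambda>_def)
    then show "\<exists>(J :: ('m \<times> ('n \<Rightarrow>\<^sub>0 nat)) set) c v. finite J \<and>
       (\<forall>j\<in>J. (\<forall>p. complex_differentiable_at (c j) p) \<and> (\<forall>p. \<forall>k\<in>\<Lambda>. form k p \<le> form k (p + v j)) \<and>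
          (\<forall>p. form l p + 1 \<le> form l (p + v j))) \<and>
       (\<forall>p. (\<forall>k\<in>\<Lambda>. 0 < form k p) \<longrightarrow> \<Phi>0 p = (\<Sum>j\<in>J. c j p * \<Phi>0 (p + v j)))"
    proof cases
      case (1 i)
      let ?J = "{i} \<times> Poly_Mapping.keys (f i)"
      define c where "c j p = Poly_Mapping.lookup (f i) (snd j) * (\<Prod>\<kappa>\<in>K. pochhammer (facet_form \<kappa> p) (gap \<kappa> i (snd j)))"
        for j :: "'m \<times> ('n \<Rightarrow>\<^sub>0 nat)" and p
      define v where "v j = shift i (snd j)" for j :: "'m \<times> ('n \<Rightarrow>\<^sub>0 nat)"
      show ?thesis
      proof (intro exI[of _ ?J] exI[of _ c] exI[of _ v] conjI ballI allI impI)
        show "finite ?J" by simp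
        show "complex_differentiable_at (c j) p" for j p
          unfolding c_def by (intro complex_differentiable_mult complex_differentiable_const
              complex_differentiable_prod complex_differentiable_pochhammer complex_differentiable_facet_form)
        show "form k p \<le> form k (p + v j)" if "j \<in> ?J" for j k p
          unfolding v_def using that by (intro form_shift) auto
        show "form l p + 1 \<le> form l (p + v j)" for j p
          by (simp add: 1 form_def v_def shift_def axis_def)
        fix p assume "\<forall>k\<in>\<Lambda>. 0 < form k p"
        then have "p \<in> convergence_domain f" by (simp add: dom)
        have "\<Phi>0 p = (\<Sum>\<alpha>\<in>Poly_Mapping.keys (f i). Poly_Mapping.lookup (f i) \<alpha> * mellin (p + shift i \<alpha>) * h K p)"
        proof -
          have "mellin p = (\<Sum>\<alpha>\<in>Poly_Mapping.keys (f i). Poly_Mapping.lookup (f i) \<alpha> * mellin (p + shift i \<alpha>))"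
            by (rule mellin_split) (rule dom_shift[OF \<open>p \<in> _\<close>])
          then show ?thesis unfolding \<Phi>0_def by (simp only: sum_distrib_right)
        qed
        also have "\<dots> = (\<Sum>\<alpha>\<in>Poly_Mapping.keys (f i). c (i, \<alpha>) p * \<Phi>0 (p + v (i, \<alpha>)))"
        proof (intro sum.cong refl)
          fix \<alpha> assume "\<alpha> \<in> Poly_Mapping.keys (f i)"
          show "Poly_Mapping.lookup (f i) \<alpha> * mellin (p + shift i \<alpha>) * h K p = c (i, \<alpha>) p * \<Phi>0 (p + v (i, \<alpha>))"
            unfolding h_shift[OF \<open>\<alpha> \<in> _\<close>, of K p] by (simp add: c_def v_def \<Phi>0_def mult_ac)
        qed
        also have "\<dots> = (\<Sum>j\<in>?J. c j p * \<Phi>0 (p + v j))"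
        proof -
          have "?J = Pair i ` Poly_Mapping.keys (f i)" by auto
          then show ?thesis by (simp add: sum.reindex inj_on_def)
        qed
        finally show "\<Phi>0 p = (\<Sum>j\<in>?J. c j p * \<Phi>0 (p + v j))" .
      qed
    next
      case (2 \<kappa>0)
      let ?J = "SIGMA i:UNIV. {\<alpha> \<in> Poly_Mapping.keys (f i). gap \<kappa>0 i \<alpha> \<noteq> 0}"
      let ?K = "K - {\<kappa>0}"
      define c where "c j p = snd p $ (fst j) * Poly_Mapping.lookup (f (fst j)) (snd j) * of_nat (gap \<kappa>0 (fst j) (snd j)) *
          pochhammer (facet_form \<kappa>0 p + 1) (gap \<kappa>0 (fst j) (snd j) - 1) *
          (\<Prod>\<kappa>\<in>?K. pochhammer (facet_form \<kappa> p) (gap \<kappa> (fst j) (snd j)))"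
        for j :: "'m \<times> ('n \<Rightarrow>\<^sub>0 nat)" and p
      define v where "v j = shift (fst j) (snd j)" for j :: "'m \<times> ('n \<Rightarrow>\<^sub>0 nat)"
      show ?thesis
      proof (intro exI[of _ ?J] exI[of _ c] exI[of _ v] conjI ballI allI impI)
        show "finite ?J" by (intro finite_SigmaI) auto
        show "complex_differentiable_at (c j) p" for j p
          unfolding c_def by (intro complex_differentiable_mult complex_differentiable_const complex_differentiable_component
              complex_differentiable_prod complex_differentiable_pochhammer complex_differentiable_add complex_differentiable_facet_form)
        show "form k p \<le> form k (p + v j)" if "j \<in> ?J" for j k p
          unfolding v_def using that by (intro form_shift) auto
        show "form l p + 1 \<le> form l (p + v j)" if "j \<in> ?J" for j p
          using that by (auto simp: 2 form_def v_def facet_form_shift)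
        fix p assume "\<forall>k\<in>\<Lambda>. 0 < form k p"
        then have p: "p \<in> convergence_domain f" by (simp add: dom)
        \<comment> \<open>The factor \<open>facet_form \<kappa>0 p\<close> on the left of the recurrence is absorbed by
            \<open>rGamma z = z * rGamma (z + 1)\<close>, which leaves \<open>rGamma (z + 1)\<close> to be compared with the shifted factor.\<close>
        let ?R = "rGamma (facet_form \<kappa>0 p + 1) * h ?K p"
        have hK: "h K q = rGamma (facet_form \<kappa>0 q) * h ?K q" for q
          unfolding h_def using K(1) 2(2) by (rule prod.remove)
        have "\<Phi>0 p = (facet_form \<kappa>0 p * mellin p) * ?R"
          unfolding \<Phi>0_def hK rGamma_plus1[symmetric, of "facet_form \<kappa>0 p"] by (simp add: mult_ac)
        also have "\<dots> = (\<Sum>i\<in>UNIV. \<Sum>\<alpha>\<in>Poly_Mapping.keys (f i). snd p $ i * Poly_Mapping.lookup (f i) \<alpha> *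
            of_nat (gap \<kappa>0 i \<alpha>) * mellin (p + shift i \<alpha>) * ?R)"
          by (subst mellin_facet_recurrence[OF p dom_shift[OF p]]) (simp_all only: sum_distrib_right)
        also have "\<dots> = (\<Sum>i\<in>UNIV. \<Sum>\<alpha>\<in>{\<alpha> \<in> Poly_Mapping.keys (f i). gap \<kappa>0 i \<alpha> \<noteq> 0}.
            snd p $ i * Poly_Mapping.lookup (f i) \<alpha> * of_nat (gap \<kappa>0 i \<alpha>) * mellin (p + shift i \<alpha>) * ?R)"
          by (intro sum.cong refl sum.mono_neutral_right) auto
        also have "\<dots> = (\<Sum>i\<in>UNIV. \<Sum>\<alpha>\<in>{\<alpha> \<in> Poly_Mapping.keys (f i). gap \<kappa>0 i \<alpha> \<noteq> 0}.
            c (i, \<alpha>) p * \<Phi>0 (p + v (i, \<alpha>)))"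
        proof (intro sum.cong refl)
          fix i \<alpha> assume "\<alpha> \<in> {\<alpha> \<in> Poly_Mapping.keys (f i). gap \<kappa>0 i \<alpha> \<noteq> 0}"
          then have \<alpha>: "\<alpha> \<in> Poly_Mapping.keys (f i)" and d: "gap \<kappa>0 i \<alpha> \<noteq> 0" by auto
          have "of_nat (gap \<kappa>0 i \<alpha>) = (1 :: complex) + of_nat (gap \<kappa>0 i \<alpha> - 1)"
            using d by (metis Suc_pred' not_gr_zero of_nat_Suc)
          then have "rGamma (facet_form \<kappa>0 p + 1) = pochhammer (facet_form \<kappa>0 p + 1) (gap \<kappa>0 i \<alpha> - 1) *
              rGamma (facet_form \<kappa>0 (p + shift i \<alpha>))"
            unfolding facet_form_shift[OF \<alpha>]
            by (subst pochhammer_rGamma[of _ "gap \<kappa>0 i \<alpha> - 1"]) (simp add: add.assoc)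
          then show "snd p $ i * Poly_Mapping.lookup (f i) \<alpha> * of_nat (gap \<kappa>0 i \<alpha>) * mellin (p + shift i \<alpha>) * ?R =
             c (i, \<alpha>) p * \<Phi>0 (p + v (i, \<alpha>))"
            unfolding h_shift[OF \<alpha>, of ?K p] \<Phi>0_def hK by (simp add: c_def v_def mult_ac)
        qed
        also have "\<dots> = (\<Sum>j\<in>?J. c j p * \<Phi>0 (p + v j))"
          by (subst sum.Sigma) (auto simp: split_def)
        finally show "\<Phi>0 p = (\<Sum>j\<in>?J. c j p * \<Phi>0 (p + v j))" .
      qed
    qed
  qed
  then show ?thesis unfolding dom[symmetric] \<Phi>0_def h_def by blast
qed

text \<open>All zeros lie on the finitely many real hyperplanes where some \<open>facet_form \<kappa>\<close> is real.\<close>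

lemma interior_rGamma_zeros:
  assumes K: "finite K" "\<forall>\<kappa>\<in>K. primitive_vec \<kappa>"
  shows "interior {p. (\<Prod>\<kappa>\<in>K. rGamma (facet_form \<kappa> p)) = 0} = {}"
proof -
  define H where "H \<kappa> = {p. Im (facet_form \<kappa> p) = 0}" for \<kappa>
  have closed: "closed (H \<kappa>)" for \<kappa>
    unfolding H_def by (intro closed_Collect_eq continuous_intros continuous_facet_form)
  have empty: "interior (H \<kappa>) = {}" if "\<kappa> \<in> K" for \<kappa>
  proof (rule ccontr)
    assume "interior (H \<kappa>) \<noteq> {}"
    then obtain p e where e: "0 < e" "ball p e \<subseteq> H \<kappa>" by (meson ex_in_conv mem_interior)
    have "real_vec \<kappa> \<noteq> 0" using that K(2) primitive_vec_nonzero by blast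
    then obtain j where j: "real_vec \<kappa> $ j \<noteq> 0" by (auto simp: vec_eq_iff)
    define v where "v = (axis j \<i> :: complex ^ 'n, 0 :: complex ^ 'm)"
    have v: "facet_form \<kappa> v = of_real (real_vec \<kappa> $ j) * \<i>"
      by (simp add: facet_form_def pairing_def v_def axis_def if_distrib[of "\<lambda>c. _ * c"] cong: if_cong)
    have nv: "norm v = 1" by (simp add: v_def norm_Pair)
    define q where "q = p + (e/2) *\<^sub>R v"
    have "dist p q = e / 2" using e(1) nv by (simp add: q_def dist_norm)
    then have "p \<in> H \<kappa>" "q \<in> H \<kappa>" using e by (auto intro!: subsetD[OF e(2)])
    moreover have "facet_form \<kappa> q = facet_form \<kappa> p + (e/2) *\<^sub>R facet_form \<kappa> v"
      unfolding q_def using linear_facet_form by (simp add: linear_add linear_scale)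
    ultimately show False using j e(1) by (simp add: H_def v)
  qed
  have "interior (\<Union>\<kappa>\<in>A. H \<kappa>) = {}" if "finite A" "A \<subseteq> K" for A
    using that
  proof (induction A)
    case (insert \<kappa> A)
    then show ?case
      using interior_closed_Un_empty_interior[OF closed[of \<kappa>], of "\<Union>\<kappa>\<in>A. H \<kappa>"] empty by simp
  qed simp
  from this[OF K(1) order.refl] have "interior (\<Union>\<kappa>\<in>K. H \<kappa>) = {}" .
  moreover have "{p. (\<Prod>\<kappa>\<in>K. rGamma (facet_form \<kappa> p)) = 0} \<subseteq> (\<Union>\<kappa>\<in>K. H \<kappa>)"
    using K(1) by (auto simp: rGamma_eq_zero_iff H_def elim!: nonpos_Ints_cases)
  ultimately show ?thesis using interior_mono by blast
qed

lemma euler_mellin_continuation: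
  assumes K: "finite K" "\<forall>\<kappa>\<in>K. primitive_vec \<kappa>" and pres: "minkowski_presentation f K"
  shows "\<exists>M \<Phi>. meromorphic_several_on M UNIV \<and>
        (\<forall>(s, t) \<in> convergence_domain f.
           set_integrable lborel orthant (euler_mellin_integrand L s t) \<and>
           M (s, t) = euler_mellin L s t) \<and>
        holomorphic_several_on \<Phi> UNIV \<and>
        (\<forall>s t. (\<forall>\<kappa>\<in>K. pairing (real_vec \<kappa>) s - pairing (support_vec f \<kappa>) t \<notin> \<int>\<^sub>\<le>\<^sub>0) \<longrightarrow>
           M (s, t) = \<Phi> (s, t) *
             (\<Prod>\<kappa>\<in>K. Gamma (pairing (real_vec \<kappa>) s - pairing (support_vec f \<kappa>) t)))"
proof -
  define h where "h p = (\<Prod>\<kappa>\<in>K. rGamma (facet_form \<kappa> p))" for p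
  obtain \<Phi> where \<Phi>: "\<And>p. complex_differentiable_at \<Phi> p"
    "\<And>p. p \<in> convergence_domain f \<Longrightarrow> \<Phi> p = mellin p * h p"
    using entire_quotient[OF K pres] unfolding h_def by blast
  have h: "complex_differentiable_at h p" for p
    unfolding h_def[abs_def]
    by (intro complex_differentiable_prod
        complex_differentiable_rGamma_facet_form)
  define M where "M p = \<Phi> p / h p" for p
  have holo: "holomorphic_several_on \<Phi> UNIV" "holomorphic_several_on h UNIV"
    using \<Phi>(1) h by (simp_all add: holomorphic_several_on_iff)
  have "meromorphic_several_on M UNIV"
    unfolding meromorphic_several_on_def
    using holo interior_rGamma_zeros[OF K]
    by (intro ballI exI[of _ UNIV] exI[of _ \<Phi>] exI[of _ h]) (simp add: M_def h_def)
  moreover have "\<forall>(s, t) \<in> convergence_domain f.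
           set_integrable lborel orthant (euler_mellin_integrand L s t) \<and> M (s, t) = euler_mellin L s t"
  proof safe
    fix s t assume st: "(s, t) \<in> convergence_domain f"
    show "set_integrable lborel orthant (euler_mellin_integrand L s t)" using euler_mellin_eq_mellin(1)[OF st] .
    have "rGamma (facet_form \<kappa> (s, t)) \<noteq> 0" if "\<kappa> \<in> K" for \<kappa>
    proof -
      have "0 < Re (facet_form \<kappa> (s, t))" using st that unfolding convergence_domain_iff[OF K pres] by blast
      then show ?thesis by (auto simp: rGamma_eq_zero_iff elim!: nonpos_Ints_cases)
    qed
    then have "h (s, t) \<noteq> 0" using K(1) by (simp add: h_def)
    then show "M (s, t) = euler_mellin L s t"
      using \<Phi>(2)[OF st] euler_mellin_eq_mellin(2)[OF st] by (simp add: M_def)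
  qed
  moreover have "M (s, t) = \<Phi> (s, t) * (\<Prod>\<kappa>\<in>K. Gamma (pairing (real_vec \<kappa>) s - pairing (support_vec f \<kappa>) t))" for s t
    by (simp add: M_def h_def facet_form_def rGamma_inverse_Gamma divide_inverse flip: prod_inversef)
  ultimately show ?thesis using holo by blast
qed

end

theorem theorem2p4:
  fixes f :: "'m::finite \<Rightarrow> 'n::finite cpoly"
    and L :: "'m \<Rightarrow> real ^ 'n \<Rightarrow> complex"
  assumes nonvanishing: "\<And>i. completely_nonvanishing_on (f i) (complex_vec ` orthant)"
    and full_dim: "aff_dim (newton_polytope (\<Prod>i\<in>UNIV. f i)) = int CARD('n)"
    and branches: "log_branches f L"
  shows "(\<exists>N \<mu> \<nu>. halfspace_presentations f N \<mu> \<nu> \<and> minkowski_presentation f (normals N \<mu>)) \<and>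
    (\<forall>N \<mu> \<nu>. halfspace_presentations f N \<mu> \<nu> \<and> minkowski_presentation f (normals N \<mu>) \<longrightarrow>
      (\<exists>M \<Phi>. meromorphic_several_on M UNIV \<and>
        (\<forall>(s, t) \<in> convergence_domain f.
           set_integrable lborel orthant (euler_mellin_integrand L s t) \<and>
           M (s, t) = euler_mellin L s t) \<and>
        holomorphic_several_on \<Phi> UNIV \<and>
        (\<forall>s t. (\<forall>\<kappa>\<in>normals N \<mu>.
                  pairing (real_vec \<kappa>) s - pairing (support_vec f \<kappa>) t \<notin> \<int>\<^sub>\<le>\<^sub>0) \<longrightarrow>
           M (s, t) = \<Phi> (s, t) *
             (\<Prod>\<kappa>\<in>normals N \<mu>.
                Gamma (pairing (real_vec \<kappa>) s - pairing (support_vec f \<kappa>) t)))))"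
proof -
  interpret log_branch_setting f L
    using nonvanishing branches by unfold_locales
  show ?thesis
  proof (rule conjI[OF halfspace_presentation_exists[OF f_nonzero]], intro allI impI)
    fix N \<mu> \<nu> assume pres: "halfspace_presentations f N \<mu> \<nu> \<and> minkowski_presentation f (normals N \<mu>)"
    have "normals N \<mu> = (\<Union>i. \<mu> i ` {1..N i})" unfolding normals_def by blast
    then have "finite (normals N \<mu>)" by simp
    moreover have "\<forall>\<kappa>\<in>normals N \<mu>. primitive_vec \<kappa>"
      using pres by (auto simp: halfspace_presentations_def normals_def)
    ultimately show "\<exists>M \<Phi>. meromorphic_several_on M UNIV \<and>
        (\<forall>(s, t) \<in> convergence_domain f.
           set_integrable lborel orthant (euler_mellin_integrand L s t) \<and>
           M (s, t) = euler_mellin L s t) \<and>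
        holomorphic_several_on \<Phi> UNIV \<and>
        (\<forall>s t. (\<forall>\<kappa>\<in>normals N \<mu>.
                  pairing (real_vec \<kappa>) s - pairing (support_vec f \<kappa>) t \<notin> \<int>\<^sub>\<le>\<^sub>0) \<longrightarrow>
           M (s, t) = \<Phi> (s, t) *
             (\<Prod>\<kappa>\<in>normals N \<mu>. Gamma (pairing (real_vec \<kappa>) s - pairing (support_vec f \<kappa>) t)))"
      using pres by (intro euler_mellin_continuation) auto
  qed
qed

end
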